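(* (i) Let $d=2$ or $d=3$. There exists a residual subset $\mathcal R\subset\mathrm{Vec}_0\mathbb T^d$ such that, for every $f\in\mathcal R$ and every integer $N\ge1$, the system $\dot x=f(x)+u(t)$, $u(t)\in\mathbb R^d$, is globally controllable in the space of $N$-ensembles in $\mathbb T^d$. (ii) For every $d\ge2$, $f\in\mathrm{Vec}_0\mathbb T^d$, $N\ge2$ and $T>0$, the system $\dot x=f(x)+u(t)$, $u(t)\in\mathbb R^d$, is not globally controllable in time smaller than or equal to $T$ in the space of $N$-ensembles in $\mathbb T^d$.
   Context: $\mathbb T^d=\mathbb R^d/2\pi\mathbb Z^d$, and $\mathrm{Vec}_0\mathbb T^d$ is the space of smooth divergence free vector fields on $\mathbb T^d$ with the $C^\infty$-topology; residual means containing a countable intersection of open dense subsets. $u\in\mathbb R^d$ is identified with a constant vector field. Controls $u(\cdot)$ are measurable and locally bounded, and $P_t^{u(\cdot)}$ denotes the flow at time $t$ of $\dot x=f(x)+u(t)$ started at time $0$. Let $(\hat{\mathbb T}^d)^N$ be the set of $N$-tuples of pairwise distinct points of $\mathbb T^d$. For $\gamma=(\gamma_1,\dots,\gamma_N)\in(\hat{\mathbb T}^d)^N$ and $t\ge0$ let $A_\gamma(t)=\{(P_t^{u(\cdot)}(\gamma_1),\dots,P_t^{u(\cdot)}(\gamma_N)): u(\cdot)\in L^\infty([0,t],\mathbb R^d)\}$. The system is globally controllable in the space of $N$-ensembles if $\bigcup_{t\ge0}A_\gamma(t)=(\hat{\mathbb T}^d)^N$ for every $\gamma\in(\hat{\mathbb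 T}^d)^N$; it is globally controllable in time smaller than or equal to $T$ in the space of $N$-ensembles if $\bigcup_{0\le t\le T}A_\gamma(t)=(\hat{\mathbb T}^d)^N$ for every $\gamma\in(\hat{\mathbb T}^d)^N$. *)

theory Defs
  imports "HOL-Analysis.Analysis"
begin

definition torus_rel :: "real ^ 'n \<Rightarrow> real ^ 'n \<Rightarrow> bool" where
  "torus_rel x y \<longleftrightarrow> (\<forall>i. \<exists>k::int. x $ i - y $ i = 2 * pi * of_int k)"

lemma equivp_torus_rel: "equivp torus_rel"
proof (rule equivpI)
  show "reflp torus_rel"
    by (rule reflpI) (auto simp: torus_rel_def intro: exI[of _ 0])
  show "symp torus_rel"
  proof (rule sympI)
    fix x y :: "real ^ 'n" assume xy: "torus_rel x y"
    show "torus_rel y x"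
      unfolding torus_rel_def
    proof
      fix i
      obtain k :: int where "x $ i - y $ i = 2 * pi * of_int k"
        using xy unfolding torus_rel_def by blast
      then have "y $ i - x $ i = 2 * pi * of_int (- k)" by simp
      then show "\<exists>k::int. y $ i - x $ i = 2 * pi * of_int k" by blast
    qed
  qed
  show "transp torus_rel"
  proof (rule transpI)
    fix x y z :: "real ^ 'n" assume xy: "torus_rel x y" and yz: "torus_rel y z"
    show "torus_rel x z"
      unfolding torus_rel_def
    proof
      fix i
      obtain k l :: int where "x $ i - y $ i = 2 * pi * of_int k"
          and "y $ i - z $ i = 2 * pi * of_int l"
        using xy yz unfolding torus_rel_def by blast
      then have "x $ i - z $ i = 2 * pi * of_int (k + l)"
        by (simp add: distrib_left)
      then show "\<exists>k::int. x $ i - z $ i = 2 * pi * of_int k" by blast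
    qed
  qed
qed

quotient_type 'n torus = "real ^ 'n" / torus_rel
  morphisms rep_torus torus_proj
  by (rule equivp_torus_rel)

(* The tangent bundle of the torus is trivial, so a vector field is a map from the torus to
   real ^ 'n.  Differentiation is done on the periodic lift. *)
type_synonym 'n vfield = "'n torus \<Rightarrow> real ^ 'n"

definition lift_field :: "('n::finite) vfield \<Rightarrow> real ^ 'n \<Rightarrow> real ^ 'n" where
  "lift_field f x = f (torus_proj x)"

definition partial_deriv :: "'n \<Rightarrow> (real ^ 'n \<Rightarrow> real ^ 'n) \<Rightarrow> real ^ ('n::finite) \<Rightarrow> real ^ 'n" where
  "partial_deriv i F x = frechet_derivative F (at x) (axis i 1)"

(* Lists of coordinate indices play the role of multi-indices; the order of differentiation
   is the length of the list. *)
primrec iter_partial_deriv ::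
    "'n list \<Rightarrow> (real ^ 'n \<Rightarrow> real ^ 'n) \<Rightarrow> real ^ ('n::finite) \<Rightarrow> real ^ 'n" where
  "iter_partial_deriv [] F = F"
| "iter_partial_deriv (i # is) F = partial_deriv i (iter_partial_deriv is F)"

definition smooth_field :: "('n::finite) vfield \<Rightarrow> bool" where
  "smooth_field f \<longleftrightarrow>
     (\<forall>is x. iter_partial_deriv is (lift_field f) differentiable (at x))"

definition divergence :: "('n::finite) vfield \<Rightarrow> real ^ 'n \<Rightarrow> real" where
  "divergence f x = (\<Sum>i\<in>UNIV. partial_deriv i (lift_field f) x $ i)"

definition Vec0 :: "('n::finite) vfield set" where
  "Vec0 = {f. smooth_field f \<and> (\<forall>x. divergence f x = 0)}"

definition Ck_close :: "nat \<Rightarrow> real \<Rightarrow> ('n::finite) vfield \<Rightarrow> 'n vfield \<Rightarrow> bool" where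
  "Ck_close k e f g \<longleftrightarrow>
     (\<forall>is x. length is \<le> k \<longrightarrow>
        norm (iter_partial_deriv is (lift_field g) x - iter_partial_deriv is (lift_field f) x) < e)"

(* The topology of uniform convergence of all partial derivatives. *)
definition Cinf_topology :: "('n::finite) vfield topology" where
  "Cinf_topology = topology (\<lambda>U. U \<subseteq> Vec0 \<and>
     (\<forall>f\<in>U. \<exists>k. \<exists>e>0. \<forall>g\<in>Vec0. Ck_close k e f g \<longrightarrow> g \<in> U))"

lemma Ck_close_mono: "Ck_close k e f g \<Longrightarrow> l \<le> k \<Longrightarrow> e \<le> e' \<Longrightarrow> Ck_close l e' f g"
  unfolding Ck_close_def by (meson le_trans less_le_trans)

lemma openin_Cinf_topology:
  "openin Cinf_topology U \<longleftrightarrow> U \<subseteq> Vec0 \<and>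
     (\<forall>f\<in>U. \<exists>k. \<exists>e>0. \<forall>g\<in>Vec0. Ck_close k e f g \<longrightarrow> g \<in> U)"
proof -
  let ?L = "\<lambda>U::'a vfield set. U \<subseteq> Vec0 \<and>
     (\<forall>f\<in>U. \<exists>k. \<exists>e>0. \<forall>g\<in>Vec0. Ck_close k e f g \<longrightarrow> g \<in> U)"
  have "istopology ?L"
    unfolding istopology_def
  proof (intro conjI allI impI)
    fix S T :: "'a vfield set" assume S: "?L S" and T: "?L T"
    show "S \<inter> T \<subseteq> Vec0" using S by blast
    show "\<forall>f\<in>S \<inter> T. \<exists>k. \<exists>e>0. \<forall>g\<in>Vec0. Ck_close k e f g \<longrightarrow> g \<in> S \<inter> T"
    proof
      fix f assume f: "f \<in> S \<inter> T"
      obtain k e where 1: "e > 0" "\<forall>g\<in>Vec0. Ck_close k e f g \<longrightarrow> g \<in> S"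
        using S f by blast
      obtain l d where 2: "d > 0" "\<forall>g\<in>Vec0. Ck_close l d f g \<longrightarrow> g \<in> T"
        using T f by blast
      have "\<forall>g\<in>Vec0. Ck_close (max k l) (min e d) f g \<longrightarrow> g \<in> S \<inter> T"
        using 1(2) 2(2) Ck_close_mono[of "max k l" "min e d" f]
        by (meson IntI max.cobounded1 max.cobounded2 min.cobounded1 min.cobounded2)
      moreover have "min e d > 0" using 1 2 by simp
      ultimately show "\<exists>k. \<exists>e>0. \<forall>g\<in>Vec0. Ck_close k e f g \<longrightarrow> g \<in> S \<inter> T" by blast
    qed
  next
    fix K :: "'a vfield set set" assume K: "\<forall>S\<in>K. ?L S"
    show "\<Union>K \<subseteq> Vec0" using K by blast
    show "\<forall>f\<in>\<Union>K. \<exists>k. \<exists>e>0. \<forall>g\<in>Vec0. Ck_close k e f g \<longrightarrow> g \<in> \<Union>K"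
      using K by (meson UnionE UnionI)
  qed
  then show ?thesis
    unfolding Cinf_topology_def by (simp add: topology_inverse')
qed

lemma topspace_Cinf_topology: "topspace Cinf_topology = Vec0"
proof
  show "topspace Cinf_topology \<subseteq> Vec0"
    using openin_topspace[of Cinf_topology] openin_Cinf_topology by blast
  have "openin Cinf_topology Vec0"
    unfolding openin_Cinf_topology by (auto intro: exI[of _ 1])
  then show "Vec0 \<subseteq> topspace Cinf_topology" by (rule openin_subset)
qed

definition residual_in :: "'a topology \<Rightarrow> 'a set \<Rightarrow> bool" where
  "residual_in X R \<longleftrightarrow> R \<subseteq> topspace X \<and>
     (\<exists>\<G>. countable \<G> \<and> (\<forall>U\<in>\<G>. openin X U \<and> X closure_of U = topspace X) \<and>
          topspace X \<inter> \<Inter>\<G> \<subseteq> R)"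

(* Representatives of the elements of the space L_infinity([0,t]). *)
definition admissible_control :: "real \<Rightarrow> (real \<Rightarrow> real ^ ('n::finite)) \<Rightarrow> bool" where
  "admissible_control t u \<longleftrightarrow>
     u \<in> borel_measurable (lebesgue_on {0..t}) \<and>
     (\<exists>B. AE s in lebesgue_on {0..t}. norm (u s) \<le> B)"

(* For merely measurable u a solution is understood in the sense of Caratheodory, that is,
   in integrated form; xi is a lift of the trajectory to the universal cover. *)
definition lifted_trajectory ::
    "('n::finite) vfield \<Rightarrow> (real \<Rightarrow> real ^ 'n) \<Rightarrow> real \<Rightarrow> (real \<Rightarrow> real ^ 'n) \<Rightarrow> bool" where
  "lifted_trajectory f u t \<xi> \<longleftrightarrow>
     (\<forall>s\<in>{0..t}. ((\<lambda>r. lift_field f (\<xi> r) + u r) has_integral (\<xi> s - \<xi> 0)) {0..s})"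

(* Trajectories exist and are unique when f is smooth and u is an admissible control on [0,t],
   and by periodicity of the lifted field the end point does not depend on the chosen lift. *)
definition flow ::
    "('n::finite) vfield \<Rightarrow> (real \<Rightarrow> real ^ 'n) \<Rightarrow> real \<Rightarrow> 'n torus \<Rightarrow> 'n torus" where
  "flow f u t p = (THE q. \<exists>\<xi>. lifted_trajectory f u t \<xi> \<and>
     torus_proj (\<xi> 0) = p \<and> torus_proj (\<xi> t) = q)"

definition ensembles :: "nat \<Rightarrow> ('n::finite) torus list set" where
  "ensembles N = {\<gamma>. length \<gamma> = N \<and> distinct \<gamma>}"

definition attainable :: "('n::finite) vfield \<Rightarrow> 'n torus list \<Rightarrow> real \<Rightarrow> 'n torus list set" where
  "attainable f \<gamma> t = {map (flow f u t) \<gamma> | u. admissible_control t u}"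

definition globally_controllable :: "('n::finite) vfield \<Rightarrow> nat \<Rightarrow> bool" where
  "globally_controllable f N \<longleftrightarrow>
     (\<forall>\<gamma>\<in>ensembles N. (\<Union>t\<in>{0..}. attainable f \<gamma> t) = ensembles N)"

definition globally_controllable_within :: "('n::finite) vfield \<Rightarrow> nat \<Rightarrow> real \<Rightarrow> bool" where
  "globally_controllable_within f N T \<longleftrightarrow>
     (\<forall>\<gamma>\<in>ensembles N. (\<Union>t\<in>{0..T}. attainable f \<gamma> t) = ensembles N)"

end

theory Submission
  imports Defs
begin

text \<open>
  Write \<open>F\<close> for the lift of \<open>f\<close> to \<open>\<real>\<^sup>d\<close>. A control acts on all points of an ensemble alike, so it
  cancels in the difference of two trajectories, and this difference grows or shrinks by a factor of
  at most \<open>exp (L t)\<close>, where \<open>L\<close> is a Lipschitz constant of \<open>F\<close>. Hence two points at distance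
  \<open>exp (- L T)\<close> cannot be brought to distance \<open>\<pi>\<close> within time \<open>T\<close>. This is part (ii).

  For part (i), a control \<open>a / \<delta>\<close> on a short time \<open>\<delta>\<close> translates the whole ensemble by about \<open>a\<close>. Moving
  there, waiting for a time \<open>s\<close> under a constant control \<open>- m\<close>, and moving back displaces the point
  \<open>\<gamma>\<^sub>j\<close> by about \<open>s (F (\<gamma>\<^sub>j + a) - m)\<close>. So the ensemble can be pushed along every nonnegative combination
  of the vectors \<open>(F (\<gamma>\<^sub>j + a) - m)\<^sub>j\<close>, \<open>a \<in> \<real>\<^sup>d\<close>, and it suffices that these vectors span all directions
  positively. Two facts give this.

  \<^item> Spanning. For generic \<open>f\<close> and each \<open>i\<close> there are finite combinations of translates of \<open>F\<close> close to the
    basis vector \<open>e\<^sub>i\<close> at the origin and close to 0 away from the lattice (\<open>separates_points\<close>); shifted to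
    \<open>\<gamma>\<^sub>j\<close>, such a combination moves the \<open>j\<close>-th point alone. One combination serves a whole neighbourhood
    of \<open>f\<close>, which gives openness. For density, add to \<open>f\<close> a small multiple \<open>\<epsilon> h\<close> of a divergence free
    trigonometric field \<open>h\<close> equal to \<open>B(x) cos (\<Lambda> x\<^sub>l) e\<^sub>i + O(1/\<Lambda>)\<close>, where \<open>B\<close> is concentrated near the
    lattice. The finite difference of order \<open>k + 1\<close> and step \<open>\<pi>/\<Lambda>\<close> in direction \<open>l\<close> preserves the
    wave but reduces \<open>F\<close> to \<open>O(\<Lambda>^(-k-1))\<close>, whereas a \<open>C\<^sup>k\<close>-small perturbation may have
    \<open>\<epsilon>\<close> of order \<open>\<Lambda>^(-k)\<close>. So \<open>h\<close> dominates for large \<open>\<Lambda>\<close> (\<open>dense_delta_fields\<close>).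

  \<^item> Signs. Take for \<open>m\<close> the mean of \<open>F\<close> over the torus. The average of all translates of \<open>F - m\<close> is 0,
    so \<open>- (F - m)\<close> is a uniform limit of nonnegative combinations of translates of \<open>F - m\<close>
    (\<open>minus_field_from_translates\<close>).

  The times spent at the various translates are then chosen by a contraction argument, which hits a
  target exactly: all ensembles near a given one are reachable from each other (\<open>local_reach\<close>). Finally
  one point at a time is moved along the complement of countably many points, which is connected for
  \<open>d \<ge> 2\<close> (\<open>reach_all\<close>).
\<close>

section \<open>The torus and its smooth fields\<close>

definition period_lattice :: "(real ^ 'n) set" where
  "period_lattice = {k. \<forall>i. \<exists>n::int. k $ i = 2 * pi * of_int n}"

lemma torus_rel_iff: "torus_rel x y \<longleftrightarrow> x - y \<in> period_lattice"
  by (simp add: torus_rel_def period_lattice_def)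

lemma torus_proj_eq_iff: "torus_proj x = torus_proj y \<longleftrightarrow> x - y \<in> period_lattice"
  using torus.abs_eq_iff torus_rel_iff by metis

lemma torus_proj_rep [simp]: "torus_proj (rep_torus p) = p"
  by (rule Quotient_abs_rep[OF Quotient_torus])

lemma period_lattice_zero [simp]: "0 \<in> period_lattice"
  using torus_proj_eq_iff[of 0 0] by simp

lemma period_lattice_uminus: "k \<in> period_lattice \<Longrightarrow> - k \<in> period_lattice"
  using torus_proj_eq_iff[of k 0] torus_proj_eq_iff[of 0 k] by simp

lemma torus_proj_add_lattice: "k \<in> period_lattice \<Longrightarrow> torus_proj (x + k) = torus_proj x"
  by (simp add: torus_proj_eq_iff)

lemma lift_field_periodic: "k \<in> period_lattice \<Longrightarrow> lift_field f (x + k) = lift_field f x"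
  by (simp add: lift_field_def torus_proj_add_lattice)

lemma obtain_lattice_box:
  fixes x :: "real ^ 'n::finite"
  obtains k where "k \<in> period_lattice" "x + k \<in> cbox 0 (\<chi> i. 2 * pi)"
proof
  define k :: "real ^ 'n" where "k = (\<chi> i. 2 * pi * of_int (- \<lfloor>x $ i / (2 * pi)\<rfloor>))"
  show "k \<in> period_lattice"
    unfolding period_lattice_def k_def by (simp, metis of_int_minus mult_minus_right)
  have "0 \<le> x $ i + k $ i \<and> x $ i + k $ i \<le> 2 * pi" for i
  proof -
    have "of_int \<lfloor>x $ i / (2 * pi)\<rfloor> * (2 * pi) \<le> x $ i"
      using mult_right_mono[OF of_int_floor_le[of "x $ i / (2 * pi)"], of "2 * pi"] by simp
    moreover have "x $ i \<le> (of_int \<lfloor>x $ i / (2 * pi)\<rfloor> + 1) * (2 * pi)"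
      using mult_right_mono[OF real_of_int_floor_add_one_ge[of "x $ i / (2 * pi)"], of "2 * pi"] by simp
    ultimately show ?thesis
      by (simp add: k_def algebra_simps)
  qed
  then show "x + k \<in> cbox 0 (\<chi> i. 2 * pi)"
    by (simp add: mem_box_cart)
qed

lemma periodic_continuous_bounded:
  fixes G :: "real ^ 'n::finite \<Rightarrow> 'b::real_normed_vector"
  assumes "continuous_on UNIV G" and "\<And>x k. k \<in> period_lattice \<Longrightarrow> G (x + k) = G x"
  shows "\<exists>B>0. \<forall>x. norm (G x) \<le> B"
proof -
  have "compact (G ` cbox 0 (\<chi> i. 2 * pi))"
    using assms(1) by (meson compact_cbox compact_continuous_image continuous_on_subset subset_UNIV)
  then obtain B where B: "B > 0" "\<And>y. y \<in> G ` cbox 0 (\<chi> i. 2 * pi) \<Longrightarrow> norm y \<le> B"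
    using bounded_pos compact_imp_bounded by metis
  have "norm (G x) \<le> B" for x
  proof -
    obtain k where "k \<in> period_lattice" "x + k \<in> cbox 0 (\<chi> i. 2 * pi)"
      using obtain_lattice_box .
    then show ?thesis
      using B(2)[of "G (x + k)"] assms(2)[of k x] by (metis imageI)
  qed
  with B(1) show ?thesis by blast
qed

text \<open>
  The derivative is a choice among the maps that satisfy a predicate; periodicity makes this predicate
  the same at both points, so the choices agree even where there is no derivative.
\<close>

lemma frechet_derivative_shift:
  fixes G :: "'a::real_normed_vector \<Rightarrow> 'b::real_normed_vector"
  assumes "\<And>y. G (y + k) = G y"
  shows "frechet_derivative G (at (x + k)) = frechet_derivative G (at x)"
proof -
  have shift: "(H has_derivative D) (at (y - c))" 
    if H: "(H has_derivative D) (at y)" and per: "\<And>z. H (z + c) = H z"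
    for H :: "'a \<Rightarrow> 'b" and D y c
  proof -
    have "((\<lambda>z. H (z + c)) has_derivative D) (at (y - c))"
      by (rule has_derivative_compose[of "\<lambda>z. z + c" "\<lambda>z. z" "y - c" UNIV H D, simplified])
        (auto intro!: derivative_eq_intros simp: H)
    then show ?thesis by (simp add: per)
  qed
  have "(G has_derivative D) (at (x + k)) \<longleftrightarrow> (G has_derivative D) (at x)" for D
    using shift[of G D "x + k" k] shift[of G D x "- k"] assms
    by (metis add_diff_cancel_right' diff_minus_eq_add minus_add_cancel add.commute)
  then show ?thesis
    unfolding frechet_derivative_def by simp
qed

lemma iter_partial_deriv_periodic:
  assumes "\<And>y. F (y + k) = F y"
  shows "iter_partial_deriv is F (x + k) = iter_partial_deriv is F x"
proof (induction "is" arbitrary: x)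
  case (Cons i "is")
  show ?case
    using frechet_derivative_shift[where G = "iter_partial_deriv is F" and k = k, OF Cons.IH]
    by (simp add: partial_deriv_def)
qed (simp add: assms)

lemma smooth_field_differentiable:
  "smooth_field f \<Longrightarrow> iter_partial_deriv is (lift_field f) differentiable at x"
  by (simp add: smooth_field_def)

text \<open>
  Continuity and periodicity reduce boundedness to a compact period box.
\<close>

lemma smooth_field_iter_bounded:
  assumes "smooth_field f"
  shows "\<exists>B>0. \<forall>x. norm (iter_partial_deriv is (lift_field f) x) \<le> B"
proof (rule periodic_continuous_bounded)
  show "continuous_on UNIV (iter_partial_deriv is (lift_field f))"
    using smooth_field_differentiable[OF assms]
    by (simp add: continuous_at_imp_continuous_on differentiable_imp_continuous_within)
  show "iter_partial_deriv is (lift_field f) (x + k) = iter_partial_deriv is (lift_field f) x"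
    if "k \<in> period_lattice" for x k
    by (rule iter_partial_deriv_periodic) (simp add: lift_field_periodic that)
qed

lemma smooth_field_lipschitz:
  fixes f :: "('n::finite) vfield"
  assumes "smooth_field f"
  shows "\<exists>L>0. \<forall>x y. norm (lift_field f x - lift_field f y) \<le> L * norm (x - y)"
proof -
  let ?F = "lift_field f"
  have "\<forall>i. \<exists>B>0. \<forall>x. norm (partial_deriv i ?F x) \<le> B"
    using smooth_field_iter_bounded[OF assms, of "[_]"] by simp
  then obtain B where B: "\<And>i. B i > 0" "\<And>i x. norm (partial_deriv i ?F x) \<le> B i"
    by metis
  define L where "L = (\<Sum>i\<in>UNIV. B i)"
  have D: "(?F has_derivative frechet_derivative ?F (at x)) (at x)" for x
    using smooth_field_differentiable[OF assms, of "[]" x] frechet_derivative_works by auto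
  have "norm (frechet_derivative ?F (at x) v) \<le> L * norm v" for x v
  proof -
    have lin: "linear (frechet_derivative ?F (at x))"
      using D has_derivative_linear by blast
    have "v = (\<Sum>i\<in>UNIV. v $ i *\<^sub>R axis i 1)"
      using basis_expansion[of v] by (simp add: scalar_mult_eq_scaleR)
    then have "frechet_derivative ?F (at x) v
        = (\<Sum>i\<in>UNIV. frechet_derivative ?F (at x) (v $ i *\<^sub>R axis i 1))"
      using linear_sum[OF lin, of "\<lambda>i. v $ i *\<^sub>R axis i 1" UNIV] by simp
    also have "\<dots> = (\<Sum>i\<in>UNIV. v $ i *\<^sub>R partial_deriv i ?F x)"
      by (simp add: linear_scale[OF lin] partial_deriv_def)
    also have "norm \<dots> \<le> (\<Sum>i\<in>UNIV. norm v * B i)"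
      by (intro sum_norm_le) (simp add: B(2) component_le_norm_cart mult_mono)
    finally show ?thesis
      by (simp add: L_def sum_distrib_left mult.commute)
  qed
  then have "norm (?F x - ?F y) \<le> L * norm (x - y)" for x y
    using differentiable_bound[of UNIV ?F "\<lambda>x. frechet_derivative ?F (at x)" L x y] D
    by (simp add: onorm_le)
  moreover have "L > 0"
    unfolding L_def using B(1) by (intro sum_pos) auto
  ultimately show ?thesis by blast
qed

section \<open>Ordinary differential equations\<close>

text \<open>
  Picard iteration on the whole interval at once: for \<open>w(s) = exp (- 2 L s) y(s)\<close> the integral operator
  is a contraction with factor \<open>1/2\<close>, whatever the length of the interval. Functions on \<open>{0..t}\<close>
  become bounded continuous functions on \<open>\<real>\<close> by clamping the argument to \<open>{0..t}\<close>.
\<close>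

lemma picard_existence:
  fixes G :: "real \<Rightarrow> 'a::euclidean_space \<Rightarrow> 'a"
  assumes t: "0 \<le> t" and L: "L > 0"
    and cont: "\<And>y. continuous_on {0..t} y \<Longrightarrow> continuous_on {0..t} (\<lambda>r. G r (y r))"
    and lip: "\<And>r a b. norm (G r a - G r b) \<le> L * norm (a - b)"
  shows "\<exists>y. continuous_on {0..t} y \<and>
    (\<forall>s\<in>{0..t}. ((\<lambda>r. G r (y r)) has_integral (y s - x)) {0..s})"
proof -
  define c where "c s = min t (max 0 s)" for s :: real
  have c: "0 \<le> c s" "c s \<le> t" for s
    using t by (auto simp: c_def)
  have c_id: "c s = s" if "s \<in> {0..t}" for s
    using that by (auto simp: c_def)
  have cont_c: "continuous_on UNIV c"
    unfolding c_def by (intro continuous_intros)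
  define E where "E w r = G r (exp (2 * L * r) *\<^sub>R apply_bcontfun w r)" for w :: "real \<Rightarrow>\<^sub>C 'a" and r
  have contE: "continuous_on {0..t} (E w)" for w
    unfolding E_def by (rule cont) (intro continuous_intros continuous_on_apply_bcontfun)
  have intE: "E w integrable_on {0..c s}" for w s
    using contE[of w] c by (meson atLeastatMost_subset_iff continuous_on_subset integrable_continuous_interval order_refl)
  define Q where "Q w s = exp (- (2 * L * s)) *\<^sub>R (x + integral {0..s} (E w))" for w s
  have "(\<lambda>s. Q w (c s)) \<in> bcontfun" for w
  proof -
    have Q: "continuous_on {0..t} (Q w)"
      unfolding Q_def
      by (intro continuous_intros indefinite_integral_continuous_1 integrable_continuous_interval contE)
    then have "continuous_on UNIV (\<lambda>s. Q w (c s))"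
      by (rule continuous_on_compose2[OF _ cont_c]) (use c in auto)
    moreover have "bounded (Q w ` {0..t})"
      using Q compact_continuous_image compact_imp_bounded by blast
    then have "bounded (range (\<lambda>s. Q w (c s)))"
      by (rule bounded_subset) (use c in auto)
    ultimately show ?thesis by (simp add: bcontfun_def)
  qed
  then have ap: "apply_bcontfun (Bcontfun (\<lambda>s. Q w (c s))) s = Q w (c s)" for w s
    by (simp add: Bcontfun_inverse)
  have contr: "dist (Bcontfun (\<lambda>s. Q w (c s))) (Bcontfun (\<lambda>s. Q w' (c s))) \<le> 1/2 * dist w w'" for w w'
  proof (rule dist_bound)
    fix s
    let ?s = "c s"
    \<comment> \<open>the weight \<open>exp (2 L r)\<close> integrates to at most \<open>1 / (2 L)\<close> times its value at \<open>s\<close>, which gives the contraction factor \<open>1/2\<close>\<close>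
    have fund: "((\<lambda>r. exp (2 * L * r) * L * dist w w') has_integral
        (exp (2 * L * ?s) * (dist w w' / 2) - exp (2 * L * 0) * (dist w w' / 2))) {0..?s}"
      using c(1)[of s]
      by (intro fundamental_theorem_of_calculus)
        (auto intro!: derivative_eq_intros simp flip: has_real_derivative_iff_has_vector_derivative)
    have "norm (integral {0..?s} (\<lambda>r. E w r - E w' r)) \<le> integral {0..?s} (\<lambda>r. exp (2 * L * r) * L * dist w w')"
    proof (rule integral_norm_bound_integral)
      show "(\<lambda>r. E w r - E w' r) integrable_on {0..?s}"
        by (intro integrable_diff intE)
      show "(\<lambda>r. exp (2 * L * r) * L * dist w w') integrable_on {0..?s}"
        using fund by blast
      fix r
      have "norm (E w r - E w' r) \<le> L * norm (exp (2 * L * r) *\<^sub>R (apply_bcontfun w r - apply_bcontfun w' r))"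
        unfolding E_def using lip[of r "exp (2 * L * r) *\<^sub>R apply_bcontfun w r" "exp (2 * L * r) *\<^sub>R apply_bcontfun w' r"]
        by (simp add: scaleR_diff_right)
      also have "\<dots> = exp (2 * L * r) * L * dist (apply_bcontfun w r) (apply_bcontfun w' r)"
        by (simp add: dist_norm)
      also have "\<dots> \<le> exp (2 * L * r) * L * dist w w'"
        using L dist_bounded[of w r w'] by (intro mult_left_mono) auto
      finally show "norm (E w r - E w' r) \<le> exp (2 * L * r) * L * dist w w'" .
    qed
    also have "\<dots> \<le> exp (2 * L * ?s) * (dist w w' / 2)"
      using integral_unique[OF fund] by simp
    finally have I: "norm (integral {0..?s} (\<lambda>r. E w r - E w' r)) \<le> exp (2 * L * ?s) * (dist w w' / 2)" .
    have "Q w ?s - Q w' ?s = exp (- (2 * L * ?s)) *\<^sub>R integral {0..?s} (\<lambda>r. E w r - E w' r)"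
      unfolding Q_def integral_diff[OF intE intE] by (simp add: algebra_simps)
    then have "dist (Q w ?s) (Q w' ?s) = exp (- (2 * L * ?s)) * norm (integral {0..?s} (\<lambda>r. E w r - E w' r))"
      by (simp add: dist_norm)
    also have "\<dots> \<le> exp (- (2 * L * ?s)) * (exp (2 * L * ?s) * (dist w w' / 2))"
      using I by (intro mult_left_mono) auto
    also have "\<dots> = 1/2 * dist w w'"
      by (simp flip: exp_add mult.assoc)
    finally show "dist (apply_bcontfun (Bcontfun (\<lambda>s. Q w (c s))) s) (apply_bcontfun (Bcontfun (\<lambda>s. Q w' (c s))) s)
        \<le> 1/2 * dist w w'"
      by (simp add: ap)
  qed
  have "\<exists>!w. Bcontfun (\<lambda>s. Q w (c s)) = w"
    by (rule banach_fix_type[of "1/2"]) (use contr in auto)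
  then obtain w where w: "Bcontfun (\<lambda>s. Q w (c s)) = w" by blast
  have wQ: "apply_bcontfun w s = Q w s" if "s \<in> {0..t}" for s
    using ap[of w s] w c_id[OF that] by simp
  define y where "y s = exp (2 * L * s) *\<^sub>R apply_bcontfun w s" for s
  have yE: "(\<lambda>r. G r (y r)) = E w"
    by (simp add: y_def E_def fun_eq_iff)
  show ?thesis
  proof (intro exI conjI ballI)
    show "continuous_on {0..t} y"
      unfolding y_def by (intro continuous_intros continuous_on_apply_bcontfun)
    fix s assume s: "s \<in> {0..t}"
    have "y s = x + integral {0..s} (E w)"
      by (simp add: y_def wQ[OF s] Q_def flip: exp_add)
    then have "y s - x = integral {0..s} (E w)" by simp
    then show "((\<lambda>r. G r (y r)) has_integral (y s - x)) {0..s}"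
      unfolding yE using intE[of w s] c_id[OF s] by (simp add: integrable_integral)
  qed
qed

text \<open>
  Gronwall in both time directions, from the monotonicity of \<open>exp (\<plusminus> 2 L s) |e(s)|\<^sup>2\<close>. The second bound gives
  uniqueness backwards in time, that is, injectivity of the flow.
\<close>

lemma linear_growth_bounds:
  fixes e h :: "real \<Rightarrow> 'a::euclidean_space"
  assumes int: "\<And>s. s \<in> {0..t} \<Longrightarrow> (h has_integral (e s - e 0)) {0..s}"
    and cont: "continuous_on {0..t} h"
    and bound: "\<And>s. s \<in> {0..t} \<Longrightarrow> norm (h s) \<le> L * norm (e s)"
    and s: "s \<in> {0..t}"
  shows "norm (e s) \<le> exp (L * s) * norm (e 0)" "norm (e 0) \<le> exp (L * s) * norm (e s)"
proof -
  have der: "(e has_vector_derivative h r) (at r within {0..s})" if r: "r \<in> {0..s}" for r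
  proof -
    have c: "continuous_on {0..s} h"
      using cont s by (meson atLeastatMost_subset_iff continuous_on_subset atLeastAtMost_iff order_refl)
    have "((\<lambda>u. integral {0..u} h) has_vector_derivative h r) (at r within {0..s})"
      using integral_has_vector_derivative[OF c r] .
    then have d0: "((\<lambda>u. e 0 + integral {0..u} h) has_vector_derivative h r) (at r within {0..s})"
      by (rule has_vector_derivative_add[OF has_vector_derivative_const, simplified])
    have eq: "e 0 + integral {0..u} h = e u" if "u \<in> {0..s}" for u
      using int[of u] that s by (simp add: integral_unique)
    show ?thesis
      by (rule has_vector_derivative_transform[OF r eq[symmetric] d0])
  qed
  have d2: "((\<lambda>r. exp (c * r) * (e r \<bullet> e r)) has_vector_derivative
      exp (c * r) * (2 * (h r \<bullet> e r) + c * (e r \<bullet> e r))) (at r within {0..s})" if r: "r \<in> {0..s}" for r c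
  proof -
    have "((\<lambda>r. e r \<bullet> e r) has_vector_derivative (e r \<bullet> h r + h r \<bullet> e r)) (at r within {0..s})"
      by (rule bounded_bilinear.has_vector_derivative[OF bounded_bilinear_inner der[OF r] der[OF r]])
    then have "((\<lambda>r. e r \<bullet> e r) has_real_derivative (2 * (h r \<bullet> e r))) (at r within {0..s})"
      by (simp add: has_real_derivative_iff_has_vector_derivative inner_commute)
    then have "((\<lambda>r. exp (c * r) * (e r \<bullet> e r)) has_real_derivative
        exp (c * r) * c * (e r \<bullet> e r) + (2 * (h r \<bullet> e r)) * exp (c * r)) (at r within {0..s})"
      by (intro DERIV_mult) (auto intro!: derivative_eq_intros)
    then show ?thesis
      by (simp add: has_real_derivative_iff_has_vector_derivative algebra_simps)
  qed
  have hb: "\<bar>h r \<bullet> e r\<bar> \<le> L * (e r \<bullet> e r)" if "r \<in> {0..s}" for r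
  proof -
    have "\<bar>h r \<bullet> e r\<bar> \<le> norm (h r) * norm (e r)"
      by (rule Cauchy_Schwarz_ineq2)
    also have "\<dots> \<le> L * norm (e r) * norm (e r)"
      using bound[of r] that s by (intro mult_right_mono) auto
    finally show ?thesis by (simp add: dot_square_norm power2_eq_square)
  qed
  have s0: "0 \<le> s" using s by simp
  have int2: "((\<lambda>r. exp (c * r) * (2 * (h r \<bullet> e r) + c * (e r \<bullet> e r))) has_integral
      (exp (c * s) * (e s \<bullet> e s) - exp (c * 0) * (e 0 \<bullet> e 0))) {0..s}" for c
    by (rule fundamental_theorem_of_calculus[OF s0 d2])
  have up: "e 0 \<bullet> e 0 \<le> exp (2 * L * s) * (e s \<bullet> e s)"
  proof -
    have "0 \<le> exp (2 * L * s) * (e s \<bullet> e s) - exp (2 * L * 0) * (e 0 \<bullet> e 0)"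
    proof (rule has_integral_nonneg[OF int2[of "2 * L"]])
      fix r assume "r \<in> {0..s}"
      then show "0 \<le> exp (2 * L * r) * (2 * (h r \<bullet> e r) + 2 * L * (e r \<bullet> e r))"
        using hb[of r] by (intro mult_nonneg_nonneg) (auto simp: abs_le_iff)
    qed
    then show ?thesis by simp
  qed
  have dn: "e s \<bullet> e s \<le> exp (2 * L * s) * (e 0 \<bullet> e 0)"
  proof -
    have "0 \<le> - (exp (-2 * L * s) * (e s \<bullet> e s) - exp (-2 * L * 0) * (e 0 \<bullet> e 0))"
    proof (rule has_integral_nonneg[OF has_integral_neg[OF int2[of "-2 * L"]]])
      fix r assume "r \<in> {0..s}"
      then have "exp (-2 * L * r) * (2 * (h r \<bullet> e r) + -2 * L * (e r \<bullet> e r)) \<le> 0"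
        using hb[of r] by (intro mult_nonneg_nonpos) (auto simp: abs_le_iff)
      then show "0 \<le> - (exp (-2 * L * r) * (2 * (h r \<bullet> e r) + -2 * L * (e r \<bullet> e r)))"
        by simp
    qed
    then have "exp (2 * L * s) * (exp (-2 * L * s) * (e s \<bullet> e s)) \<le> exp (2 * L * s) * (e 0 \<bullet> e 0)"
      by (intro mult_left_mono) auto
    then show ?thesis by (simp flip: exp_add mult.assoc)
  qed
  have sq: "norm a \<le> exp (L * s) * norm b" if "a \<bullet> a \<le> exp (2 * L * s) * (b \<bullet> b)" for a b :: 'a
  proof -
    have "(norm a)\<^sup>2 \<le> (exp (L * s) * norm b)\<^sup>2"
      using that by (simp add: dot_square_norm power_mult_distrib exp_double[symmetric] mult.assoc)
    then show ?thesis by (rule power2_le_imp_le) simp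
  qed
  show "norm (e s) \<le> exp (L * s) * norm (e 0)" "norm (e 0) \<le> exp (L * s) * norm (e s)"
    using sq up dn by auto
qed

section \<open>Trajectories, flows and reachability\<close>

text \<open>
  The two constants through which the smoothness of \<open>f\<close> enters the control part of the argument.
\<close>

locale drift =
  fixes f :: "('n::finite) vfield" and L M :: real
  assumes L_pos: "L > 0" and M_pos: "M > 0"
    and lip: "\<And>x y. norm (lift_field f x - lift_field f y) \<le> L * norm (x - y)"
    and bnd: "\<And>x. norm (lift_field f x) \<le> M"
begin

abbreviation F :: "real ^ 'n \<Rightarrow> real ^ 'n" where "F \<equiv> lift_field f"

lemma continuous_F: "continuous_on S F"
  using lip L_pos by (intro lipschitz_on_continuous_on[of L] lipschitz_onI) (auto simp: dist_norm)

lemma continuous_F_compose: "continuous_on S \<xi> \<Longrightarrow> continuous_on S (\<lambda>r. F (\<xi> r))"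
  by (rule continuous_on_compose2[OF continuous_F]) auto

lemma trajectory_continuous:
  assumes "lifted_trajectory f u t \<xi>"
  shows "continuous_on {0..t} \<xi>"
proof (cases "0 \<le> t")
  case True
  let ?g = "\<lambda>r. F (\<xi> r) + u r"
  have "?g integrable_on {0..t}"
    using assms True unfolding lifted_trajectory_def by auto
  then have "continuous_on {0..t} (\<lambda>s. \<xi> 0 + integral {0..s} ?g)"
    by (intro continuous_intros indefinite_integral_continuous_1)
  moreover have "\<xi> 0 + integral {0..s} ?g = \<xi> s" if "s \<in> {0..t}" for s
    using integral_unique[of ?g "\<xi> s - \<xi> 0" "{0..s}"] assms that unfolding lifted_trajectory_def by simp
  ultimately show ?thesis
    by (rule continuous_on_eq)
qed auto

lemma trajectories_difference:
  assumes "lifted_trajectory f u t \<xi>" "lifted_trajectory f u t \<xi>'" "s \<in> {0..t}"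
  shows "((\<lambda>r. F (\<xi> r) - F (\<xi>' r)) has_integral ((\<xi> s - \<xi>' s) - (\<xi> 0 - \<xi>' 0))) {0..s}"
proof -
  have "((\<lambda>r. (F (\<xi> r) + u r) - (F (\<xi>' r) + u r)) has_integral ((\<xi> s - \<xi> 0) - (\<xi>' s - \<xi>' 0))) {0..s}"
    using assms unfolding lifted_trajectory_def by (intro has_integral_diff) auto
  then show ?thesis
    by (simp add: algebra_simps)
qed

lemma trajectories_separation:
  assumes "lifted_trajectory f u t \<xi>" "lifted_trajectory f u t \<xi>'" "s \<in> {0..t}"
  shows "norm (\<xi> s - \<xi>' s) \<le> exp (L * s) * norm (\<xi> 0 - \<xi>' 0)"
    and "norm (\<xi> 0 - \<xi>' 0) \<le> exp (L * s) * norm (\<xi> s - \<xi>' s)"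
proof -
  have cont: "continuous_on {0..t} (\<lambda>r. F (\<xi> r) - F (\<xi>' r))"
    using assms trajectory_continuous by (intro continuous_on_diff continuous_F_compose)
  note growth = linear_growth_bounds[where e = "\<lambda>s. \<xi> s - \<xi>' s",
      OF trajectories_difference[OF assms(1,2)] cont lip assms(3)]
  show "norm (\<xi> s - \<xi>' s) \<le> exp (L * s) * norm (\<xi> 0 - \<xi>' 0)"
    and "norm (\<xi> 0 - \<xi>' 0) \<le> exp (L * s) * norm (\<xi> s - \<xi>' s)"
    using growth by auto
qed

text \<open>
  Subtracting the continuous function \<open>v(s) = \<integral>\<^sub>0\<^sup>s u\<close> turns the equation for a measurable control into
  \<open>y' = F (y + v)\<close>, whose right-hand side is continuous in time.
\<close>

lemma trajectory_exists:
  assumes u: "admissible_control t u" and t: "0 \<le> t"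
  shows "\<exists>\<xi>. lifted_trajectory f u t \<xi> \<and> \<xi> 0 = x"
proof -
  obtain B where B: "AE s in lebesgue_on {0..t}. norm (u s) \<le> B"
    and m: "u \<in> borel_measurable (lebesgue_on {0..t})"
    using u unfolding admissible_control_def by blast
  interpret finite_measure "lebesgue_on {0..t}"
    by (rule finite_measure_lebesgue_on) simp
  have u_int: "u integrable_on {0..t}"
    using integrable_const_bound[OF B m] by (rule integrable_on_lebesgue_on) simp
  define v where "v s = integral {0..s} u" for s
  have v: "(u has_integral v s) {0..s}" if "s \<in> {0..t}" for s
    using u_int that unfolding v_def
    by (meson atLeastAtMost_iff atLeastatMost_subset_iff integrable_integral integrable_on_subinterval order_refl)
  have "\<exists>y. continuous_on {0..t} y \<and>
    (\<forall>s\<in>{0..t}. ((\<lambda>r. F (y r + v r)) has_integral (y s - x)) {0..s})"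
  proof (rule picard_existence[OF t L_pos])
    show "continuous_on {0..t} (\<lambda>r. F (y r + v r))" if "continuous_on {0..t} y" for y
      unfolding v_def
      by (intro continuous_F_compose continuous_intros that indefinite_integral_continuous_1 u_int)
    show "norm (F (a + v r) - F (b + v r)) \<le> L * norm (a - b)" for r a b
      using lip[of "a + v r" "b + v r"] by simp
  qed
  then obtain y where y: "\<And>s. s \<in> {0..t} \<Longrightarrow> ((\<lambda>r. F (y r + v r)) has_integral (y s - x)) {0..s}"
    by blast
  have y0: "y 0 = x"
    using y[of 0] t has_integral_unique[OF _ has_integral_refl(2)] by fastforce
  have v0: "v 0 = 0"
    by (simp add: v_def)
  have "((\<lambda>r. F (y r + v r) + u r) has_integral ((y s + v s) - (y 0 + v 0))) {0..s}" if "s \<in> {0..t}" for s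
    using has_integral_add[OF y[OF that] v[OF that]] by (simp add: y0 v0 algebra_simps)
  then have "lifted_trajectory f u t (\<lambda>s. y s + v s)"
    unfolding lifted_trajectory_def by blast
  then show ?thesis
    using y0 v0 by (intro exI[of _ "\<lambda>s. y s + v s"]) simp
qed

lemma trajectory_lattice_shift:
  assumes "lifted_trajectory f u t \<xi>" "k \<in> period_lattice"
  shows "lifted_trajectory f u t (\<lambda>s. \<xi> s + k)"
  using assms unfolding lifted_trajectory_def by (simp add: lift_field_periodic)

text \<open>
  Shift one trajectory by the lattice vector that makes two of the endpoints coincide; the Gronwall
  bounds then force the other endpoints to coincide as well.
\<close>

lemma trajectories_endpoints_iff:
  assumes "lifted_trajectory f u t \<xi>" "lifted_trajectory f u t \<xi>'" "0 \<le> t"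
  shows "torus_proj (\<xi> 0) = torus_proj (\<xi>' 0) \<longleftrightarrow> torus_proj (\<xi> t) = torus_proj (\<xi>' t)"
proof -
  have *: "\<xi> 0 = \<xi>' 0 + k \<longleftrightarrow> \<xi> t = \<xi>' t + k" if "k \<in> period_lattice" for k
    using trajectories_separation[OF assms(1) trajectory_lattice_shift[OF assms(2) that], of t] assms(3)
    by auto
  have "torus_proj x = torus_proj y \<longleftrightarrow> (\<exists>k\<in>period_lattice. x = y + k)" for x y :: "real ^ 'n"
    unfolding torus_proj_eq_iff by (metis add.commute add_diff_cancel_right' diff_add_cancel)
  then show ?thesis
    using * by simp
qed

lemma flow_eq:
  assumes "lifted_trajectory f u t \<xi>" "0 \<le> t"
  shows "flow f u t (torus_proj (\<xi> 0)) = torus_proj (\<xi> t)"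
  unfolding flow_def
proof (rule the_equality)
  show "\<exists>\<xi>'. lifted_trajectory f u t \<xi>' \<and> torus_proj (\<xi>' 0) = torus_proj (\<xi> 0) \<and>
      torus_proj (\<xi>' t) = torus_proj (\<xi> t)"
    using assms by blast
  show "q = torus_proj (\<xi> t)" if "\<exists>\<xi>'. lifted_trajectory f u t \<xi>' \<and>
      torus_proj (\<xi>' 0) = torus_proj (\<xi> 0) \<and> torus_proj (\<xi>' t) = q" for q
    using that assms trajectories_endpoints_iff by metis
qed

lemma obtain_flow_trajectory:
  assumes "admissible_control t u" "0 \<le> t"
  obtains \<xi> where "lifted_trajectory f u t \<xi>" "\<xi> 0 = x" "flow f u t (torus_proj x) = torus_proj (\<xi> t)"
  using trajectory_exists[OF assms, of x] flow_eq[OF _ assms(2)] by metis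

lemma inj_flow:
  assumes "admissible_control t u" "0 \<le> t"
  shows "inj (flow f u t)"
proof (rule injI)
  fix p q assume pq: "flow f u t p = flow f u t q"
  obtain \<xi> where \<xi>: "lifted_trajectory f u t \<xi>" "\<xi> 0 = rep_torus p"
      "flow f u t (torus_proj (rep_torus p)) = torus_proj (\<xi> t)"
    using obtain_flow_trajectory[OF assms] .
  obtain \<xi>' where \<xi>': "lifted_trajectory f u t \<xi>'" "\<xi>' 0 = rep_torus q"
      "flow f u t (torus_proj (rep_torus q)) = torus_proj (\<xi>' t)"
    using obtain_flow_trajectory[OF assms] .
  show "p = q"
    using trajectories_endpoints_iff[OF \<xi>(1) \<xi>'(1) assms(2)] \<xi> \<xi>' pq by simp
qed

end

lemma bounded_borel_admissible:
  fixes u :: "real \<Rightarrow> real ^ ('n::finite)"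
  assumes "u \<in> borel_measurable borel" "\<And>s. norm (u s) \<le> B"
  shows "admissible_control t u"
proof -
  have "u \<in> borel_measurable (lebesgue_on {0..t})"
    using assms(1) by (intro measurable_restrict_space1) (simp add: measurable_completion)
  then show ?thesis
    unfolding admissible_control_def using assms(2) by auto
qed

lemma lifted_trajectory_append:
  fixes f :: "('n::finite) vfield"
  assumes 1: "lifted_trajectory f u t \<xi>" and 2: "lifted_trajectory f u' t' \<xi>'"
    and eq: "\<xi>' 0 = \<xi> t" and t: "0 \<le> t" "0 \<le> t'"
  shows "lifted_trajectory f (\<lambda>r. if r \<le> t then u r else u' (r - t)) (t + t')
           (\<lambda>s. if s \<le> t then \<xi> s else \<xi>' (s - t))"
proof -
  let ?u = "\<lambda>r. if r \<le> t then u r else u' (r - t)"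
  let ?x = "\<lambda>s. if s \<le> t then \<xi> s else \<xi>' (s - t)"
  let ?g = "\<lambda>r. lift_field f (?x r) + ?u r"
  have A: "(?g has_integral (\<xi> s - \<xi> 0)) {0..s}" if "s \<in> {0..t}" for s
  proof -
    have "((\<lambda>r. lift_field f (\<xi> r) + u r) has_integral (\<xi> s - \<xi> 0)) {0..s}"
      using 1 that unfolding lifted_trajectory_def by blast
    then show ?thesis
      by (rule has_integral_eq[rotated]) (use that in auto)
  qed
  have B: "(?g has_integral (\<xi>' (s - t) - \<xi>' 0)) {t..s}" if "s \<in> {t..t + t'}" for s
  proof -
    have "((\<lambda>r. lift_field f (\<xi>' r) + u' r) has_integral (\<xi>' (s - t) - \<xi>' 0)) {0..s - t}"
      using 2 that unfolding lifted_trajectory_def by auto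
    then have "((\<lambda>r. lift_field f (\<xi>' (r - t)) + u' (r - t)) has_integral (\<xi>' (s - t) - \<xi>' 0)) {t..s}"
      using has_integral_shift_real_ivl[of "\<lambda>r. lift_field f (\<xi>' r) + u' r" _ 0 "s - t" "- t"] by simp
    then show ?thesis
      by (rule has_integral_spike_finite[of "{t}", rotated 2]) auto
  qed
  have "(?g has_integral (?x s - ?x 0)) {0..s}" if s: "s \<in> {0..t + t'}" for s
  proof (cases "s \<le> t")
    case True
    with A[of s] s t show ?thesis by auto
  next
    case False
    then have "(?g has_integral ((\<xi> t - \<xi> 0) + (\<xi>' (s - t) - \<xi>' 0))) {0..s}"
      using A[of t] B[of s] s t by (intro has_integral_combine[of 0 t s]) auto
    with False s t show ?thesis by (simp add: eq)
  qed
  then show ?thesis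
    unfolding lifted_trajectory_def by blast
qed

text \<open>
  Only bounded Borel controls are used: these are admissible on every interval and closed under
  concatenation. An ensemble of \<open>N\<close> points is given by the lifts \<open>x j\<close>, \<open>j < N\<close>.
\<close>

definition reach :: "('n::finite) vfield \<Rightarrow> nat \<Rightarrow> (nat \<Rightarrow> real ^ 'n) \<Rightarrow> (nat \<Rightarrow> real ^ 'n) \<Rightarrow> bool" where
  "reach f N x x' \<longleftrightarrow> (\<exists>t\<ge>0. \<exists>u. u \<in> borel_measurable borel \<and> (\<exists>B. \<forall>s. norm (u s) \<le> B) \<and>
     (\<forall>j<N. \<exists>\<xi>. lifted_trajectory f u t \<xi> \<and> \<xi> 0 = x j \<and> \<xi> t = x' j))"

lemma reach_cong:
  assumes "reach f N x x'" "\<And>j. j < N \<Longrightarrow> x j = y j" "\<And>j. j < N \<Longrightarrow> x' j = y' j"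
  shows "reach f N y y'"
  using assms unfolding reach_def by (metis (no_types, lifting))

lemma reach_refl: "reach f N x x"
proof -
  have "lifted_trajectory f (\<lambda>_. 0) 0 (\<lambda>_. x j)" for j
    by (simp add: lifted_trajectory_def has_integral_refl)
  then have "\<exists>\<xi>. lifted_trajectory f (\<lambda>_. 0) 0 \<xi> \<and> \<xi> 0 = x j \<and> \<xi> 0 = x j" for j
    by (intro exI[of _ "\<lambda>_. x j"]) simp
  moreover have "(\<lambda>_. 0) \<in> borel_measurable borel" "\<forall>s. norm ((\<lambda>_. 0) s) \<le> 0"
    by auto
  ultimately show ?thesis
    unfolding reach_def by blast
qed

lemma reach_trans:
  assumes "reach f N x y" "reach f N y z"
  shows "reach f N x z"
proof -
  obtain t u B where 1: "0 \<le> t" "u \<in> borel_measurable borel" "\<And>s. norm (u s) \<le> B"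
    "\<And>j. j < N \<Longrightarrow> \<exists>\<xi>. lifted_trajectory f u t \<xi> \<and> \<xi> 0 = x j \<and> \<xi> t = y j"
    using assms(1) unfolding reach_def by blast
  obtain t' u' B' where 2: "0 \<le> t'" "u' \<in> borel_measurable borel" "\<And>s. norm (u' s) \<le> B'"
    "\<And>j. j < N \<Longrightarrow> \<exists>\<xi>. lifted_trajectory f u' t' \<xi> \<and> \<xi> 0 = y j \<and> \<xi> t' = z j"
    using assms(2) unfolding reach_def by blast
  let ?u = "\<lambda>r. if r \<le> t then u r else u' (r - t)"
  have "?u \<in> borel_measurable borel"
  proof -
    have [measurable]: "u \<in> borel_measurable borel" "u' \<in> borel_measurable borel" by fact+
    show ?thesis by measurable
  qed
  moreover have "norm (?u s) \<le> max B B'" for s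
    using 1(3)[of s] 2(3)[of "s - t"] by auto
  moreover have "\<exists>\<xi>. lifted_trajectory f ?u (t + t') \<xi> \<and> \<xi> 0 = x j \<and> \<xi> (t + t') = z j" if j: "j < N" for j
  proof -
    obtain \<xi> \<xi>' where "lifted_trajectory f u t \<xi>" "\<xi> 0 = x j" "\<xi> t = y j"
      "lifted_trajectory f u' t' \<xi>'" "\<xi>' 0 = y j" "\<xi>' t' = z j"
      using 1(4)[OF j] 2(4)[OF j] by blast
    then show ?thesis
      using lifted_trajectory_append[of f u t \<xi> u' t' \<xi>'] 1(1) 2(1)
      by (intro exI[of _ "\<lambda>s. if s \<le> t then \<xi> s else \<xi>' (s - t)"]) auto
  qed
  moreover have "0 \<le> t + t'" using 1 2 by simp
  ultimately show ?thesis
    unfolding reach_def by blast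
qed

section \<open>Waiting at translates of the drift\<close>

lemma has_integral_interval_bound:
  fixes g :: "real \<Rightarrow> 'a::euclidean_space"
  assumes "(g has_integral i) {a..b}" "a \<le> b" "\<And>x. x \<in> {a..b} \<Longrightarrow> norm (g x) \<le> B"
  shows "norm i \<le> (b - a) * B"
proof -
  have "0 \<le> B"
    using order_trans[OF norm_ge_zero assms(3)[of a]] assms(2) by simp
  then show ?thesis
    using has_integral_bound[of B g i a b] assms by (simp add: mult.commute)
qed

context drift
begin

definition const_flow :: "real ^ 'n \<Rightarrow> real \<Rightarrow> real ^ 'n \<Rightarrow> real ^ 'n" where
  "const_flow u s x = (SOME y. \<exists>\<xi>. lifted_trajectory f (\<lambda>_. u) s \<xi> \<and> \<xi> 0 = x \<and> \<xi> s = y)"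

lemma const_flow_eq:
  assumes \<xi>: "lifted_trajectory f (\<lambda>_. u) S \<xi>" and s: "s \<in> {0..S}"
  shows "const_flow u s (\<xi> 0) = \<xi> s"
  unfolding const_flow_def
proof (rule some_equality)
  have s': "lifted_trajectory f (\<lambda>_. u) s \<xi>"
    using assms unfolding lifted_trajectory_def by auto
  then show "\<exists>\<zeta>. lifted_trajectory f (\<lambda>_. u) s \<zeta> \<and> \<zeta> 0 = \<xi> 0 \<and> \<zeta> s = \<xi> s"
    by blast
  show "y = \<xi> s" if y: "\<exists>\<zeta>. lifted_trajectory f (\<lambda>_. u) s \<zeta> \<and> \<zeta> 0 = \<xi> 0 \<and> \<zeta> s = y" for y
  proof -
    obtain \<zeta> where \<zeta>: "lifted_trajectory f (\<lambda>_. u) s \<zeta>" "\<zeta> 0 = \<xi> 0" "\<zeta> s = y"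
      using y by blast
    then show ?thesis
      using trajectories_separation(1)[OF \<zeta>(1) s', of s] s by simp
  qed
qed

lemma constant_control_trajectory:
  assumes "0 \<le> S"
  obtains \<xi> where "lifted_trajectory f (\<lambda>_. u) S \<xi>" "\<xi> 0 = x" "\<And>s. s \<in> {0..S} \<Longrightarrow> const_flow u s x = \<xi> s"
proof -
  have "admissible_control S (\<lambda>_. u)"
    by (rule bounded_borel_admissible[of _ "norm u"]) auto
  then obtain \<xi> where "lifted_trajectory f (\<lambda>_. u) S \<xi>" "\<xi> 0 = x"
    using trajectory_exists[OF _ assms] by blast
  with const_flow_eq[OF this(1)] show ?thesis
    using that by metis
qed

lemma const_flow_integral:
  assumes \<xi>: "lifted_trajectory f (\<lambda>_. u) S \<xi>" and s: "0 \<le> s'" "s' \<le> s" "s \<le> S"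
  shows "((\<lambda>r. F (\<xi> r) + u) has_integral (\<xi> s - \<xi> s')) {s'..s}"
proof -
  let ?g = "\<lambda>r. F (\<xi> r) + u"
  have i: "(?g has_integral (\<xi> s' - \<xi> 0)) {0..s'}" "(?g has_integral (\<xi> s - \<xi> 0)) {0..s}"
    using \<xi> s unfolding lifted_trajectory_def by auto
  have "?g integrable_on {s'..s}"
    using i(2) s by (meson atLeastatMost_subset_iff has_integral_integrable integrable_on_subinterval order_refl)
  then obtain k where k: "(?g has_integral k) {s'..s}" by blast
  then have "(?g has_integral ((\<xi> s' - \<xi> 0) + k)) {0..s}"
    using i(1) s by (intro has_integral_combine[of 0 s' s]) auto
  then have "\<xi> s - \<xi> 0 = (\<xi> s' - \<xi> 0) + k"
    using i(2) has_integral_unique by blast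
  with k show ?thesis by (simp add: algebra_simps)
qed

lemma const_flow_zero [simp]: "const_flow u 0 x = x"
  using constant_control_trajectory[of 0 u x] by (metis atLeastAtMost_iff order_refl)

lemma reach_constant_control:
  assumes "0 \<le> s"
  shows "reach f N x (\<lambda>j. const_flow u s (x j))"
  unfolding reach_def
proof (rule exI[of _ s], intro conjI assms, rule exI[of _ "\<lambda>_. u"], intro conjI allI impI)
  show "\<exists>B. \<forall>s. norm u \<le> B" by blast
  show "\<exists>\<xi>. lifted_trajectory f (\<lambda>_. u) s \<xi> \<and> \<xi> 0 = x j \<and> \<xi> s = const_flow u s (x j)" for j
    using constant_control_trajectory[OF assms, of u "x j"] assms by (metis atLeastAtMost_iff order_refl)
qed simp

text \<open>
  While the state stays near \<open>c\<close>, the time dependence of the flow is nearly linear with velocity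
  \<open>F c + u\<close>. The second estimate is a Lipschitz bound for the error.
\<close>

lemma const_flow_time_increment:
  assumes s: "0 \<le> s" "s \<le> S" "0 \<le> s'" "s' \<le> S"
  shows "norm (const_flow u s x - const_flow u s' x) \<le> \<bar>s - s'\<bar> * (M + norm u)"
    and "norm (const_flow u s x - const_flow u s' x - (s - s') *\<^sub>R (F c + u))
      \<le> \<bar>s - s'\<bar> * (L * (norm (x - c) + S * (M + norm u)))"
proof -
  obtain \<xi> where \<xi>: "lifted_trajectory f (\<lambda>_. u) S \<xi>" "\<xi> 0 = x" "\<And>s. s \<in> {0..S} \<Longrightarrow> const_flow u s x = \<xi> s"
    using constant_control_trajectory[of S u x] s by auto
  have Fu: "norm (F y + u) \<le> M + norm u" for y
    by (meson add_right_mono bnd norm_triangle_le)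
  have v: "norm (\<xi> b - \<xi> a) \<le> (b - a) * (M + norm u)" if "0 \<le> a" "a \<le> b" "b \<le> S" for a b
    by (rule has_integral_interval_bound[OF const_flow_integral[OF \<xi>(1) that] that(2) Fu])
  show "norm (const_flow u s x - const_flow u s' x) \<le> \<bar>s - s'\<bar> * (M + norm u)"
    using v[of s s'] v[of s' s] s \<xi>(3) by (cases "s \<le> s'") (auto simp: norm_minus_commute)
  have near: "norm (F (\<xi> r) + u - (F c + u)) \<le> L * (norm (x - c) + S * (M + norm u))" if r: "r \<in> {0..S}" for r
  proof -
    have "norm (\<xi> r - c) \<le> norm (\<xi> r - \<xi> 0) + norm (x - c)"
      using norm_triangle_ineq[of "\<xi> r - \<xi> 0" "x - c"] \<xi>(2) by simp
    also have "norm (\<xi> r - \<xi> 0) \<le> S * (M + norm u)"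
      using order_trans[OF v[of 0 r] mult_right_mono[of "r - 0" S "M + norm u"]] r M_pos by simp
    finally have "L * norm (\<xi> r - c) \<le> L * (norm (x - c) + S * (M + norm u))"
      using L_pos by simp
    then show ?thesis
      using lip[of "\<xi> r" c] by simp
  qed
  have w: "norm (\<xi> b - \<xi> a - (b - a) *\<^sub>R (F c + u)) \<le> (b - a) * (L * (norm (x - c) + S * (M + norm u)))"
    if ab: "0 \<le> a" "a \<le> b" "b \<le> S" for a b
  proof -
    have "((\<lambda>r. F (\<xi> r) + u - (F c + u)) has_integral (\<xi> b - \<xi> a - (b - a) *\<^sub>R (F c + u))) {a..b}"
      using has_integral_diff[OF const_flow_integral[OF \<xi>(1) ab] has_integral_const_real[of "F c + u" a b]] ab
      by simp
    then show ?thesis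
      by (rule has_integral_interval_bound[OF _ ab(2)]) (use near ab in auto)
  qed
  show "norm (const_flow u s x - const_flow u s' x - (s - s') *\<^sub>R (F c + u))
      \<le> \<bar>s - s'\<bar> * (L * (norm (x - c) + S * (M + norm u)))"
  proof (cases "s' \<le> s")
    case True
    then show ?thesis using w[of s' s] s \<xi>(3) by auto
  next
    case False
    have "norm (const_flow u s x - const_flow u s' x - (s - s') *\<^sub>R (F c + u))
        = norm (\<xi> s' - \<xi> s - (s' - s) *\<^sub>R (F c + u))"
      using s \<xi>(3) norm_minus_cancel[of "\<xi> s' - \<xi> s - (s' - s) *\<^sub>R (F c + u)"] by (simp add: algebra_simps)
    then show ?thesis using w[of s s'] s False by auto
  qed
qed

lemma const_flow_displacement:
  assumes "0 \<le> s"
  shows "norm (const_flow u s x - x - s *\<^sub>R u) \<le> s * M"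
proof -
  obtain \<xi> where \<xi>: "lifted_trajectory f (\<lambda>_. u) s \<xi>" "\<xi> 0 = x" "\<And>r. r \<in> {0..s} \<Longrightarrow> const_flow u r x = \<xi> r"
    using constant_control_trajectory[OF assms, of u x] by blast
  have "((\<lambda>r. F (\<xi> r)) has_integral (const_flow u s x - x - s *\<^sub>R u)) {0..s}"
    using has_integral_diff[OF const_flow_integral[OF \<xi>(1), of 0 s] has_integral_const_real[of u 0 s]] assms \<xi>(2) \<xi>(3)[of s]
    by simp
  then show ?thesis
    using has_integral_interval_bound[OF _ assms bnd] by fastforce
qed

lemma const_flow_separation:
  assumes "0 \<le> s"
  shows "norm (const_flow u s x - const_flow u s x' - (x - x')) \<le> s * (L * exp (L * s) * norm (x - x'))"
proof -
  obtain \<xi> where \<xi>: "lifted_trajectory f (\<lambda>_. u) s \<xi>" "\<xi> 0 = x" "\<And>r. r \<in> {0..s} \<Longrightarrow> const_flow u r x = \<xi> r"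
    using constant_control_trajectory[OF assms, of u x] by blast
  obtain \<xi>' where \<xi>': "lifted_trajectory f (\<lambda>_. u) s \<xi>'" "\<xi>' 0 = x'" "\<And>r. r \<in> {0..s} \<Longrightarrow> const_flow u r x' = \<xi>' r"
    using constant_control_trajectory[OF assms, of u x'] by blast
  have "norm (F (\<xi> r) - F (\<xi>' r)) \<le> L * exp (L * s) * norm (x - x')" if r: "r \<in> {0..s}" for r
  proof -
    have "norm (F (\<xi> r) - F (\<xi>' r)) \<le> L * norm (\<xi> r - \<xi>' r)"
      by (rule lip)
    also have "\<dots> \<le> L * (exp (L * r) * norm (x - x'))"
      using trajectories_separation(1)[OF \<xi>(1) \<xi>'(1) r] \<xi>(2) \<xi>'(2) L_pos by simp
    also have "\<dots> \<le> L * (exp (L * s) * norm (x - x'))"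
      using L_pos r by (intro mult_left_mono mult_right_mono) auto
    finally show ?thesis by (simp add: mult.assoc)
  qed
  moreover have "((\<lambda>r. F (\<xi> r) - F (\<xi>' r)) has_integral (const_flow u s x - const_flow u s x' - (x - x'))) {0..s}"
    using trajectories_difference[OF \<xi>(1) \<xi>'(1), of s] \<xi> \<xi>' assms by simp
  ultimately have "norm (const_flow u s x - const_flow u s x' - (x - x')) \<le> (s - 0) * (L * exp (L * s) * norm (x - x'))"
    by (intro has_integral_interval_bound[OF _ assms])
  then show ?thesis by simp
qed

text \<open>
  Translate by about \<open>a\<close>, wait for time \<open>s\<close> under the control \<open>u\<close>, translate back.
\<close>

definition block :: "real \<Rightarrow> real ^ 'n \<Rightarrow> real \<Rightarrow> real ^ 'n \<Rightarrow> real ^ 'n \<Rightarrow> real ^ 'n" where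
  "block \<delta> u s a x = const_flow (- ((1 / \<delta>) *\<^sub>R a)) \<delta> (const_flow u s (const_flow ((1 / \<delta>) *\<^sub>R a) \<delta> x))"

lemma reach_block:
  assumes "0 < \<delta>" "0 \<le> s"
  shows "reach f N x (\<lambda>j. block \<delta> u s a (x j))"
  unfolding block_def using assms
  by (intro reach_trans[OF reach_trans[OF reach_constant_control reach_constant_control] reach_constant_control]) auto


text \<open>
  The waiting time \<open>T w(z)\<close> and the starting point \<open>X z\<close> depend on a parameter \<open>z\<close>. To first order the block
  displaces \<open>X z\<close> by \<open>T w(z) (F (c + a) + u)\<close>, and what matters for a contraction argument is that the
  Lipschitz constant of the error \<open>E\<close> in \<open>z\<close> is \<open>O(T (T + r))\<close>, one order better than that of the
  displacement itself. With \<open>w z = 0\<close> only the two imperfect translations remain, which explains the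
  bound by \<open>\<delta>\<close> alone. The constants are written out to show that they do not depend on \<open>T\<close>, \<open>\<delta>\<close>, \<open>r\<close> and \<open>c\<close>.
\<close>

lemma block_estimates:
  fixes X :: "'z::real_normed_vector \<Rightarrow> real ^ 'n" and w :: "'z \<Rightarrow> real"
    and a :: "real ^ 'n"
  assumes T: "0 < T" "T \<le> 1" and \<delta>: "0 < \<delta>" "\<delta> \<le> T" and r: "0 \<le> r"
    and w: "\<And>z. z \<in> D \<Longrightarrow> 0 \<le> w z" "\<And>z. z \<in> D \<Longrightarrow> w z \<le> K" and K: "0 \<le> K"
    and wlip: "\<And>z z'. z \<in> D \<Longrightarrow> z' \<in> D \<Longrightarrow> \<bar>w z - w z'\<bar> \<le> K * norm (z - z')"
    and C: "0 \<le> C" and near: "\<And>z. z \<in> D \<Longrightarrow> norm (X z - c) \<le> r + C * T"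
    and Xlip: "\<And>z z'. z \<in> D \<Longrightarrow> z' \<in> D \<Longrightarrow> norm (X z - X z') \<le> C * T * norm (z - z')"
    and P: "P = M + norm u" and Q: "Q = L * exp (L * (K + 1))"
  defines "Y \<equiv> \<lambda>z. block \<delta> u (T * w z) a (X z)"
    and "E \<equiv> \<lambda>z. block \<delta> u (T * w z) a (X z) - X z - (T * w z) *\<^sub>R (F (c + a) + u)"
  shows "\<And>z. z \<in> D \<Longrightarrow> norm (Y z - X z) \<le> T * (2 * M + K * P)" (is "\<And>z. _ \<Longrightarrow> ?near z")
    and "\<And>z. z \<in> D \<Longrightarrow> w z = 0 \<Longrightarrow> norm (Y z - X z) \<le> 2 * M * \<delta>" (is "\<And>z. _ \<Longrightarrow> _ \<Longrightarrow> ?idle z")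
    and "\<And>z z'. z \<in> D \<Longrightarrow> z' \<in> D \<Longrightarrow> norm (E z - E z')
      \<le> (Q * C + K * L * (1 + C + M + K * P) + K * Q * (1 + Q) * C
          + Q * (K * P + (1 + K * Q) * (1 + Q) * C)) * (T * (T + r)) * norm (z - z')"
proof -
  define X1 where "X1 z = const_flow ((1 / \<delta>) *\<^sub>R a) \<delta> (X z)" for z
  define X2 where "X2 z = const_flow u (T * w z) (X1 z)" for z
  have Y: "Y z = const_flow (- ((1 / \<delta>) *\<^sub>R a)) \<delta> (X2 z)" for z
    by (simp add: Y_def X1_def X2_def block_def)
  have P0: "0 \<le> P" using P M_pos by simp
  have Q0: "0 \<le> Q" using Q L_pos by simp
  have s: "0 \<le> T * w z" "T * w z \<le> T * K" "T * w z \<le> K" if "z \<in> D" for z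
    using w[OF that] T K mult_left_mono[of "w z" K T] mult_mono[of T 1 "w z" K] by auto
  have Qs: "L * exp (L * q) \<le> Q" if "q \<le> K + 1" for q
    using that L_pos unfolding Q by simp
  have X1_disp: "norm (X1 z - X z - a) \<le> \<delta> * M" for z
    using const_flow_displacement[of \<delta> "(1 / \<delta>) *\<^sub>R a" "X z"] \<delta> by (simp add: X1_def)
  have X2_disp: "norm (X2 z - X1 z) \<le> T * w z * P" if "z \<in> D" for z
    using const_flow_time_increment(1)[of "T * w z" "T * w z" 0 u "X1 z"] s(1)[OF that] by (simp add: X2_def P)
  have Y_disp: "norm (Y z - X2 z + a) \<le> \<delta> * M" for z
    using const_flow_displacement[of \<delta> "- ((1 / \<delta>) *\<^sub>R a)" "X2 z"] \<delta> by (simp add: Y)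
  have split: "norm (Y z - X z) \<le> 2 * M * \<delta> + T * w z * P" if "z \<in> D" for z
  proof -
    have "Y z - X z = (X1 z - X z - a) + (X2 z - X1 z) + (Y z - X2 z + a)"
      by simp
    then have "norm (Y z - X z) \<le> \<delta> * M + T * w z * P + \<delta> * M"
      using X1_disp[of z] X2_disp[OF that] Y_disp[of z] by (simp only: norm_triangle_le add_mono)
    then show ?thesis by (simp add: algebra_simps)
  qed
  show "?near z" if "z \<in> D" for z
  proof -
    have "2 * M * \<delta> \<le> 2 * M * T" "T * w z * P \<le> T * K * P"
      using \<delta> M_pos P0 s[OF that] by (auto intro: mult_right_mono)
    then show ?thesis using split[OF that] by (simp add: algebra_simps)
  qed
  show "?idle z" if "z \<in> D" "w z = 0" for z
    using split[OF that(1)] that(2) by simp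
  fix z z' assume z: "z \<in> D" "z' \<in> D"
  define dz where "dz = norm (z - z')"
  have dz: "0 \<le> dz" by (simp add: dz_def)
  have CT: "0 \<le> C * T" using C T by simp
  have e1: "norm (X1 z - X1 z' - (X z - X z')) \<le> \<delta> * (Q * (C * T * dz))"
  proof -
    have "norm (X1 z - X1 z' - (X z - X z')) \<le> \<delta> * (L * exp (L * \<delta>) * norm (X z - X z'))"
      unfolding X1_def using const_flow_separation[of \<delta>] \<delta> by simp
    also have "\<dots> \<le> \<delta> * (Q * (C * T * dz))"
      using Qs[of \<delta>] \<delta> T K Xlip[OF z] Q0 CT dz unfolding dz_def
      by (intro mult_left_mono mult_mono) auto
    finally show ?thesis .
  qed
  have d1: "norm (X1 z - X1 z') \<le> (1 + Q) * (C * T * dz)"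
  proof -
    have "norm (X1 z - X1 z') \<le> C * T * dz + \<delta> * (Q * (C * T * dz))"
      using norm_triangle_sub[of "X1 z - X1 z'" "X z - X z'"] e1 Xlip[OF z] unfolding dz_def by linarith
    also have "\<delta> * (Q * (C * T * dz)) \<le> 1 * (Q * (C * T * dz))"
      using \<delta> T Q0 CT dz by (intro mult_right_mono) auto
    finally show ?thesis by (simp add: algebra_simps)
  qed
  have ws: "\<bar>T * w z - T * w z'\<bar> \<le> T * (K * dz)"
    using wlip[OF z] T unfolding dz_def by (simp add: abs_mult flip: right_diff_distrib)
  have e2: "norm (const_flow u (T * w z) (X1 z) - const_flow u (T * w z') (X1 z) - (T * w z - T * w z') *\<^sub>R (F (c + a) + u))
      \<le> T * (K * dz) * (L * ((T + r) * (1 + C + M + K * P)))"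
  proof -
    have "norm (X1 z - (c + a)) \<le> \<delta> * M + (r + C * T)"
      using norm_triangle_ineq[of "X1 z - X z - a" "X z - c"] X1_disp[of z] near[OF z(1)]
      by (simp add: algebra_simps)
    also have "\<dots> \<le> T * M + (r + C * T)"
      using \<delta> M_pos by simp
    finally have "norm (X1 z - (c + a)) + T * K * P \<le> r + T * (C + M + K * P)"
      by (simp add: algebra_simps)
    also have "\<dots> \<le> (T + r) * (1 + C + M + K * P)"
      using r C M_pos P0 K T by (simp add: algebra_simps)
    finally have *: "norm (X1 z - (c + a)) + T * K * P \<le> (T + r) * (1 + C + M + K * P)" .
    have "norm (const_flow u (T * w z) (X1 z) - const_flow u (T * w z') (X1 z) - (T * w z - T * w z') *\<^sub>R (F (c + a) + u))
      \<le> \<bar>T * w z - T * w z'\<bar> * (L * (norm (X1 z - (c + a)) + T * K * P))"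
      unfolding P using s[OF z(1)] s[OF z(2)] by (intro const_flow_time_increment(2)) auto
    also have "\<dots> \<le> T * (K * dz) * (L * ((T + r) * (1 + C + M + K * P)))"
      using ws * L_pos T K P0 dz by (intro mult_mono mult_left_mono) auto
    finally show ?thesis .
  qed
  have e3: "norm (const_flow u (T * w z') (X1 z) - const_flow u (T * w z') (X1 z') - (X1 z - X1 z'))
      \<le> T * K * (Q * ((1 + Q) * (C * T * dz)))"
  proof -
    have "norm (const_flow u (T * w z') (X1 z) - const_flow u (T * w z') (X1 z') - (X1 z - X1 z'))
      \<le> T * w z' * (L * exp (L * (T * w z')) * norm (X1 z - X1 z'))"
      using const_flow_separation s(1)[OF z(2)] by simp
    also have "\<dots> \<le> T * K * (Q * ((1 + Q) * (C * T * dz)))"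
      using Qs[of "T * w z'"] s[OF z(2)] w(1)[OF z(2)] d1 Q0 L_pos T K by (intro mult_mono) auto
    finally show ?thesis .
  qed
  have d2: "norm (X2 z - X2 z') \<le> T * (K * P + (1 + K * Q) * (1 + Q) * C) * dz"
  proof -
    have "norm (const_flow u (T * w z) (X1 z) - const_flow u (T * w z') (X1 z)) \<le> \<bar>T * w z - T * w z'\<bar> * P"
      unfolding P using s(1)[OF z(1)] s(1)[OF z(2)]
      by (intro const_flow_time_increment(1)[of _ "max (T * w z) (T * w z')"]) auto
    also have "\<dots> \<le> T * (K * dz) * P"
      using ws P0 by (intro mult_right_mono)
    finally have "norm (X2 z - X2 z') \<le> T * (K * dz) * P + (1 + Q) * (C * T * dz) + T * K * (Q * ((1 + Q) * (C * T * dz)))"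
      using e3 d1 norm_triangle_sub[of "const_flow u (T * w z') (X1 z) - const_flow u (T * w z') (X1 z')" "X1 z - X1 z'"]
        norm_triangle_ineq[of "const_flow u (T * w z) (X1 z) - const_flow u (T * w z') (X1 z)"
          "const_flow u (T * w z') (X1 z) - const_flow u (T * w z') (X1 z')"]
      unfolding X2_def by simp
    also have "T * K * (Q * ((1 + Q) * (C * T * dz))) \<le> 1 * K * (Q * ((1 + Q) * (C * T * dz)))"
      using T K Q0 CT dz by (intro mult_right_mono) auto
    finally show ?thesis by (simp add: algebra_simps)
  qed
  have e4: "norm (Y z - Y z' - (X2 z - X2 z')) \<le> \<delta> * (Q * (T * (K * P + (1 + K * Q) * (1 + Q) * C) * dz))"
  proof -
    have "norm (Y z - Y z' - (X2 z - X2 z')) \<le> \<delta> * (L * exp (L * \<delta>) * norm (X2 z - X2 z'))"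
      unfolding Y using const_flow_separation[of \<delta>] \<delta> by simp
    also have "\<dots> \<le> \<delta> * (Q * (T * (K * P + (1 + K * Q) * (1 + Q) * C) * dz))"
      using Qs[of \<delta>] \<delta> T K d2 Q0 by (intro mult_left_mono mult_mono) auto
    finally show ?thesis .
  qed
  have Ez: "E z = Y z - X z - (T * w z) *\<^sub>R (F (c + a) + u)" for z
    by (simp add: E_def Y_def)
  have "E z - E z' = (X1 z - X1 z' - (X z - X z'))
     + (const_flow u (T * w z) (X1 z) - const_flow u (T * w z') (X1 z) - (T * w z - T * w z') *\<^sub>R (F (c + a) + u))
     + (const_flow u (T * w z') (X1 z) - const_flow u (T * w z') (X1 z') - (X1 z - X1 z'))
     + (Y z - Y z' - (X2 z - X2 z'))"
    unfolding Ez X2_def by (simp add: algebra_simps)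
  then have "norm (E z - E z') \<le> \<delta> * (Q * (C * T * dz)) + T * (K * dz) * (L * ((T + r) * (1 + C + M + K * P)))
     + T * K * (Q * ((1 + Q) * (C * T * dz))) + \<delta> * (Q * (T * (K * P + (1 + K * Q) * (1 + Q) * C) * dz))"
    using e1 e2 e3 e4 by (simp only: norm_triangle_le add_mono)
  also have "\<dots> \<le> T * (Q * (C * T * dz)) + T * (K * dz) * (L * ((T + r) * (1 + C + M + K * P)))
     + T * K * (Q * ((1 + Q) * (C * T * dz))) + T * (Q * (T * (K * P + (1 + K * Q) * (1 + Q) * C) * dz))"
    using \<delta> T Q0 CT dz P0 K C L_pos M_pos r by (intro add_mono mult_right_mono) auto
  also have "\<dots> = (Q * C) * (T * T) * dz + K * L * (1 + C + M + K * P) * (T * (T + r)) * dz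
     + (K * Q * (1 + Q) * C) * (T * T) * dz + (Q * (K * P + (1 + K * Q) * (1 + Q) * C)) * (T * T) * dz"
    by (simp add: algebra_simps)
  also have "\<dots> \<le> (Q * C) * (T * (T + r)) * dz + K * L * (1 + C + M + K * P) * (T * (T + r)) * dz
     + (K * Q * (1 + Q) * C) * (T * (T + r)) * dz + (Q * (K * P + (1 + K * Q) * (1 + Q) * C)) * (T * (T + r)) * dz"
    using T r Q0 C K P0 dz L_pos M_pos by (intro add_mono mult_right_mono mult_left_mono) auto
  finally show "norm (E z - E z')
      \<le> (Q * C + K * L * (1 + C + M + K * P) + K * Q * (1 + Q) * C
          + Q * (K * P + (1 + K * Q) * (1 + Q) * C)) * (T * (T + r)) * norm (z - z')"
    by (simp add: dz_def algebra_simps)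
qed


text \<open>
  A list entry \<open>(w, a)\<close> stands for a block at the translation \<open>a\<close> with waiting time \<open>T w(z)\<close>.
\<close>

primrec steer :: "real \<Rightarrow> real ^ 'n \<Rightarrow> real \<Rightarrow> (('z \<Rightarrow> real) \<times> (real ^ 'n)) list \<Rightarrow> 'z \<Rightarrow> real ^ 'n \<Rightarrow> real ^ 'n" where
  "steer \<delta> u T [] z x = x"
| "steer \<delta> u T (b # bs) z x = steer \<delta> u T bs z (block \<delta> u (T * fst b z) (snd b) x)"

text \<open>
  The displacement per unit of \<open>T\<close>, to first order, when all blocks act at the fixed point \<open>c\<close>.
\<close>

definition steer_velocity :: "real ^ 'n \<Rightarrow> (('z \<Rightarrow> real) \<times> (real ^ 'n)) list \<Rightarrow> 'z \<Rightarrow> real ^ 'n \<Rightarrow> real ^ 'n" where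
  "steer_velocity u bs z c = (\<Sum>b\<leftarrow>bs. fst b z *\<^sub>R (F (c + snd b) + u))"

definition steer_error ::
    "real \<Rightarrow> real ^ 'n \<Rightarrow> real \<Rightarrow> (('z \<Rightarrow> real) \<times> (real ^ 'n)) list \<Rightarrow> real ^ 'n \<Rightarrow> ('z \<Rightarrow> real ^ 'n) \<Rightarrow> 'z \<Rightarrow> real ^ 'n" where
  "steer_error \<delta> u T bs c X z = steer \<delta> u T bs z (X z) - X z - T *\<^sub>R steer_velocity u bs z c"

text \<open>
  Uniform first-order accuracy: \<open>C'\<close> does not depend on the scale \<open>T\<close>, the translation time \<open>\<delta>\<close>, the
  distance \<open>r\<close> to the reference point, or the reference point \<open>c\<close> itself. For this reason the same constant
  serves all points of an ensemble.
\<close>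

definition steer_accurate ::
     "real ^ 'n \<Rightarrow> (('z::real_normed_vector \<Rightarrow> real) \<times> (real ^ 'n)) list \<Rightarrow> 'z set \<Rightarrow> real \<Rightarrow> real \<Rightarrow> bool" where
  "steer_accurate u bs D C C' \<longleftrightarrow> (\<forall>T \<delta> r c X. 0 < T \<and> T \<le> 1 \<and> 0 < \<delta> \<and> \<delta> \<le> T \<and> 0 \<le> r \<and> r \<le> 1 \<and>
     (\<forall>z\<in>D. norm (X z - c) \<le> r + C * T) \<and>
     (\<forall>z\<in>D. \<forall>z'\<in>D. norm (X z - X z') \<le> C * T * norm (z - z')) \<longrightarrow>
     norm (steer \<delta> u T bs 0 (X 0) - X 0) \<le> C' * \<delta> \<and>
     (\<forall>z\<in>D. \<forall>z'\<in>D. norm (steer_error \<delta> u T bs c X z - steer_error \<delta> u T bs c X z')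
       \<le> C' * (T * (T + r)) * norm (z - z')))"

lemma reach_steer:
  assumes "0 < \<delta>" "0 < T" "\<forall>b\<in>set bs. 0 \<le> fst b z"
  shows "reach f N x (\<lambda>j. steer \<delta> u T bs z (x j))"
  using assms(3)
proof (induction bs arbitrary: x)
  case Nil
  then show ?case by (simp add: reach_refl)
next
  case (Cons b bs)
  then show ?case
    using assms reach_trans[OF reach_block[of \<delta> "T * fst b z" N x u "snd b"] Cons.IH] by simp
qed

text \<open>
  Each block starts where the previous one ended, so the starting point \<open>X\<close> in the induction is itself a
  Lipschitz function of the parameter; its constants grow from \<open>C\<close> to \<open>C1\<close> along a block.
\<close>

lemma steer_estimates:
  fixes bs :: "(('z::real_normed_vector \<Rightarrow> real) \<times> (real ^ 'n)) list"
  assumes D: "0 \<in> D" and K: "0 \<le> K"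
    and w: "\<And>b z. b \<in> set bs \<Longrightarrow> z \<in> D \<Longrightarrow> 0 \<le> fst b z \<and> fst b z \<le> K"
    and w0: "\<And>b. b \<in> set bs \<Longrightarrow> fst b 0 = 0"
    and wlip: "\<And>b z z'. b \<in> set bs \<Longrightarrow> z \<in> D \<Longrightarrow> z' \<in> D \<Longrightarrow> \<bar>fst b z - fst b z'\<bar> \<le> K * norm (z - z')"
    and C: "0 \<le> C"
  shows "\<exists>C'\<ge>0. steer_accurate u bs D C C'"
  using w w0 wlip C
proof (induction bs arbitrary: C)
  case Nil
  show ?case by (rule exI[of _ 0]) (simp add: steer_accurate_def steer_error_def steer_velocity_def)
next
  case (Cons b bs)
  note C = Cons.prems(4)
  define P where "P = M + norm u"
  define Q where "Q = L * exp (L * (K + 1))"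
  define A where "A = Q * C + K * L * (1 + C + M + K * P) + K * Q * (1 + Q) * C
          + Q * (K * P + (1 + K * Q) * (1 + Q) * C)"
  define C1 where "C1 = C + 2 * M + K * P + 2 * A"
  have P0: "0 \<le> P" using M_pos by (simp add: P_def)
  have A0: "0 \<le> A" using P0 C K L_pos M_pos by (simp add: A_def Q_def)
  have C1: "0 \<le> C1" using P0 A0 C K M_pos by (simp add: C1_def)
  have "\<exists>C'\<ge>0. steer_accurate u bs D C1 C'"
    by (rule Cons.IH) (use Cons.prems C1 in auto)
  then obtain C2 where C2: "0 \<le> C2" and acc: "steer_accurate u bs D C1 C2"
    by blast
  have step: "norm (steer \<delta> u T bs 0 (X 0) - X 0) \<le> C2 * \<delta> \<and>
      (\<forall>z\<in>D. \<forall>z'\<in>D. norm (steer_error \<delta> u T bs c X z - steer_error \<delta> u T bs c X z')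
        \<le> C2 * (T * (T + r)) * norm (z - z'))"
    if "0 < T" "T \<le> 1" "0 < \<delta>" "\<delta> \<le> T" "0 \<le> r" "r \<le> 1"
      "\<And>z. z \<in> D \<Longrightarrow> norm (X z - c) \<le> r + C1 * T"
      "\<And>z z'. z \<in> D \<Longrightarrow> z' \<in> D \<Longrightarrow> norm (X z - X z') \<le> C1 * T * norm (z - z')" for T \<delta> r c X
    using acc[unfolded steer_accurate_def, rule_format, of T \<delta> r X c] that by blast
  show ?case
    unfolding steer_accurate_def
  proof (rule exI[of _ "A + C2 + 2 * M"], intro conjI allI impI)
    show "0 \<le> A + C2 + 2 * M" using A0 C2 M_pos by simp
    fix T \<delta> r :: real and c :: "real ^ 'n" and X :: "'z \<Rightarrow> real ^ 'n"
    assume asm: "0 < T \<and> T \<le> 1 \<and> 0 < \<delta> \<and> \<delta> \<le> T \<and> 0 \<le> r \<and> r \<le> 1 \<and>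
      (\<forall>z\<in>D. norm (X z - c) \<le> r + C * T) \<and>
      (\<forall>z\<in>D. \<forall>z'\<in>D. norm (X z - X z') \<le> C * T * norm (z - z'))"
    then have T: "0 < T" "T \<le> 1" and \<delta>: "0 < \<delta>" "\<delta> \<le> T" and r: "0 \<le> r" "r \<le> 1"
      and near: "\<And>z. z \<in> D \<Longrightarrow> norm (X z - c) \<le> r + C * T"
      and Xlip: "\<And>z z'. z \<in> D \<Longrightarrow> z' \<in> D \<Longrightarrow> norm (X z - X z') \<le> C * T * norm (z - z')"
      by auto
    define Y where "Y z = block \<delta> u (T * fst b z) (snd b) (X z)" for z
    define V where "V = F (c + snd b) + u"
    have wb: "\<And>z. z \<in> D \<Longrightarrow> 0 \<le> fst b z" "\<And>z. z \<in> D \<Longrightarrow> fst b z \<le> K"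
      "\<And>z z'. z \<in> D \<Longrightarrow> z' \<in> D \<Longrightarrow> \<bar>fst b z - fst b z'\<bar> \<le> K * norm (z - z')" "fst b 0 = 0"
      using Cons.prems(1-3)[of b] by auto
    note be = block_estimates[where w = "fst b" and a = "snd b" and u = u and D = D and X = X and c = c,
        OF T \<delta> r(1) _ _ K _ C _ _ P_def Q_def, folded A_def V_def Y_def]
    have be1: "norm (Y z - X z) \<le> T * (2 * M + K * P)" if "z \<in> D" for z
      by (rule be(1)) (use that wb near Xlip in auto)
    have be2: "norm (Y 0 - X 0) \<le> 2 * M * \<delta>"
      by (rule be(2)) (use D wb near Xlip in auto)
    have be3: "norm ((Y z - X z - (T * fst b z) *\<^sub>R V) - (Y z' - X z' - (T * fst b z') *\<^sub>R V))
        \<le> A * (T * (T + r)) * norm (z - z')" if "z \<in> D" "z' \<in> D" for z z'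
      by (rule be(3)) (use that wb near Xlip in auto)
    have V: "norm V \<le> P"
      unfolding V_def P_def by (meson add_right_mono bnd norm_triangle_le)
    have Y_near: "norm (Y z - c) \<le> r + C1 * T" if "z \<in> D" for z
    proof -
      have "norm (Y z - c) \<le> T * (2 * M + K * P) + (r + C * T)"
        using be1[OF that] near[OF that] norm_triangle_ineq[of "Y z - X z" "X z - c"] by simp
      also have "\<dots> \<le> r + C1 * T"
        using A0 T by (simp add: C1_def algebra_simps)
      finally show ?thesis .
    qed
    have Y_lip: "norm (Y z - Y z') \<le> C1 * T * norm (z - z')" if z: "z \<in> D" "z' \<in> D" for z z'
    proof -
      have "Y z - Y z' = (X z - X z') + (T * fst b z - T * fst b z') *\<^sub>R V
          + ((Y z - X z - (T * fst b z) *\<^sub>R V) - (Y z' - X z' - (T * fst b z') *\<^sub>R V))"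
        by (simp add: algebra_simps)
      then have "norm (Y z - Y z') \<le> norm (X z - X z') + norm ((T * fst b z - T * fst b z') *\<^sub>R V)
          + norm ((Y z - X z - (T * fst b z) *\<^sub>R V) - (Y z' - X z' - (T * fst b z') *\<^sub>R V))"
        by (metis norm_triangle_ineq norm_triangle_le add_right_mono)
      also have "\<dots> \<le> C * T * norm (z - z') + T * (K * norm (z - z')) * P + A * (T * (T + r)) * norm (z - z')"
      proof (intro add_mono Xlip[OF z] be3[OF z])
        have "\<bar>T * fst b z - T * fst b z'\<bar> \<le> T * (K * norm (z - z'))"
          using wb(3)[OF z] T by (simp add: abs_mult flip: right_diff_distrib)
        then show "norm ((T * fst b z - T * fst b z') *\<^sub>R V) \<le> T * (K * norm (z - z')) * P"
          using V T K by (simp, intro mult_mono) auto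
      qed
      also have "\<dots> \<le> C * T * norm (z - z') + T * (K * norm (z - z')) * P + A * (T * 2) * norm (z - z')"
        using A0 T r by (intro add_left_mono mult_right_mono mult_left_mono) auto
      also have "\<dots> = (C + K * P + 2 * A) * T * norm (z - z')"
        by (simp add: algebra_simps)
      also have "\<dots> \<le> C1 * T * norm (z - z')"
        using M_pos T by (intro mult_right_mono) (auto simp: C1_def)
      finally show ?thesis .
    qed
    note st = step[OF T \<delta> r Y_near Y_lip]
    have eq: "steer_error \<delta> u T (b # bs) c X z = steer_error \<delta> u T bs c Y z
          + (Y z - X z - (T * fst b z) *\<^sub>R V)" for z
      by (simp add: steer_error_def Y_def V_def steer_velocity_def algebra_simps)
    have "norm (steer \<delta> u T bs 0 (Y 0) - Y 0) \<le> C2 * \<delta>" "norm (Y 0 - X 0) \<le> 2 * M * \<delta>"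
      using st be2 by auto
    then have "norm (steer \<delta> u T bs 0 (Y 0) - X 0) \<le> C2 * \<delta> + 2 * M * \<delta>"
      using norm_triangle_ineq[of "steer \<delta> u T bs 0 (Y 0) - Y 0" "Y 0 - X 0"] by simp
    also have "\<dots> \<le> (A + C2 + 2 * M) * \<delta>"
      using A0 \<delta> by (simp add: algebra_simps)
    finally show "norm (steer \<delta> u T (b # bs) 0 (X 0) - X 0) \<le> (A + C2 + 2 * M) * \<delta>"
      by (simp add: Y_def)
    show "\<forall>z\<in>D. \<forall>z'\<in>D. norm (steer_error \<delta> u T (b # bs) c X z - steer_error \<delta> u T (b # bs) c X z')
        \<le> (A + C2 + 2 * M) * (T * (T + r)) * norm (z - z')"
    proof (intro ballI)
      fix z z' assume z: "z \<in> D" "z' \<in> D"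
      have "norm (steer_error \<delta> u T (b # bs) c X z - steer_error \<delta> u T (b # bs) c X z')
        \<le> C2 * (T * (T + r)) * norm (z - z') + A * (T * (T + r)) * norm (z - z')"
        unfolding eq using st z be3[OF z]
        by (subst add_diff_add, intro norm_triangle_le add_mono) auto
      also have "\<dots> \<le> (A + C2 + 2 * M) * (T * (T + r)) * norm (z - z')"
        using M_pos T r by (simp add: algebra_simps)
      finally show "norm (steer_error \<delta> u T (b # bs) c X z - steer_error \<delta> u T (b # bs) c X z')
        \<le> (A + C2 + 2 * M) * (T * (T + r)) * norm (z - z')" .
    qed
  qed
qed

end

section \<open>Local reachability of ensembles\<close>

text \<open>
  A function on the torus with values in \<open>{0..1}\<close> that attains 1 only on the lattice. It measures how well
  two points are separated, and its powers are the localized trigonometric polynomials used for the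
  density argument.
\<close>

definition bump :: "real ^ 'n::finite \<Rightarrow> real" where
  "bump x = (\<Prod>i\<in>UNIV. (1 + cos (x $ i)) / 2)"

lemma half_one_plus_cos:
  fixes t :: real
  shows "0 \<le> (1 + cos t) / 2" "(1 + cos t) / 2 \<le> 1"
proof -
  have 1: "- 1 \<le> cos t" and 2: "cos t \<le> 1" by simp_all
  show "0 \<le> (1 + cos t) / 2" using 1 by argo
  show "(1 + cos t) / 2 \<le> 1" using 2 by argo
qed

lemma bump_bounds: "0 \<le> bump x" "bump x \<le> 1"
proof -
  have *: "0 \<le> (1 + cos (x $ i)) / 2" "(1 + cos (x $ i)) / 2 \<le> 1" for i
    by (rule half_one_plus_cos)+
  show "0 \<le> bump x" unfolding bump_def by (intro prod_nonneg) (use * in auto)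
  show "bump x \<le> 1" unfolding bump_def by (intro prod_le_1) (use * in auto)
qed

lemma bump_zero [simp]: "bump 0 = 1"
  by (simp add: bump_def)

lemma bump_less_one:
  assumes "x \<notin> period_lattice"
  shows "bump x < 1"
proof -
  have *: "0 \<le> (1 + cos (x $ i)) / 2" "(1 + cos (x $ i)) / 2 \<le> 1" for i
    by (rule half_one_plus_cos)+
  obtain i where i: "\<And>k::int. x $ i \<noteq> 2 * pi * of_int k"
    using assms unfolding period_lattice_def by blast
  then have "cos (x $ i) \<noteq> 1"
    by (auto simp: cos_one_2pi_int mult_ac)
  then have lt: "(1 + cos (x $ i)) / 2 < 1"
    using order.not_eq_order_implies_strict[OF _ cos_le_one[of "x $ i"]] by simp
  have "bump x = (1 + cos (x $ i)) / 2 * (\<Prod>j\<in>UNIV - {i}. (1 + cos (x $ j)) / 2)"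
    unfolding bump_def by (rule prod.remove) auto
  also have "\<dots> \<le> (1 + cos (x $ i)) / 2 * 1"
    using *[of i] by (intro mult_left_mono prod_le_1) (use * in auto)
  finally show ?thesis using lt by simp
qed

text \<open>
  The points of an ensemble, given by lifts, are distinct on the torus.
\<close>

definition distinct_points :: "nat \<Rightarrow> (nat \<Rightarrow> real ^ 'n) \<Rightarrow> bool" where
  "distinct_points N \<gamma> \<longleftrightarrow> (\<forall>j<N. \<forall>k<N. j \<noteq> k \<longrightarrow> \<gamma> j - \<gamma> k \<notin> period_lattice)"

lemma sum_list_concat_map:
  "sum_list (map g (concat (map h ks))) = (\<Sum>k\<leftarrow>ks. sum_list (map g (h k)))"
  by (induction ks) auto

text \<open>
  Completeness for an arbitrary topological domain; it is applied with domain \<open>nat\<close>, so that one complete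
  normed space holds the parameters of ensembles of every size.
\<close>

lemma complete_bcontfun_UNIV:
  "complete (UNIV :: ('a::topological_space \<Rightarrow>\<^sub>C 'b::complete_space) set)"
  unfolding complete_def
proof (intro allI impI, elim conjE)
  fix h :: "nat \<Rightarrow> 'a \<Rightarrow>\<^sub>C 'b"
  assume "Cauchy h"
  have "\<exists>N. \<forall>m n x. N \<le> m \<and> N \<le> n \<and> True \<longrightarrow> dist (h m x) (h n x) < e" if e: "e > 0" for e
  proof -
    obtain N where "\<And>m n. N \<le> m \<Longrightarrow> N \<le> n \<Longrightarrow> dist (h m) (h n) < e"
      using \<open>Cauchy h\<close> e unfolding Cauchy_def by blast
    then show ?thesis
      by (intro exI[of _ N]) (auto intro: dist_fun_lt_imp_dist_val_lt)
  qed
  then obtain g where "\<forall>e>0. \<exists>N. \<forall>n x. N \<le> n \<and> True \<longrightarrow> dist (h n x) (g x) < e"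
    using uniformly_convergent_eq_cauchy[of "\<lambda>_. True" "\<lambda>n. apply_bcontfun (h n)"] by blast
  then have "uniform_limit UNIV h g sequentially"
    unfolding uniform_limit_sequentially_iff by blast
  from uniform_limit_bcontfunE[OF this sequentially_bot]
  obtain l' where "g = apply_bcontfun l'" "h \<longlonglongrightarrow> l'" by metis
  then show "\<exists>l\<in>UNIV. h \<longlonglongrightarrow> l" by (intro bexI[of _ l']) auto
qed

lemma scaleR_sum_list_map:
  "c *\<^sub>R (\<Sum>p\<leftarrow>ps. g p) = (\<Sum>p\<leftarrow>ps. c *\<^sub>R (g p :: 'a::real_vector))"
  by (induction ps) (simp_all add: scaleR_add_right)

context drift
begin

text \<open>
  Waiting at the translations in \<open>ps\<close> for the given times moves a point at the origin along \<open>v\<close> and leaves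
  well separated points almost in place.
\<close>

definition pushes_origin :: "real ^ 'n \<Rightarrow> real \<Rightarrow> real \<Rightarrow> real ^ 'n \<Rightarrow> (real \<times> (real ^ 'n)) list \<Rightarrow> bool" where
  "pushes_origin m \<epsilon> \<rho> v ps \<longleftrightarrow> (\<forall>p\<in>set ps. 0 \<le> fst p) \<and>
     norm ((\<Sum>p\<leftarrow>ps. fst p *\<^sub>R (F (snd p) - m)) - v) \<le> \<epsilon> \<and>
     (\<forall>x. bump x \<le> \<rho> \<longrightarrow> norm (\<Sum>p\<leftarrow>ps. fst p *\<^sub>R (F (x + snd p) - m)) \<le> \<epsilon>)"

definition positively_spanning :: "real ^ 'n \<Rightarrow> bool" where
  "positively_spanning m \<longleftrightarrow> (\<forall>i. \<forall>\<sigma>\<in>{1, -1}. \<forall>\<epsilon>>0. \<forall>\<rho><1. \<exists>ps. pushes_origin m \<epsilon> \<rho> (\<sigma> *\<^sub>R axis i 1) ps)"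

text \<open>
  The parameter \<open>z\<close> is the desired displacement of the ensemble. For every point \<open>j\<close>, coordinate \<open>i\<close> and
  sign \<open>\<sigma>\<close> there is a family of blocks that moves point \<open>j\<close> alone along \<open>\<sigma> e\<^sub>i\<close>, used for times
  proportional to the positive part of \<open>\<sigma> z\<^sub>j\<^sub>i\<close>. Since \<open>max 0 t - max 0 (- t) = t\<close>, the velocities add up to \<open>z\<close>,
  with an error of small Lipschitz constant.
\<close>

lemma almost_identity_velocities:
  assumes span: "positively_spanning m"
    and dist: "distinct_points N \<gamma>"
  shows "\<exists>(bs :: (((nat \<Rightarrow>\<^sub>C (real ^ 'n)) \<Rightarrow> real) \<times> (real ^ 'n)) list) K. 0 \<le> K \<and>
    (\<forall>b\<in>set bs. (\<forall>z. 0 \<le> fst b z) \<and> fst b 0 = 0 \<and> (\<forall>z z'. \<bar>fst b z - fst b z'\<bar> \<le> K * norm (z - z'))) \<and>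
    (\<forall>k<N. \<forall>z z'. norm (steer_velocity (- m) bs z (\<gamma> k) - steer_velocity (- m) bs z' (\<gamma> k)
        - (apply_bcontfun z k - apply_bcontfun z' k)) \<le> 1/4 * norm (z - z'))"
proof -
  have "\<exists>\<rho><1. \<forall>j<N. \<forall>k<N. j \<noteq> k \<longrightarrow> bump (\<gamma> k - \<gamma> j) \<le> \<rho>"
  proof -
    let ?S = "insert 0 ((\<lambda>(j,k). bump (\<gamma> k - \<gamma> j)) ` {(j,k). j < N \<and> k < N \<and> j \<noteq> k})"
    have fin: "finite {(j,k). j < N \<and> k < N \<and> j \<noteq> k}"
      by (rule finite_subset[of _ "{..<N} \<times> {..<N}"]) auto
    have "Max ?S < 1"
      using fin dist bump_less_one by (subst Max_less_iff) (auto simp: distinct_points_def)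
    moreover have "bump (\<gamma> k - \<gamma> j) \<le> Max ?S" if "j < N" "k < N" "j \<noteq> k" for j k
      using fin that by (intro Max_ge) (auto intro!: rev_image_eqI[of "(j,k)"])
    ultimately show ?thesis by blast
  qed
  then obtain \<rho> where \<rho>: "\<rho> < 1" "\<And>j k. j < N \<Longrightarrow> k < N \<Longrightarrow> j \<noteq> k \<Longrightarrow> bump (\<gamma> k - \<gamma> j) \<le> \<rho>"
    by blast
  define I where "I = {..<N} \<times> (UNIV :: 'n set) \<times> {1, -1 :: real}"
  have fI: "finite I" by (simp add: I_def)
  define \<epsilon> where "\<epsilon> = 1 / (4 * (real (card I) + 1))"
  have \<epsilon>: "\<epsilon> > 0" by (simp add: \<epsilon>_def)
  define ps where "ps i \<sigma> = (SOME ps. pushes_origin m \<epsilon> \<rho> (\<sigma> *\<^sub>R axis i 1) ps)" for i \<sigma>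
  have ps: "pushes_origin m \<epsilon> \<rho> (\<sigma> *\<^sub>R axis i 1) (ps i \<sigma>)" if "\<sigma> \<in> {1, -1}" for i \<sigma>
    unfolding ps_def
    by (rule someI_ex, rule span[unfolded positively_spanning_def, rule_format, OF that \<epsilon> \<rho>(1)])
  have ps0: "0 \<le> fst p" if "\<sigma> \<in> {1, -1}" "p \<in> set (ps i \<sigma>)" for i \<sigma> p
    using ps[OF that(1)] that(2) unfolding pushes_origin_def by blast
  have ps1: "norm ((\<Sum>p\<leftarrow>ps i \<sigma>. fst p *\<^sub>R (F (snd p) - m)) - \<sigma> *\<^sub>R axis i 1) \<le> \<epsilon>"
    if "\<sigma> \<in> {1, -1}" for i \<sigma>
    using ps[OF that(1)] unfolding pushes_origin_def by blast
  have ps2: "norm (\<Sum>p\<leftarrow>ps i \<sigma>. fst p *\<^sub>R (F (x + snd p) - m)) \<le> \<epsilon>"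
    if "\<sigma> \<in> {1, -1}" "bump x \<le> \<rho>" for i \<sigma> x
    using ps[OF that(1)] that(2) unfolding pushes_origin_def by blast
  obtain il where il: "set il = I" "distinct il"
    using finite_distinct_list[OF fI] by blast
  define wt where "wt z q = max 0 (snd (snd q) * (apply_bcontfun z (fst q) $ fst (snd q)))"
    for z :: "nat \<Rightarrow>\<^sub>C (real ^ 'n)" and q :: "nat \<times> 'n \<times> real"
  define bs where "bs = concat (map (\<lambda>q. map (\<lambda>p. (\<lambda>z. fst p * wt z q, snd p - \<gamma> (fst q)))
      (ps (fst (snd q)) (snd (snd q)))) il)"
  define V where "V q k = (\<Sum>p\<leftarrow>ps (fst (snd q)) (snd (snd q)). fst p *\<^sub>R (F (\<gamma> k - \<gamma> (fst q) + snd p) - m))"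
    for q :: "nat \<times> 'n \<times> real" and k
  define U where "U q k = (if fst q = k then snd (snd q) *\<^sub>R axis (fst (snd q)) 1 else 0 :: real ^ 'n)"
    for q :: "nat \<times> 'n \<times> real" and k
  have vel: "steer_velocity (- m) bs z (\<gamma> k) = (\<Sum>q\<in>I. wt z q *\<^sub>R V q k)" for z k
  proof -
    have "steer_velocity (- m) bs z (\<gamma> k) = (\<Sum>q\<leftarrow>il. wt z q *\<^sub>R V q k)"
      unfolding steer_velocity_def bs_def sum_list_concat_map V_def
      by (intro arg_cong[where f = sum_list] map_cong refl)
        (simp add: o_def scaleR_sum_list_map add_diff_eq diff_add_eq mult.commute)
    then show ?thesis
      using il by (simp add: sum_list_distinct_conv_sum_set)
  qed
  have VU: "norm (V q k - U q k) \<le> \<epsilon>" if "q \<in> I" "k < N" for q k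
    using that ps1[of "snd (snd q)" "fst (snd q)"] ps2[of "snd (snd q)" "\<gamma> k - \<gamma> (fst q)" "fst (snd q)"] \<rho>(2)[of "fst q" k]
    by (auto simp: V_def U_def I_def)
  have ident: "(\<Sum>q\<in>I. wt z q *\<^sub>R U q k) = apply_bcontfun z k" if "k < N" for z k
  proof -
    have "(\<Sum>q\<in>I. wt z q *\<^sub>R U q k) = (\<Sum>j<N. \<Sum>r\<in>UNIV \<times> {1,-1}. wt z (j, r) *\<^sub>R U (j, r) k)"
      unfolding I_def by (simp add: sum.cartesian_product)
    also have "\<dots> = (\<Sum>j<N. if j = k then \<Sum>r\<in>UNIV \<times> {1,-1}. wt z (j, r) *\<^sub>R snd r *\<^sub>R axis (fst r) 1 else 0)"
      by (intro sum.cong) (auto simp: U_def)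
    also have "\<dots> = (\<Sum>r\<in>UNIV \<times> {1,-1}. wt z (k, r) *\<^sub>R snd r *\<^sub>R axis (fst r) 1)"
      using that by simp
    also have "\<dots> = (\<Sum>i\<in>UNIV. \<Sum>\<sigma>\<in>{1,-1}. wt z (k, i, \<sigma>) *\<^sub>R \<sigma> *\<^sub>R axis i 1)"
      unfolding sum.cartesian_product by (intro sum.cong) auto
    also have "\<dots> = (\<Sum>i\<in>UNIV. (apply_bcontfun z k $ i) *\<^sub>R axis i 1)"
      by (intro sum.cong refl) (auto simp: wt_def max_def)
    also have "\<dots> = apply_bcontfun z k"
      using basis_expansion[of "apply_bcontfun z k"] by (simp add: scalar_mult_eq_scaleR)
    finally show ?thesis .
  qed
  have wlip: "\<bar>wt z q - wt z' q\<bar> \<le> norm (z - z')" if "q \<in> I" for z z' q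
  proof -
    obtain j i \<sigma> where q: "q = (j, i, \<sigma>)" by (cases q) auto
    have "\<bar>wt z q - wt z' q\<bar> \<le> \<bar>\<sigma> * (apply_bcontfun z j $ i) - \<sigma> * (apply_bcontfun z' j $ i)\<bar>"
      unfolding wt_def q by auto
    also have "\<dots> = \<bar>apply_bcontfun (z - z') j $ i\<bar>"
      using that unfolding I_def q by auto
    also have "\<dots> \<le> norm (z - z')"
      using component_le_norm_cart norm_bounded order_trans by blast
    finally show ?thesis .
  qed
  have fin: "finite (\<Union>i. \<Union>\<sigma>\<in>{1,-1}. fst ` set (ps i \<sigma>))"
    by auto
  then have "bdd_above (\<Union>i. \<Union>\<sigma>\<in>{1,-1}. fst ` set (ps i \<sigma>))"
    by (rule bdd_above_finite)
  then obtain K0 where K0: "\<And>a. a \<in> (\<Union>i. \<Union>\<sigma>\<in>{1,-1}. fst ` set (ps i \<sigma>)) \<Longrightarrow> a \<le> K0"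
    unfolding bdd_above_def by metis
  define K where "K = max 0 K0"
  have K: "0 \<le> K" by (simp add: K_def)
  have K1: "fst p \<le> K" if "\<sigma> \<in> {1,-1}" "p \<in> set (ps i \<sigma>)" for i \<sigma> p
  proof -
    have "fst p \<in> (\<Union>i. \<Union>\<sigma>\<in>{1,-1}. fst ` set (ps i \<sigma>))"
      by (rule UN_I[OF UNIV_I], rule UN_I[OF that(1)], rule imageI[OF that(2)])
    from K0[OF this] show ?thesis by (simp add: K_def)
  qed
  show ?thesis
  proof (intro exI[of _ bs] exI[of _ K] conjI ballI allI impI K)
    fix b assume "b \<in> set bs"
    then obtain q p where q: "q \<in> I" "p \<in> set (ps (fst (snd q)) (snd (snd q)))"
      and b: "b = (\<lambda>z. fst p * wt z q, snd p - \<gamma> (fst q))"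
      unfolding bs_def using il(1) by auto
    have sg: "snd (snd q) \<in> {1, -1}" using q(1) by (auto simp: I_def)
    have p: "0 \<le> fst p" "fst p \<le> K" using ps0[OF sg q(2)] K1[OF sg q(2)] .
    show "0 \<le> fst b z" for z using p by (simp add: b wt_def)
    show "fst b 0 = 0" by (simp add: b wt_def)
    show "\<bar>fst b z - fst b z'\<bar> \<le> K * norm (z - z')" for z z'
    proof -
      have "\<bar>fst b z - fst b z'\<bar> = fst p * \<bar>wt z q - wt z' q\<bar>"
        using p by (simp add: b abs_mult flip: right_diff_distrib)
      also have "\<dots> \<le> K * norm (z - z')"
        using p wlip[OF q(1)] K by (intro mult_mono) auto
      finally show ?thesis .
    qed
  next
    fix k z z' assume k: "k < N"
    have "steer_velocity (- m) bs z (\<gamma> k) - steer_velocity (- m) bs z' (\<gamma> k)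
        - (apply_bcontfun z k - apply_bcontfun z' k) = (\<Sum>q\<in>I. (wt z q - wt z' q) *\<^sub>R (V q k - U q k))"
      unfolding vel ident[OF k, symmetric] by (simp add: algebra_simps sum.distrib sum_subtractf)
    also have "norm \<dots> \<le> (\<Sum>q\<in>I. norm (z - z') * \<epsilon>)"
      using wlip VU k by (intro sum_norm_le) (simp add: mult_mono)
    also have "\<dots> = (real (card I) * \<epsilon>) * norm (z - z')"
      by simp
    also have "\<dots> \<le> 1/4 * norm (z - z')"
      by (intro mult_right_mono) (auto simp: \<epsilon>_def field_simps)
    finally show "norm (steer_velocity (- m) bs z (\<gamma> k) - steer_velocity (- m) bs z' (\<gamma> k)
        - (apply_bcontfun z k - apply_bcontfun z' k)) \<le> 1/4 * norm (z - z')" .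
  qed
qed

text \<open>
  With waiting times of scale \<open>T\<close> the endpoints are \<open>x + T (z + small)\<close>, where "small" has Lipschitz constant
  at most \<open>1/2\<close> in \<open>z\<close>. Hence \<open>z \<mapsto> z - (endpoint - x') / T\<close> is a contraction of the unit ball, and a
  fixed point steers \<open>x\<close> exactly to \<open>x'\<close>.
\<close>

theorem local_reach:
  assumes span: "positively_spanning m"
    and dist: "distinct_points N \<gamma>"
  shows "\<exists>r>0. \<forall>x x'. (\<forall>j<N. norm (x j - \<gamma> j) \<le> r \<and> norm (x' j - \<gamma> j) \<le> r) \<longrightarrow> reach f N x x'"
proof -
  obtain bs :: "(((nat \<Rightarrow>\<^sub>C (real ^ 'n)) \<Rightarrow> real) \<times> (real ^ 'n)) list" and K where K: "0 \<le> K"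
    and bs: "\<And>b z. b \<in> set bs \<Longrightarrow> 0 \<le> fst b z" "\<And>b. b \<in> set bs \<Longrightarrow> fst b 0 = 0"
      "\<And>b z z'. b \<in> set bs \<Longrightarrow> \<bar>fst b z - fst b z'\<bar> \<le> K * norm (z - z')"
    and vel: "\<And>k z z'. k < N \<Longrightarrow> norm (steer_velocity (- m) bs z (\<gamma> k) - steer_velocity (- m) bs z' (\<gamma> k)
        - (apply_bcontfun z k - apply_bcontfun z' k)) \<le> 1/4 * norm (z - z')"
  proof -
    from almost_identity_velocities[OF span dist]
    obtain bs :: "(((nat \<Rightarrow>\<^sub>C (real ^ 'n)) \<Rightarrow> real) \<times> (real ^ 'n)) list" and K where "0 \<le> K"
      and "\<forall>b\<in>set bs. (\<forall>z. 0 \<le> fst b z) \<and> fst b 0 = 0 \<and> (\<forall>z z'. \<bar>fst b z - fst b z'\<bar> \<le> K * norm (z - z'))"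
      and "\<forall>k<N. \<forall>z z'. norm (steer_velocity (- m) bs z (\<gamma> k) - steer_velocity (- m) bs z' (\<gamma> k)
        - (apply_bcontfun z k - apply_bcontfun z' k)) \<le> 1/4 * norm (z - z')"
      by (elim exE conjE) (rule that)
    then show thesis by (intro that[of K bs]) auto
  qed
  define D where "D = cball (0 :: nat \<Rightarrow>\<^sub>C (real ^ 'n)) 1"
  have bK: "fst b z \<le> K" if "b \<in> set bs" "z \<in> D" for b z
  proof -
    have "fst b z \<le> K * norm (z - 0)"
      using bs(3)[OF that(1), of z 0] bs(2)[OF that(1)] by simp
    also have "\<dots> \<le> K * 1"
      using K that(2) by (intro mult_left_mono) (auto simp: D_def)
    finally show ?thesis by simp
  qed
  obtain C where C: "0 \<le> C" and st: "\<And>T \<delta> r c x. 0 < T \<Longrightarrow> T \<le> 1 \<Longrightarrow> 0 < \<delta> \<Longrightarrow> \<delta> \<le> T \<Longrightarrow> 0 \<le> r \<Longrightarrow> r \<le> 1 \<Longrightarrow>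
      norm (x - c) \<le> r \<Longrightarrow>
      norm (steer \<delta> (- m) T bs 0 x - x) \<le> C * \<delta> \<and>
      (\<forall>z\<in>D. \<forall>z'\<in>D. norm ((steer \<delta> (- m) T bs z x - x - T *\<^sub>R steer_velocity (- m) bs z c)
          - (steer \<delta> (- m) T bs z' x - x - T *\<^sub>R steer_velocity (- m) bs z' c))
        \<le> C * (T * (T + r)) * norm (z - z'))"
  proof -
    have "\<exists>C'\<ge>0. steer_accurate (- m) bs D 0 C'"
      by (rule steer_estimates[OF _ K]) (use bs bK in \<open>auto simp: D_def\<close>)
    then obtain C where C: "0 \<le> C" "steer_accurate (- m) bs D 0 C"
      by blast
    show thesis
    proof (rule that[OF C(1)])
      fix T \<delta> r :: real and c x :: "real ^ 'n"
      assume "0 < T" "T \<le> 1" "0 < \<delta>" "\<delta> \<le> T" "0 \<le> r" "r \<le> 1" "norm (x - c) \<le> r"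
      then show "norm (steer \<delta> (- m) T bs 0 x - x) \<le> C * \<delta> \<and>
      (\<forall>z\<in>D. \<forall>z'\<in>D. norm ((steer \<delta> (- m) T bs z x - x - T *\<^sub>R steer_velocity (- m) bs z c)
          - (steer \<delta> (- m) T bs z' x - x - T *\<^sub>R steer_velocity (- m) bs z' c))
        \<le> C * (T * (T + r)) * norm (z - z'))"
        using C(2)[unfolded steer_accurate_def steer_error_def, rule_format, of T \<delta> r "\<lambda>_. x" c] by simp
    qed
  qed
  \<comment> \<open>\<open>T\<close> makes the Lipschitz error \<open>C (T + r)\<close> at most \<open>1/4\<close>; given \<open>T\<close>, the numbers \<open>r\<close> and \<open>\<delta>\<close> make the
    image of 0 under the contraction at most \<open>1/2\<close>\<close>
  define T where "T = 1 / (8 * (C + 1))"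
  define r where "r = T / 8"
  define \<delta> where "\<delta> = T / (4 * (C + 1))"
  have T: "0 < T" "T \<le> 1" using C by (auto simp: T_def)
  have r: "0 < r" "r \<le> 1" "r \<le> T" using T by (auto simp: r_def)
  have \<delta>: "0 < \<delta>" "\<delta> \<le> T" "C * \<delta> \<le> T / 4"
    using T C by (auto simp: \<delta>_def field_simps)
  have CT: "C * (T + r) \<le> 1/4"
  proof -
    have "C * (T + r) \<le> C * (2 * T)"
      using r C by (intro mult_left_mono) auto
    also have "\<dots> \<le> 1/4"
      using C by (simp add: T_def field_simps)
    finally show ?thesis .
  qed
  show ?thesis
  proof (rule exI[of _ r], intro conjI r allI impI)
    fix x x' assume xx: "\<forall>j<N. norm (x j - \<gamma> j) \<le> r \<and> norm (x' j - \<gamma> j) \<le> r"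
    define S where "S z k = steer \<delta> (- m) T bs z (x k)" for z k
    define G where "G z k = (if k < N then apply_bcontfun z k - (1 / T) *\<^sub>R (S z k - x' k) else 0)" for z k
    have "G z \<in> bcontfun" for z
    proof -
      have "continuous_on UNIV (G z)"
        by (simp add: continuous_on_open_vimage open_discrete)
      moreover have "range (G z) \<subseteq> insert 0 (G z ` {..<N})"
        by (auto simp: G_def)
      then have "bounded (range (G z))"
        by (meson bounded_subset finite_imageI finite_imp_bounded finite_insert finite_lessThan)
      ultimately show ?thesis by (simp add: bcontfun_def)
    qed
    then have ap: "apply_bcontfun (Bcontfun (G z)) = G z" for z
      by (simp add: Bcontfun_inverse)
    have contr: "dist (Bcontfun (G z)) (Bcontfun (G z')) \<le> 1/2 * dist z z'" if z: "z \<in> D" "z' \<in> D" for z z'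
    proof (rule dist_bound)
      fix k
      show "dist (apply_bcontfun (Bcontfun (G z)) k) (apply_bcontfun (Bcontfun (G z')) k) \<le> 1/2 * dist z z'"
      proof (cases "k < N")
        case True
        define e where "e z = S z k - x k - T *\<^sub>R steer_velocity (- m) bs z (\<gamma> k)" for z
        have e: "norm (e z - e z') \<le> C * (T * (T + r)) * norm (z - z')"
          using st[of T \<delta> r "x k" "\<gamma> k"] T \<delta> r xx True z unfolding e_def S_def by simp
        have Geq: "G z k - G z' k = - (steer_velocity (- m) bs z (\<gamma> k) - steer_velocity (- m) bs z' (\<gamma> k)
            - (apply_bcontfun z k - apply_bcontfun z' k)) - (1 / T) *\<^sub>R (e z - e z')"
          using True T by (simp add: G_def e_def algebra_simps)
        have eT: "norm ((1 / T) *\<^sub>R (e z - e z')) \<le> (1 / T) * (C * (T * (T + r)) * norm (z - z'))"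
        proof -
          have "\<bar>1 / T\<bar> = 1 / T" "0 \<le> 1 / T" using T by auto
          then show ?thesis unfolding norm_scaleR by (simp only: mult_left_mono[OF e])
        qed
        have "norm (G z k - G z' k) \<le> 1/4 * norm (z - z') + (1 / T) * (C * (T * (T + r)) * norm (z - z'))"
          unfolding Geq
          by (rule order_trans[OF norm_triangle_ineq4 add_mono[OF _ eT]])
            (simp only: norm_minus_cancel vel[OF True])
        also have "\<dots> = (1/4 + C * (T + r)) * norm (z - z')"
          using T by (simp add: field_simps)
        also have "\<dots> \<le> 1/2 * norm (z - z')"
          using CT by (intro mult_right_mono) auto
        finally show ?thesis by (simp add: ap dist_norm)
      qed (simp add: ap G_def)
    qed
    have zero: "norm (Bcontfun (G 0)) \<le> 1/2"
    proof (rule norm_bound)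
      fix k
      show "norm (apply_bcontfun (Bcontfun (G 0)) k) \<le> 1/2"
      proof (cases "k < N")
        case True
        have "norm (S 0 k - x k) \<le> C * \<delta>"
          using st[of T \<delta> r "x k" "\<gamma> k"] T \<delta> r xx True unfolding S_def by simp
        moreover have "norm (x k - x' k) \<le> 2 * r"
          using norm_triangle_ineq4[of "x k - \<gamma> k" "x' k - \<gamma> k"] xx True by force
        ultimately have "norm (S 0 k - x' k) \<le> C * \<delta> + 2 * r"
          using norm_triangle_ineq[of "S 0 k - x k" "x k - x' k"] by simp
        also have "\<dots> \<le> T / 2"
          using \<delta>(3) by (simp add: r_def)
        finally have "norm (S 0 k - x' k) / T \<le> 1/2"
          using T by (simp add: field_simps)
        then show ?thesis
          using True T by (simp add: ap G_def)
      qed (simp add: ap G_def)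
    qed
    have self: "(\<lambda>z. Bcontfun (G z)) ` D \<subseteq> D"
    proof clarify
      fix z assume z: "z \<in> D"
      have "norm (Bcontfun (G z)) \<le> dist (Bcontfun (G z)) (Bcontfun (G 0)) + norm (Bcontfun (G 0))"
        using norm_triangle_sub by (metis add.commute dist_norm)
      also have "\<dots> \<le> 1/2 * dist z 0 + 1/2"
        using contr[OF z, of 0] zero by (simp add: D_def)
      also have "\<dots> \<le> 1"
        using z by (simp add: D_def dist_commute)
      finally show "Bcontfun (G z) \<in> D" by (simp add: D_def)
    qed
    have "complete D"
      unfolding D_def by (rule complete_closed_subset[OF closed_cball subset_UNIV complete_bcontfun_UNIV])
    then have "\<exists>!z\<in>D. Bcontfun (G z) = z"
      using Banach_fix[of D "1/2" "\<lambda>z. Bcontfun (G z)"] self contr by (auto simp: D_def)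
    then obtain z where z: "z \<in> D" "Bcontfun (G z) = z" by blast
    have Sx: "S z k = x' k" if "k < N" for k
    proof -
      have "apply_bcontfun z k = apply_bcontfun z k - (1 / T) *\<^sub>R (S z k - x' k)"
        using fun_cong[OF ap[of z], of k] that unfolding z(2) G_def by simp
      then show ?thesis using T by simp
    qed
    have "reach f N x (\<lambda>j. S z j)"
      unfolding S_def by (rule reach_steer) (use T \<delta> bs in auto)
    then show "reach f N x x'"
      by (rule reach_cong) (simp_all add: Sx)
  qed
qed

end

section \<open>Reversing the drift by averaging its translates\<close>

definition grid :: "nat \<Rightarrow> ('n \<Rightarrow> nat) set" where
  "grid n = {q. \<forall>i. q i < n}"

definition grid_point :: "nat \<Rightarrow> ('n \<Rightarrow> nat) \<Rightarrow> real ^ ('n::finite)" where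
  "grid_point n q = (\<chi> i. 2 * pi * real (q i) / real n)"

lemma grid_PiE: "grid n = PiE UNIV (\<lambda>_. {..<n})"
  by (auto simp: grid_def PiE_def Pi_def)

lemma finite_grid [simp]: "finite (grid n :: ('n::finite \<Rightarrow> nat) set)"
  unfolding grid_PiE by (intro finite_PiE) auto

lemma card_grid: "card (grid n :: ('n::finite \<Rightarrow> nat) set) = n ^ CARD('n)"
  unfolding grid_PiE by (subst card_PiE) auto

context drift
begin

definition grid_sum :: "nat \<Rightarrow> real ^ 'n \<Rightarrow> real ^ 'n" where
  "grid_sum n x = (\<Sum>q\<in>grid n. F (x + grid_point n q))"

text \<open>
  A shift by a grid vector permutes the grid modulo the lattice.
\<close>

lemma grid_sum_shift:
  fixes k :: "'n \<Rightarrow> int"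
  assumes n: "n > 0"
  shows "grid_sum n (x + (\<chi> i. 2 * pi * of_int (k i) / real n)) = grid_sum n x"
  unfolding grid_sum_def
proof (rule sum.reindex_bij_witness[where
    i = "\<lambda>q i. nat ((int (q i) - k i) mod int n)" and j = "\<lambda>q i. nat ((int (q i) + k i) mod int n)"])
  fix q :: "'n \<Rightarrow> nat" assume q: "q \<in> grid n"
  then have qi: "q i < n" for i by (simp add: grid_def)
  have pos: "0 \<le> a mod int n" "a mod int n < int n" for a using n by auto
  show "(\<lambda>i. nat ((int (q i) + k i) mod int n)) \<in> grid n"
    "(\<lambda>i. nat ((int (q i) - k i) mod int n)) \<in> grid n"
    using pos n by (auto simp: grid_def nat_less_iff)
  show "(\<lambda>i. nat ((int (nat ((int (q i) + k i) mod int n)) - k i) mod int n)) = q"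
    "(\<lambda>i. nat ((int (nat ((int (q i) - k i) mod int n)) + k i) mod int n)) = q"
    using pos qi n by (auto simp: fun_eq_iff mod_simps)
  define l :: "real ^ 'n" where "l = (\<chi> i. 2 * pi * of_int ((int (q i) + k i) div int n))"
  have l: "l \<in> period_lattice" unfolding l_def period_lattice_def by auto
  have "x + (\<chi> i. 2 * pi * of_int (k i) / real n) + grid_point n q
      = x + grid_point n (\<lambda>i. nat ((int (q i) + k i) mod int n)) + l"
  proof (rule vec_eq_iff[THEN iffD2], rule allI)
    fix i
    have "real_of_int (int (q i) + k i)
        = real_of_int ((int (q i) + k i) div int n * int n + (int (q i) + k i) mod int n)"
      by (simp only: div_mult_mod_eq)
    moreover have "real (nat ((int (q i) + k i) mod int n)) = of_int ((int (q i) + k i) mod int n)"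
      using pos by simp
    ultimately have e: "real (q i) + of_int (k i)
        = of_int ((int (q i) + k i) div int n) * real n + real (nat ((int (q i) + k i) mod int n))"
      by (simp only: of_int_add of_int_mult of_int_of_nat_eq)
    have "2 * pi * of_int (k i) / real n + 2 * pi * real (q i) / real n
       = 2 * pi * (real (q i) + of_int (k i)) / real n"
      by (simp add: add_divide_distrib distrib_left)
    also have "\<dots> = 2 * pi * real (nat ((int (q i) + k i) mod int n)) / real n
        + 2 * pi * of_int ((int (q i) + k i) div int n)"
      unfolding e using n by (simp add: field_simps)
    finally show "(x + (\<chi> i. 2 * pi * of_int (k i) / real n) + grid_point n q) $ i
      = (x + grid_point n (\<lambda>i. nat ((int (q i) + k i) mod int n)) + l) $ i"
      by (simp add: l_def grid_point_def)
  qed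
  then show "F (x + grid_point n (\<lambda>i. nat ((int (q i) + k i) mod int n)))
    = F (x + (\<chi> i. 2 * pi * of_int (k i) / real n) + grid_point n q)"
    by (simp only: lift_field_periodic[OF l])
qed

definition osc :: real where "osc = 2 * pi * real CARD('n) * L"

lemma lip_box:
  assumes "\<And>i. \<bar>x $ i - y $ i\<bar> \<le> 2 * pi * c"
  shows "norm (F x - F y) \<le> osc * c"
proof -
  have "norm (x - y) \<le> (\<Sum>i\<in>UNIV. \<bar>(x - y) $ i\<bar>)"
    by (rule norm_le_l1_cart)
  also have "\<dots> \<le> (\<Sum>i\<in>(UNIV :: 'n set). 2 * pi * c)"
    by (intro sum_mono) (use assms in auto)
  finally have "L * norm (x - y) \<le> L * (real CARD('n) * (2 * pi * c))"
    using L_pos by simp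
  then show ?thesis
    using lip[of x y] by (simp add: osc_def algebra_simps)
qed

text \<open>
  By the previous lemma only shifts smaller than the grid spacing matter.
\<close>

lemma grid_sum_oscillation:
  assumes n: "n > 0"
  shows "norm (grid_sum n x - grid_sum n y) \<le> real n ^ CARD('n) * (osc / real n)"
proof -
  define k where "k i = \<lfloor>(x $ i - y $ i) * real n / (2 * pi)\<rfloor>" for i
  define y' where "y' = y + (\<chi> i. 2 * pi * of_int (k i) / real n)"
  have close: "\<bar>(x + p) $ i - (y' + p) $ i\<bar> \<le> 2 * pi * (1 / real n)" for i p
  proof -
    define t where "t = (x $ i - y $ i) * real n / (2 * pi)"
    have xy: "x $ i - y $ i = 2 * pi / real n * t"
      using n by (simp add: t_def)
    have "(x + p) $ i - (y' + p) $ i = 2 * pi / real n * (t - of_int \<lfloor>t\<rfloor>)"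
    proof -
      have "(x + p) $ i - (y' + p) $ i = (x $ i - y $ i) - 2 * pi / real n * of_int \<lfloor>t\<rfloor>"
        by (simp add: y'_def k_def t_def)
      then show ?thesis unfolding xy by (simp only: right_diff_distrib)
    qed
    moreover have "0 \<le> t - of_int \<lfloor>t\<rfloor>" "t - of_int \<lfloor>t\<rfloor> \<le> 1" by linarith+
    moreover have "0 \<le> 2 * pi / real n" by simp
    ultimately show ?thesis
      using mult_left_mono[of "t - of_int \<lfloor>t\<rfloor>" 1 "2 * pi / real n"] by (simp add: abs_mult)
  qed
  have "grid_sum n y = grid_sum n y'"
    unfolding y'_def by (rule grid_sum_shift[OF n, symmetric])
  then have "grid_sum n x - grid_sum n y = (\<Sum>q\<in>grid n. F (x + grid_point n q) - F (y' + grid_point n q))"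
    by (simp add: grid_sum_def sum_subtractf)
  also have "norm \<dots> \<le> (\<Sum>q\<in>(grid n :: ('n \<Rightarrow> nat) set). osc * (1 / real n))"
    by (intro sum_norm_le lip_box close)
  finally show ?thesis
    by (simp add: card_grid)
qed

lemma grid_sum_refine:
  assumes n: "n1 > 0" "n2 > 0"
  shows "grid_sum (n1 * n2) x = (\<Sum>q\<in>grid n2. grid_sum n1 (x + grid_point (n1 * n2) q))"
proof -
  have "(\<Sum>q\<in>grid n2. grid_sum n1 (x + grid_point (n1 * n2) q))
      = (\<Sum>p\<in>grid n2 \<times> grid n1. F (x + grid_point (n1 * n2) (fst p) + grid_point n1 (snd p)))"
    unfolding grid_sum_def sum.cartesian_product by (intro sum.cong) auto
  also have "\<dots> = grid_sum (n1 * n2) x"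
    unfolding grid_sum_def
  proof (rule sum.reindex_bij_witness[where
      i = "\<lambda>q. (\<lambda>i. q i mod n2, \<lambda>i. q i div n2)" and j = "\<lambda>p i. snd p i * n2 + fst p i"])
    fix p :: "('n \<Rightarrow> nat) \<times> ('n \<Rightarrow> nat)" assume p: "p \<in> grid n2 \<times> grid n1"
    then have p: "fst p i < n2" "snd p i < n1" for i by (auto simp: grid_def)
    show "(\<lambda>i. (snd p i * n2 + fst p i) mod n2, \<lambda>i. (snd p i * n2 + fst p i) div n2) = p"
      using p n by (auto simp: prod_eq_iff fun_eq_iff)
    have "snd p i * n2 + fst p i < n1 * n2" for i
    proof -
      have "snd p i * n2 + fst p i < Suc (snd p i) * n2" using p by simp
      also have "\<dots> \<le> n1 * n2" using p(2)[of i] by (intro mult_le_mono1) simp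
      finally show ?thesis .
    qed
    then show "(\<lambda>i. snd p i * n2 + fst p i) \<in> grid (n1 * n2)" by (simp add: grid_def)
    have "grid_point (n1 * n2) (\<lambda>i. snd p i * n2 + fst p i) = grid_point (n1 * n2) (fst p) + grid_point n1 (snd p)"
      using n by (simp add: grid_point_def vec_eq_iff field_simps)
    then show "F (x + grid_point (n1 * n2) (\<lambda>i. snd p i * n2 + fst p i))
        = F (x + grid_point (n1 * n2) (fst p) + grid_point n1 (snd p))"
      by (simp add: add.assoc)
  next
    fix q :: "'n \<Rightarrow> nat" assume "q \<in> grid (n1 * n2)"
    then have q: "q i < n1 * n2" for i by (simp add: grid_def)
    show "(\<lambda>i. snd (\<lambda>i. q i mod n2, \<lambda>i. q i div n2) i * n2 + fst (\<lambda>i. q i mod n2, \<lambda>i. q i div n2) i) = q"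
      by (simp add: fun_eq_iff)
    show "(\<lambda>i. q i mod n2, \<lambda>i. q i div n2) \<in> grid n2 \<times> grid n1"
      using q n by (simp add: grid_def less_mult_imp_div_less)
  qed
  finally show ?thesis by simp
qed

definition grid_mean :: "nat \<Rightarrow> real ^ 'n \<Rightarrow> real ^ 'n" where
  "grid_mean n x = (1 / real n ^ CARD('n)) *\<^sub>R grid_sum n x"

lemma grid_mean_refine:
  assumes n: "n1 > 0" "n2 > 0"
  shows "norm (grid_mean (n1 * n2) x - grid_mean n1 y) \<le> osc / real n1"
proof -
  have "grid_sum (n1 * n2) x - real n2 ^ CARD('n) *\<^sub>R grid_sum n1 y
      = (\<Sum>q\<in>grid n2. grid_sum n1 (x + grid_point (n1 * n2) q) - grid_sum n1 y)"
    using grid_sum_refine[OF n, of x] by (simp add: sum_subtractf card_grid sum_constant_scaleR del: sum_constant)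
  also have "norm \<dots> \<le> (\<Sum>q\<in>(grid n2 :: ('n \<Rightarrow> nat) set). real n1 ^ CARD('n) * (osc / real n1))"
    by (intro sum_norm_le grid_sum_oscillation n)
  finally have *: "norm (grid_sum (n1 * n2) x - real n2 ^ CARD('n) *\<^sub>R grid_sum n1 y)
      \<le> real (n1 * n2) ^ CARD('n) * (osc / real n1)"
    by (simp add: card_grid power_mult_distrib mult_ac)
  define P where "P = real (n1 * n2) ^ CARD('n)"
  have P: "P > 0" using n by (simp add: P_def)
  have "grid_mean (n1 * n2) x - grid_mean n1 y
     = (1 / P) *\<^sub>R (grid_sum (n1 * n2) x - real n2 ^ CARD('n) *\<^sub>R grid_sum n1 y)"
    using n by (simp add: grid_mean_def P_def scaleR_diff_right power_mult_distrib)
  then have "norm (grid_mean (n1 * n2) x - grid_mean n1 y)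
     = (1 / P) * norm (grid_sum (n1 * n2) x - real n2 ^ CARD('n) *\<^sub>R grid_sum n1 y)"
    using P by simp
  also have "\<dots> \<le> (1 / P) * (P * (osc / real n1))"
    using * P unfolding P_def[symmetric] by (intro mult_left_mono) auto
  finally show ?thesis using P by simp
qed

text \<open>
  Refining a grid changes the grid mean by no more than its oscillation, so the means over dyadic grids
  converge, uniformly in the base point. The limit \<open>m\<close> is the mean of \<open>F\<close> over the torus.
\<close>

lemma grid_mean_limit: "\<exists>m. \<forall>r x. norm (grid_mean (2 ^ r) x - m) \<le> osc / 2 ^ r"
proof -
  have ref: "norm (grid_mean (2 ^ s) x - grid_mean (2 ^ r) y) \<le> osc / 2 ^ r" if "r \<le> s" for r s x y
    using grid_mean_refine[of "2 ^ r" "2 ^ (s - r)" x y] that by (simp flip: power_add)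
  have small: "(\<lambda>r. osc / 2 ^ r) \<longlonglongrightarrow> 0"
    using LIMSEQ_divide_realpow_zero[of 2 osc] by simp
  have "Cauchy (\<lambda>r. grid_mean (2 ^ r) 0)"
  proof (rule metric_CauchyI)
    fix e :: real assume e: "e > 0"
    then obtain R where R: "osc / 2 ^ R < e / 2"
      using order_tendstoD(2)[OF small, of "e / 2"] unfolding eventually_sequentially by auto
    have "dist (grid_mean (2 ^ s) 0) (grid_mean (2 ^ t) 0) < e" if "s \<ge> R" "t \<ge> R" for s t
      using ref[OF that(1), of 0 0] ref[OF that(2), of 0 0] R
        dist_triangle2[of "grid_mean (2 ^ s) 0" "grid_mean (2 ^ t) 0" "grid_mean (2 ^ R) 0"]
      unfolding dist_norm by argo
    then show "\<exists>R. \<forall>s\<ge>R. \<forall>t\<ge>R. dist (grid_mean (2 ^ s) 0) (grid_mean (2 ^ t) 0) < e" by blast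
  qed
  then obtain m where m: "(\<lambda>r. grid_mean (2 ^ r) 0) \<longlonglongrightarrow> m"
    using Cauchy_convergent_iff convergent_def by blast
  have "norm (grid_mean (2 ^ r) x - m) \<le> osc / 2 ^ r" for r x
  proof -
    have "(\<lambda>s. norm (grid_mean (2 ^ s) 0 - grid_mean (2 ^ r) x)) \<longlonglongrightarrow> norm (m - grid_mean (2 ^ r) x)"
      by (intro tendsto_intros m)
    moreover have "eventually (\<lambda>s. norm (grid_mean (2 ^ s) 0 - grid_mean (2 ^ r) x) \<le> osc / 2 ^ r) sequentially"
      using ref unfolding eventually_sequentially by blast
    ultimately have "norm (m - grid_mean (2 ^ r) x) \<le> osc / 2 ^ r"
      by (rule tendsto_upperbound) simp
    then show ?thesis by (simp add: norm_minus_commute)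
  qed
  then show ?thesis by blast
qed

text \<open>
  Two scales are needed. The weight of a single grid point in a grid mean is as small as the reciprocal of
  the number of points, and dividing by it would destroy the estimate \<open>O(1/n)\<close> for the grid mean. Therefore
  \<open>F x\<close> is replaced by its average over a small box of fixed size \<open>2 \<pi> / n1\<close>, which contains the fixed
  proportion \<open>n1^(-d)\<close> of the points of the grid with \<open>n = n1 n2\<close>. The sum over the remaining points is the
  required combination, and it compensates the box up to \<open>n1^d O(1/n)\<close>, which vanishes as \<open>n2\<close> grows.
\<close>

lemma minus_field_from_translates:
  "\<exists>m. \<forall>\<epsilon>>0. \<exists>ps::(real \<times> (real ^ 'n)) list. (\<forall>p\<in>set ps. 0 \<le> fst p) \<and>
     (\<forall>x. norm (F x - m + (\<Sum>p\<leftarrow>ps. fst p *\<^sub>R (F (x + snd p) - m))) \<le> \<epsilon>)"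
proof -
  obtain m where m: "\<And>r x. norm (grid_mean (2 ^ r) x - m) \<le> osc / 2 ^ r"
    using grid_mean_limit by blast
  show ?thesis
  proof (rule exI[of _ m], intro allI impI)
    fix \<epsilon> :: real assume \<epsilon>: "\<epsilon> > 0"
    have small: "(\<lambda>r. c / 2 ^ r) \<longlonglongrightarrow> 0" for c :: real
      using LIMSEQ_divide_realpow_zero[of 2 c] by simp
    have pick: "\<exists>r. c / 2 ^ r < \<epsilon> / 2" for c :: real
      using order_tendstoD(2)[OF small[of c], of "\<epsilon> / 2"] \<epsilon> unfolding eventually_sequentially by auto
    obtain r where r: "osc / 2 ^ r < \<epsilon> / 2" using pick by blast
    define n1 :: nat where "n1 = 2 ^ r"
    have n1: "n1 > 0" "osc / real n1 < \<epsilon> / 2" using r by (simp_all add: n1_def)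
    obtain s where s: "real n1 ^ CARD('n) * osc / real n1 / 2 ^ s < \<epsilon> / 2" using pick by blast
    define n2 :: nat where "n2 = 2 ^ s"
    have n2: "n2 > 0" "real n1 ^ CARD('n) * (osc / (real n1 * real n2)) < \<epsilon> / 2"
      using s by (simp_all add: n2_def)
    define w where "w = 1 / real n2 ^ CARD('n)"
    have w: "w > 0" using n2 by (simp add: w_def)
    \<comment> \<open>the grid without the small box at its corner\<close>
    define J where "J = grid (n1 * n2) - (grid n2 :: ('n \<Rightarrow> nat) set)"
    have "finite J" by (simp add: J_def)
    then obtain ql where ql: "set ql = J" "distinct ql"
      using finite_distinct_list by blast
    define ps where "ps = map (\<lambda>q. (w, grid_point (n1 * n2) q)) ql"
    have sub: "grid n2 \<subseteq> (grid (n1 * n2) :: ('n \<Rightarrow> nat) set)"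
    proof -
      have "n2 \<le> n1 * n2" using n1 by simp
      then show ?thesis unfolding grid_def by (blast intro: less_le_trans)
    qed
    have "norm (F x - m + (\<Sum>p\<leftarrow>ps. fst p *\<^sub>R (F (x + snd p) - m))) \<le> \<epsilon>" for x
    proof -
      let ?g = "\<lambda>q. F (x + grid_point (n1 * n2) q)"
      have "(\<Sum>p\<leftarrow>ps. fst p *\<^sub>R (F (x + snd p) - m)) = (\<Sum>q\<in>J. w *\<^sub>R (?g q - m))"
        using ql by (simp add: ps_def o_def sum_list_distinct_conv_sum_set)
      also have "\<dots> = (\<Sum>q\<in>grid (n1 * n2). w *\<^sub>R (?g q - m)) - (\<Sum>q\<in>grid n2. w *\<^sub>R (?g q - m))"
        unfolding J_def by (rule sum_diff[OF finite_grid sub])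
      also have "(\<Sum>q\<in>grid (n1 * n2). w *\<^sub>R (?g q - m))
          = real n1 ^ CARD('n) *\<^sub>R (grid_mean (n1 * n2) x - m)"
        using n1 n2 by (simp add: grid_mean_def grid_sum_def w_def power_mult_distrib
            sum_subtractf card_grid sum_constant_scaleR scaleR_diff_right del: sum_constant flip: scaleR_right.sum)
      finally have eq: "F x - m + (\<Sum>p\<leftarrow>ps. fst p *\<^sub>R (F (x + snd p) - m))
          = real n1 ^ CARD('n) *\<^sub>R (grid_mean (n1 * n2) x - m) + (F x - m - (\<Sum>q\<in>grid n2. w *\<^sub>R (?g q - m)))"
        by simp
      have "(\<Sum>q\<in>(grid n2 :: ('n \<Rightarrow> nat) set). w *\<^sub>R (F x - m)) = F x - m"
        using n2 by (simp add: w_def card_grid sum_constant_scaleR del: sum_constant)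
      then have "F x - m - (\<Sum>q\<in>grid n2. w *\<^sub>R (?g q - m))
          = (\<Sum>q\<in>(grid n2 :: ('n \<Rightarrow> nat) set). w *\<^sub>R (F x - m)) - (\<Sum>q\<in>grid n2. w *\<^sub>R (?g q - m))"
        by (simp only:)
      also have "\<dots> = (\<Sum>q\<in>grid n2. w *\<^sub>R (F x - ?g q))"
        unfolding sum_subtractf[symmetric] by (intro sum.cong refl) (simp add: algebra_simps)
      also have "norm \<dots> \<le> (\<Sum>q\<in>(grid n2 :: ('n \<Rightarrow> nat) set). w * (osc * (1 / real n1)))"
      proof (intro sum_norm_le)
        fix q :: "'n \<Rightarrow> nat" assume q: "q \<in> grid n2"
        have "norm (F x - ?g q) \<le> osc * (1 / real n1)"
        proof (rule lip_box)
          fix i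
          have "real (q i) / (real n1 * real n2) \<le> real n2 / (real n1 * real n2)"
            using q n1 n2 unfolding grid_def by (intro divide_right_mono) (auto intro: less_imp_le)
          then have "2 * pi * (real (q i) / (real n1 * real n2)) \<le> 2 * pi * (1 / real n1)"
            using n2 by (intro mult_left_mono) auto
          then show "\<bar>x $ i - (x + grid_point (n1 * n2) q) $ i\<bar> \<le> 2 * pi * (1 / real n1)"
            by (simp add: grid_point_def)
        qed
        then show "norm (w *\<^sub>R (F x - ?g q)) \<le> w * (osc * (1 / real n1))"
          unfolding norm_scaleR abs_of_pos[OF w] by (intro mult_left_mono less_imp_le[OF w])
      qed
      also have "\<dots> = osc / real n1"
        using n2 by (simp add: w_def card_grid)
      finally have 1: "norm (F x - m - (\<Sum>q\<in>grid n2. w *\<^sub>R (?g q - m))) \<le> osc / real n1" .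
      have "norm (grid_mean (n1 * n2) x - m) \<le> osc / (real n1 * real n2)"
        using m[of "r + s" x] by (simp add: n1_def n2_def power_add)
      then have "real n1 ^ CARD('n) * norm (grid_mean (n1 * n2) x - m) \<le> real n1 ^ CARD('n) * (osc / (real n1 * real n2))"
        by (intro mult_left_mono) auto
      then have 2: "norm (real n1 ^ CARD('n) *\<^sub>R (grid_mean (n1 * n2) x - m)) \<le> \<epsilon> / 2"
        using order_trans[OF _ less_imp_le[OF n2(2)]] by simp
      show ?thesis
        unfolding eq using norm_triangle_ineq 1 2 n1(2) by (smt (verit) field_sum_of_halves)
    qed
    moreover have "\<forall>p\<in>set ps. 0 \<le> fst p" using w by (auto simp: ps_def)
    ultimately show "\<exists>ps::(real \<times> (real ^ 'n)) list. (\<forall>p\<in>set ps. 0 \<le> fst p) \<and>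
       (\<forall>x. norm (F x - m + (\<Sum>p\<leftarrow>ps. fst p *\<^sub>R (F (x + snd p) - m))) \<le> \<epsilon>)" by blast
  qed
qed

end

definition translate_sum :: "('n::finite) vfield \<Rightarrow> (real \<times> (real ^ 'n)) list \<Rightarrow> real ^ 'n \<Rightarrow> real ^ 'n" where
  "translate_sum f cs x = (\<Sum>c\<leftarrow>cs. fst c *\<^sub>R lift_field f (x + snd c))"

text \<open>
  Combinations of translates of the field approximate the discontinuous field that is \<open>e\<^sub>i\<close> on the lattice and 0
  elsewhere. As the coefficients sum to 0, subtracting a constant from the field changes nothing.
\<close>

definition separates_points :: "('n::finite) vfield \<Rightarrow> bool" where
  "separates_points f \<longleftrightarrow> (\<forall>i. \<forall>\<epsilon>>0. \<forall>\<rho><1. \<exists>cs. (\<Sum>c\<leftarrow>cs. fst c) = 0 \<and>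
     norm (translate_sum f cs 0 - axis i 1) \<le> \<epsilon> \<and>
     (\<forall>x. bump x \<le> \<rho> \<longrightarrow> norm (translate_sum f cs x) \<le> \<epsilon>))"

context drift
begin

text \<open>
  Every term with a negative coefficient is rewritten by \<open>minus_field_from_translates\<close>.
\<close>

lemma separates_points_imp_positively_spanning:
  assumes sep: "separates_points f"
  shows "\<exists>m. positively_spanning m"
proof -
  obtain m where m: "\<And>\<epsilon>. \<epsilon> > 0 \<Longrightarrow> \<exists>ps::(real \<times> (real ^ 'n)) list. (\<forall>p\<in>set ps. 0 \<le> fst p) \<and>
     (\<forall>x. norm (F x - m + (\<Sum>p\<leftarrow>ps. fst p *\<^sub>R (F (x + snd p) - m))) \<le> \<epsilon>)"
    using minus_field_from_translates by blast
  have "\<exists>ps. pushes_origin m \<epsilon> \<rho> (\<sigma> *\<^sub>R axis i 1) ps" if \<sigma>: "\<sigma> \<in> {1, -1}" and \<epsilon>: "\<epsilon> > 0" and \<rho>: "\<rho> < 1" for i \<sigma> \<epsilon> \<rho>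
  proof -
    obtain cs where c0: "(\<Sum>c\<leftarrow>cs. fst c) = 0"
      and c1: "norm (translate_sum f cs 0 - axis i 1) \<le> \<epsilon> / 2"
      and c2: "\<And>x. bump x \<le> \<rho> \<Longrightarrow> norm (translate_sum f cs x) \<le> \<epsilon> / 2"
      using sep \<rho> half_gt_zero[OF \<epsilon>] unfolding separates_points_def by blast
    define W where "W = (\<Sum>c\<leftarrow>cs. \<bar>fst c\<bar>)"
    have W: "W \<ge> 0" unfolding W_def by (intro sum_list_nonneg) auto
    have "\<epsilon> / (2 * (W + 1)) > 0" using \<epsilon> W by simp
    then obtain ns where n0: "\<forall>p\<in>set ns. 0 \<le> fst p"
      and n1: "\<And>x. norm (F x - m + (\<Sum>p\<leftarrow>ns. fst p *\<^sub>R (F (x + snd p) - m))) \<le> \<epsilon> / (2 * (W + 1))"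
      using m by meson
    \<comment> \<open>a nonnegative replacement for the single term \<open>\<sigma> c F (x + a)\<close>\<close>
    define h where "h c = (if 0 \<le> \<sigma> * fst c then [(\<sigma> * fst c, snd c)]
        else map (\<lambda>p. (- (\<sigma> * fst c) * fst p, snd c + snd p)) ns)" for c :: "real \<times> (real ^ 'n)"
    define ps where "ps = concat (map h cs)"
    have nonneg: "\<forall>p\<in>set ps. 0 \<le> fst p"
      using n0 by (auto simp: ps_def h_def mult_nonpos_nonneg split: if_splits)
    have err: "norm ((\<Sum>p\<leftarrow>h c. fst p *\<^sub>R (F (x + snd p) - m)) - \<sigma> *\<^sub>R (fst c *\<^sub>R (F (x + snd c) - m)))
        \<le> \<bar>fst c\<bar> * (\<epsilon> / (2 * (W + 1)))" for c x
    proof (cases "0 \<le> \<sigma> * fst c")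
      case True
      then show ?thesis using \<epsilon> W by (simp add: h_def)
    next
      case False
      have "(\<Sum>p\<leftarrow>h c. fst p *\<^sub>R (F (x + snd p) - m)) - \<sigma> *\<^sub>R (fst c *\<^sub>R (F (x + snd c) - m))
        = (- (\<sigma> * fst c)) *\<^sub>R (F (x + snd c) - m + (\<Sum>p\<leftarrow>ns. fst p *\<^sub>R (F (x + snd c + snd p) - m)))"
        using False by (simp add: h_def o_def scaleR_add_right scaleR_sum_list_map add.assoc)
      moreover have "\<bar>\<sigma> * fst c\<bar> = \<bar>fst c\<bar>" using \<sigma> by auto
      ultimately have "norm ((\<Sum>p\<leftarrow>h c. fst p *\<^sub>R (F (x + snd p) - m)) - \<sigma> *\<^sub>R (fst c *\<^sub>R (F (x + snd c) - m)))
        = \<bar>fst c\<bar> * norm (F (x + snd c) - m + (\<Sum>p\<leftarrow>ns. fst p *\<^sub>R (F (x + snd c + snd p) - m)))"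
        by (simp only: norm_scaleR abs_minus_cancel)
      also have "\<dots> \<le> \<bar>fst c\<bar> * (\<epsilon> / (2 * (W + 1)))"
        by (rule mult_left_mono[OF n1 abs_ge_zero])
      finally show ?thesis .
    qed
    have key: "norm ((\<Sum>p\<leftarrow>ps. fst p *\<^sub>R (F (x + snd p) - m)) - \<sigma> *\<^sub>R translate_sum f cs x) \<le> \<epsilon> / 2" for x
    proof -
      have mz: "(\<Sum>c\<leftarrow>cs. fst c *\<^sub>R (F (x + snd c) - m)) = translate_sum f cs x"
      proof -
        have "(\<Sum>c\<leftarrow>ds. fst c *\<^sub>R (F (x + snd c) - m)) = translate_sum f ds x - (\<Sum>c\<leftarrow>ds. fst c) *\<^sub>R m"
          for ds :: "(real \<times> (real ^ 'n)) list"
          by (induction ds) (auto simp: translate_sum_def algebra_simps)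
        then show ?thesis using c0 by simp
      qed
      have "norm ((\<Sum>p\<leftarrow>concat (map h ds). fst p *\<^sub>R (F (x + snd p) - m))
            - \<sigma> *\<^sub>R (\<Sum>c\<leftarrow>ds. fst c *\<^sub>R (F (x + snd c) - m)))
          \<le> (\<Sum>c\<leftarrow>ds. \<bar>fst c\<bar>) * (\<epsilon> / (2 * (W + 1)))" for ds
      proof (induction ds)
        case (Cons c ds)
        have "(\<Sum>p\<leftarrow>concat (map h (c # ds)). fst p *\<^sub>R (F (x + snd p) - m))
            - \<sigma> *\<^sub>R (\<Sum>c\<leftarrow>c # ds. fst c *\<^sub>R (F (x + snd c) - m))
          = ((\<Sum>p\<leftarrow>h c. fst p *\<^sub>R (F (x + snd p) - m)) - \<sigma> *\<^sub>R (fst c *\<^sub>R (F (x + snd c) - m)))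
            + ((\<Sum>p\<leftarrow>concat (map h ds). fst p *\<^sub>R (F (x + snd p) - m))
            - \<sigma> *\<^sub>R (\<Sum>c\<leftarrow>ds. fst c *\<^sub>R (F (x + snd c) - m)))"
          by (simp add: scaleR_add_right)
        also have "norm \<dots> \<le> \<bar>fst c\<bar> * (\<epsilon> / (2 * (W + 1))) + (\<Sum>c\<leftarrow>ds. \<bar>fst c\<bar>) * (\<epsilon> / (2 * (W + 1)))"
          by (rule norm_triangle_le[OF add_mono[OF err Cons.IH]])
        finally show ?case by (simp only: list.map sum_list.Cons distrib_right)
      qed simp
      from this[of cs] have "norm ((\<Sum>p\<leftarrow>ps. fst p *\<^sub>R (F (x + snd p) - m)) - \<sigma> *\<^sub>R translate_sum f cs x)
          \<le> W * (\<epsilon> / (2 * (W + 1)))"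
        unfolding mz ps_def W_def .
      also have "\<dots> \<le> \<epsilon> / 2"
        using W \<epsilon> by (simp add: field_simps)
      finally show ?thesis .
    qed
    have s1: "norm (\<sigma> *\<^sub>R v) = norm v" for v :: "real ^ 'n"
      using \<sigma> by auto
    have "pushes_origin m \<epsilon> \<rho> (\<sigma> *\<^sub>R axis i 1) ps"
      unfolding pushes_origin_def
    proof (intro conjI nonneg allI impI)
      have "norm (\<sigma> *\<^sub>R translate_sum f cs 0 - \<sigma> *\<^sub>R axis i 1) \<le> \<epsilon> / 2"
        unfolding scaleR_diff_right[symmetric] s1 by (rule c1)
      with key[of 0] show "norm ((\<Sum>p\<leftarrow>ps. fst p *\<^sub>R (F (snd p) - m)) - \<sigma> *\<^sub>R axis i 1) \<le> \<epsilon>"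
        using norm_triangle_ineq[of "(\<Sum>p\<leftarrow>ps. fst p *\<^sub>R (F (snd p) - m)) - \<sigma> *\<^sub>R translate_sum f cs 0"
            "\<sigma> *\<^sub>R translate_sum f cs 0 - \<sigma> *\<^sub>R axis i 1"] by simp
      fix x :: "real ^ 'n" assume "bump x \<le> \<rho>"
      then have "norm (\<sigma> *\<^sub>R translate_sum f cs x) \<le> \<epsilon> / 2"
        unfolding s1 by (rule c2)
      with key[of x] show "norm (\<Sum>p\<leftarrow>ps. fst p *\<^sub>R (F (x + snd p) - m)) \<le> \<epsilon>"
        using norm_triangle_ineq[of "(\<Sum>p\<leftarrow>ps. fst p *\<^sub>R (F (x + snd p) - m)) - \<sigma> *\<^sub>R translate_sum f cs x"
            "\<sigma> *\<^sub>R translate_sum f cs x"] by simp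
    qed
    then show ?thesis by blast
  qed
  then show ?thesis unfolding positively_spanning_def by blast
qed

end

section \<open>Trigonometric fields and finite differences\<close>

type_synonym 'n trig = "((real ^ 'n) \<times> (real ^ 'n) \<times> real) list"

text \<open>
  Trigonometric fields with amplitude, frequency and phase of each term. A derivative only changes the
  amplitude and advances the phase by \<open>\<pi> / 2\<close>, so this form is closed under all derivatives.
\<close>

definition trig_field :: "('n::finite) trig \<Rightarrow> real ^ 'n \<Rightarrow> real ^ 'n" where
  "trig_field ts x = (\<Sum>(c, k, a)\<leftarrow>ts. cos (k \<bullet> x + a) *\<^sub>R c)"

definition trig_deriv :: "'n list \<Rightarrow> ('n::finite) trig \<Rightarrow> 'n trig" where
  "trig_deriv is ts = map (\<lambda>(c, k, a). (prod_list (map (($) k) is) *\<^sub>R c, k, a + real (length is) * (pi / 2))) ts"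

lemma has_derivative_trig_field:
  "(trig_field ts has_derivative (\<lambda>v. \<Sum>(c, k, a)\<leftarrow>ts. (- sin (k \<bullet> x + a) * (k \<bullet> v)) *\<^sub>R c)) (at x)"
  unfolding trig_field_def
proof (induction ts)
  case (Cons t ts)
  obtain c k a where t: "t = (c, k, a)" by (cases t) auto
  have "((\<lambda>x. cos (k \<bullet> x + a) *\<^sub>R c) has_derivative (\<lambda>v. (- sin (k \<bullet> x + a) * (k \<bullet> v)) *\<^sub>R c)) (at x)"
    by (auto intro!: derivative_eq_intros)
  from has_derivative_add[OF this Cons.IH] show ?case
    by (simp add: t)
qed simp

lemma trig_field_differentiable: "trig_field ts differentiable at x"
  using has_derivative_trig_field differentiable_def by blast

lemma cos_shift: "cos (t + (a + pi / 2)) = - sin (t + a)" for t a :: real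
  using cos_add[of "t + a" "pi / 2"] by (simp add: add.assoc)

lemma partial_deriv_trig_field: "partial_deriv i (trig_field ts) = trig_field (trig_deriv [i] ts)"
proof
  fix x
  have "partial_deriv i (trig_field ts) x = (\<Sum>(c, k, a)\<leftarrow>ts. (- sin (k \<bullet> x + a) * (k \<bullet> axis i 1)) *\<^sub>R c)"
    unfolding partial_deriv_def frechet_derivative_at[OF has_derivative_trig_field, symmetric] ..
  also have "\<dots> = trig_field (trig_deriv [i] ts) x"
    unfolding trig_field_def trig_deriv_def
    by (induction ts) (auto simp: inner_axis cos_shift mult.commute)
  finally show "partial_deriv i (trig_field ts) x = trig_field (trig_deriv [i] ts) x" .
qed

lemma iter_partial_deriv_trig_field:
  "iter_partial_deriv is (trig_field ts) = trig_field (trig_deriv is ts)"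
proof (induction "is")
  case Nil
  have "trig_deriv [] ts = ts" by (simp add: trig_deriv_def case_prod_unfold)
  then show ?case by simp
next
  case (Cons i "is")
  have "trig_deriv [i] (trig_deriv is ts) = trig_deriv (i # is) ts"
    by (auto simp: trig_deriv_def algebra_simps)
  then show ?case by (simp add: Cons partial_deriv_trig_field)
qed

lemma norm_trig_field: "norm (trig_field ts x) \<le> (\<Sum>(c, k, a)\<leftarrow>ts. norm c)"
  unfolding trig_field_def
proof (induction ts)
  case (Cons t ts)
  obtain c k a where t: "t = (c, k, a)" by (cases t) auto
  have "norm (cos (k \<bullet> x + a) *\<^sub>R c) \<le> norm c"
    by (simp add: mult_left_le_one_le)
  then show ?case
    using norm_triangle_mono[OF _ Cons.IH] by (simp add: t)
qed simp

lemma norm_iter_partial_deriv_trig_field: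
  fixes ts :: "('n::finite) trig"
  shows "norm (iter_partial_deriv is (trig_field ts) x) \<le> (\<Sum>(c, k, a)\<leftarrow>ts. norm k ^ length is * norm c)"
proof -
  have "\<bar>prod_list (map (($) k) is)\<bar> \<le> norm k ^ length is" for k :: "real ^ 'n"
    by (induction "is") (auto simp: abs_mult component_le_norm_cart intro!: mult_mono)
  then have "(\<Sum>(c, k, a)\<leftarrow>trig_deriv is ts. norm c) \<le> (\<Sum>(c, k, a)\<leftarrow>ts. norm k ^ length is * norm c)"
    unfolding trig_deriv_def map_map
    by (intro sum_list_mono) (auto intro!: mult_right_mono)
  then show ?thesis
    unfolding iter_partial_deriv_trig_field using norm_trig_field order_trans by blast
qed

definition integer_vector :: "real ^ 'n \<Rightarrow> bool" where
  "integer_vector q \<longleftrightarrow> (\<forall>i. q $ i \<in> \<int>)"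

lemma cos_inner_lattice:
  fixes k :: "real ^ 'n::finite"
  assumes "integer_vector k" "l \<in> period_lattice"
  shows "cos (k \<bullet> (x + l) + a) = cos (k \<bullet> x + a)"
proof -
  have "\<exists>m::int. k $ i * l $ i = 2 * pi * of_int m" for i
  proof -
    obtain p :: int where p: "k $ i = of_int p"
      using assms(1) unfolding integer_vector_def by (metis Ints_cases)
    obtain n :: int where n: "l $ i = 2 * pi * of_int n"
      using assms(2) unfolding period_lattice_def by blast
    have "k $ i * l $ i = 2 * pi * of_int (p * n)" by (simp add: p n)
    then show ?thesis by blast
  qed
  then obtain m :: "'n \<Rightarrow> int" where m: "\<And>i. k $ i * l $ i = 2 * pi * of_int (m i)" by metis
  have "k \<bullet> l = 2 * pi * of_int (\<Sum>i\<in>UNIV. m i)"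
    by (simp add: inner_vec_def m sum_distrib_left)
  then have "k \<bullet> (x + l) + a = (k \<bullet> x + a) + 2 * pi * of_int (\<Sum>i\<in>UNIV. m i)"
    by (simp add: inner_add_right)
  moreover have "cos (t + 2 * pi * of_int M) = cos t" for t and M :: int
    using cos_int_2pin[of M] sin_int_2pin[of M] by (simp add: cos_add)
  ultimately show ?thesis by (simp only:)
qed

definition torus_trig :: "('n::finite) trig \<Rightarrow> 'n vfield" where
  "torus_trig ts p = trig_field ts (rep_torus p)"

lemma lift_torus_trig:
  fixes ts :: "('n::finite) trig"
  assumes "\<forall>(c, k, a)\<in>set ts. integer_vector k"
  shows "lift_field (torus_trig ts) = trig_field ts"
proof
  fix x :: "real ^ 'n"
  have "torus_proj (rep_torus (torus_proj x)) = torus_proj x" by simp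
  then obtain l where l: "l \<in> period_lattice" "rep_torus (torus_proj x) = x + l"
    unfolding torus_proj_eq_iff by (metis add.commute diff_add_cancel)
  have "trig_field ts (x + l) = trig_field ts x"
    unfolding trig_field_def using assms
    by (intro arg_cong[where f = sum_list] map_cong refl) (auto simp: cos_inner_lattice[OF _ l(1)])
  then show "lift_field (torus_trig ts) x = trig_field ts x"
    by (simp add: lift_field_def torus_trig_def l(2))
qed

text \<open>
  A plane wave is divergence free when its amplitude is orthogonal to its frequency.
\<close>

lemma torus_trig_Vec0:
  fixes ts :: "('n::finite) trig"
  assumes int: "\<forall>(c, k, a)\<in>set ts. integer_vector k" and orth: "\<forall>(c, k, a)\<in>set ts. k \<bullet> c = 0"
  shows "torus_trig ts \<in> Vec0"
proof -
  have "smooth_field (torus_trig ts)"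
    unfolding smooth_field_def lift_torus_trig[OF int] iter_partial_deriv_trig_field
    by (simp add: trig_field_differentiable)
  moreover have "divergence (torus_trig ts) x = 0" for x
  proof -
    have "divergence (torus_trig ts) x = (\<Sum>i\<in>UNIV. trig_field (trig_deriv [i] ts) x $ i)"
      by (simp add: divergence_def lift_torus_trig[OF int] partial_deriv_trig_field)
    also have "\<dots> = (\<Sum>(c, k, a)\<leftarrow>ts. cos (k \<bullet> x + (a + pi / 2)) * (k \<bullet> c))"
    proof -
      have "(\<Sum>i\<in>UNIV. (cos t *\<^sub>R ((k $ i) *\<^sub>R c)) $ i) = cos t * (k \<bullet> c)" for t and k c :: "real ^ 'n"
        by (simp add: inner_vec_def sum_distrib_left mult_ac)
      then show ?thesis
        unfolding trig_field_def trig_deriv_def by (induction ts) (auto simp: sum.distrib)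
    qed
    also have "\<dots> = 0"
      using orth by (induction ts) auto
    finally show ?thesis .
  qed
  ultimately show ?thesis by (simp add: Vec0_def)
qed

lemma iter_partial_deriv_add_scaleR:
  assumes F: "\<And>is x. iter_partial_deriv is F differentiable at x"
    and G: "\<And>is x. iter_partial_deriv is G differentiable at x"
  shows "iter_partial_deriv is (\<lambda>x. F x + e *\<^sub>R G x)
    = (\<lambda>x. iter_partial_deriv is F x + e *\<^sub>R iter_partial_deriv is G x)"
proof (induction "is")
  case (Cons i "is")
  show ?case
  proof
    fix x
    let ?F = "iter_partial_deriv is F" and ?G = "iter_partial_deriv is G"
    have "((\<lambda>x. ?F x + e *\<^sub>R ?G x) has_derivative
        (\<lambda>v. frechet_derivative ?F (at x) v + e *\<^sub>R frechet_derivative ?G (at x) v)) (at x)"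
      using F[of "is" x] G[of "is" x] unfolding frechet_derivative_works
      by (intro has_derivative_add has_derivative_scaleR_right)
    from fun_cong[OF frechet_derivative_at[OF this], of "axis i 1"]
    show "iter_partial_deriv (i # is) (\<lambda>x. F x + e *\<^sub>R G x) x
        = iter_partial_deriv (i # is) F x + e *\<^sub>R iter_partial_deriv (i # is) G x"
      by (simp add: Cons partial_deriv_def)
  qed
qed simp

lemma Vec0_add_scaleR:
  assumes f: "f \<in> Vec0" and h: "h \<in> Vec0"
  shows "(\<lambda>p. f p + e *\<^sub>R h p) \<in> Vec0"
    and "lift_field (\<lambda>p. f p + e *\<^sub>R h p) = (\<lambda>x. lift_field f x + e *\<^sub>R lift_field h x)"
    and "iter_partial_deriv is (lift_field (\<lambda>p. f p + e *\<^sub>R h p))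
      = (\<lambda>x. iter_partial_deriv is (lift_field f) x + e *\<^sub>R iter_partial_deriv is (lift_field h) x)"
proof -
  have d: "\<And>is x. iter_partial_deriv is (lift_field f) differentiable at x"
    "\<And>is x. iter_partial_deriv is (lift_field h) differentiable at x"
    using f h by (auto simp: Vec0_def smooth_field_def)
  show l: "lift_field (\<lambda>p. f p + e *\<^sub>R h p) = (\<lambda>x. lift_field f x + e *\<^sub>R lift_field h x)"
    by (simp add: lift_field_def fun_eq_iff)
  note it = iter_partial_deriv_add_scaleR[OF d]
  show "iter_partial_deriv is (lift_field (\<lambda>p. f p + e *\<^sub>R h p))
      = (\<lambda>x. iter_partial_deriv is (lift_field f) x + e *\<^sub>R iter_partial_deriv is (lift_field h) x)"
    unfolding l it ..
  have "smooth_field (\<lambda>p. f p + e *\<^sub>R h p)"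
    unfolding smooth_field_def l it by (intro allI differentiable_add differentiable_scaleR d) auto
  moreover have "divergence (\<lambda>p. f p + e *\<^sub>R h p) x = divergence f x + e * divergence h x" for x
    using it[of "[_]" e] unfolding divergence_def l
    by (simp add: sum.distrib sum_distrib_left fun_eq_iff)
  ultimately show "(\<lambda>p. f p + e *\<^sub>R h p) \<in> Vec0"
    using f h by (simp add: Vec0_def)
qed

definition fdiff :: "'a::real_vector \<Rightarrow> ('a \<Rightarrow> 'b::real_vector) \<Rightarrow> 'a \<Rightarrow> 'b" where
  "fdiff v G x = G (x + v) - G x"

definition fsum :: "'a::real_vector \<Rightarrow> ('a \<Rightarrow> 'b::real_vector) \<Rightarrow> 'a \<Rightarrow> 'b" where
  "fsum v G x = G (x + v) + G x"

lemma fdiff_power_Suc: "(fdiff v ^^ Suc s) G x = (fdiff v ^^ s) G (x + v) - (fdiff v ^^ s) G x"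
  by (simp only: funpow.simps comp_apply fdiff_def)

lemma fdiff_power_add_scaleR:
  "(fdiff v ^^ s) (\<lambda>x. F x + e *\<^sub>R G x) = (\<lambda>x. (fdiff v ^^ s) F x + e *\<^sub>R (fdiff v ^^ s) G x)"
  by (induction s) (auto simp: fdiff_def algebra_simps)

lemma fdiff_power_bound:
  fixes G :: "'a::real_vector \<Rightarrow> 'b::real_normed_vector"
  assumes "\<And>x. norm (G x) \<le> C"
  shows "norm ((fdiff v ^^ s) G x) \<le> 2 ^ s * C"
proof (induction s arbitrary: x)
  case (Suc s)
  show ?case
    using norm_triangle_ineq4[of "(fdiff v ^^ s) G (x + v)" "(fdiff v ^^ s) G x"] Suc[of x] Suc[of "x + v"]
    unfolding fdiff_power_Suc by simp
qed (use assms in simp)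

text \<open>
  The list of coefficients and shifts depends neither on the field nor on the point, and from order 1 on
  the coefficients sum to 0.
\<close>

lemma fdiff_power_translate_sum:
  fixes v :: "real ^ 'n::finite"
  shows "\<exists>cs. (s > 0 \<longrightarrow> (\<Sum>c\<leftarrow>cs. fst c) = 0) \<and>
    (\<forall>f x. translate_sum f cs x = (fdiff v ^^ s) (lift_field f) x)"
proof (induction s)
  case 0
  show ?case by (rule exI[of _ "[(1, 0)]"]) (simp add: translate_sum_def)
next
  case (Suc s)
  then obtain cs where cs: "\<And>f x. translate_sum f cs x = (fdiff v ^^ s) (lift_field f) x" by blast
  define ds where "ds = map (\<lambda>c. (fst c, snd c + v)) cs @ map (\<lambda>c. (- fst c, snd c)) cs"
  have "(\<Sum>c\<leftarrow>ds. fst c) = 0"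
    unfolding ds_def by (induction cs) (auto simp: o_def)
  moreover have "translate_sum f ds x = translate_sum f cs (x + v) - translate_sum f cs x" for f x
    unfolding ds_def translate_sum_def by (induction cs) (auto simp: algebra_simps)
  ultimately show ?case
    by (intro exI[of _ ds]) (simp add: cs fdiff_power_Suc del: funpow.simps)
qed

text \<open>
  Differences commute with derivatives, and each difference costs one derivative and gains one factor
  \<open>|\<eta>|\<close>.
\<close>

lemma fdiff_power_smooth:
  fixes F :: "real ^ 'n::finite \<Rightarrow> real ^ 'n"
  assumes "\<And>is x. iter_partial_deriv is F differentiable at x"
    and "\<And>x. norm (iter_partial_deriv (replicate s l) F x) \<le> C"
  shows "norm ((fdiff (\<eta> *\<^sub>R axis l 1) ^^ s) F x) \<le> C * \<bar>\<eta>\<bar> ^ s"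
  using assms
proof (induction s arbitrary: F C x)
  case 0
  then show ?case by simp
next
  case (Suc s)
  let ?v = "\<eta> *\<^sub>R axis l 1 :: real ^ 'n"
  have sh: "iter_partial_deriv is (\<lambda>x. F (x + ?v)) = (\<lambda>x. iter_partial_deriv is F (x + ?v))" for "is"
  proof (induction "is")
    case (Cons i "is")
    have "partial_deriv i (\<lambda>x. iter_partial_deriv is F (x + ?v)) x = partial_deriv i (iter_partial_deriv is F) (x + ?v)" for x
    proof -
      have "((\<lambda>x. iter_partial_deriv is F (x + ?v)) has_derivative
          frechet_derivative (iter_partial_deriv is F) (at (x + ?v))) (at x)"
      proof (rule has_derivative_compose[of "\<lambda>x. x + ?v" "\<lambda>h. h" x UNIV])
        show "((\<lambda>x. x + ?v) has_derivative (\<lambda>h. h)) (at x)"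
          by (auto intro!: derivative_eq_intros)
        show "(iter_partial_deriv is F has_derivative
            frechet_derivative (iter_partial_deriv is F) (at (x + ?v))) (at (x + ?v))"
          using Suc.prems(1)[of "is" "x + ?v"] unfolding frechet_derivative_works .
      qed
      from frechet_derivative_at[OF this] show ?thesis
        by (simp add: partial_deriv_def)
    qed
    then show ?case by (simp add: Cons)
  qed simp
  have dsh: "iter_partial_deriv is (\<lambda>x. F (x + ?v)) differentiable at x" for "is" x
    unfolding sh by (rule differentiable_compose[of "iter_partial_deriv is F"]) (auto intro: Suc.prems(1))
  have eq: "iter_partial_deriv is (fdiff ?v F) = (\<lambda>x. iter_partial_deriv is F (x + ?v) - iter_partial_deriv is F x)" for "is"
    using iter_partial_deriv_add_scaleR[OF dsh Suc.prems(1), of "is" "-1"] unfolding sh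
    by (simp add: fdiff_def[abs_def])
  have 1: "iter_partial_deriv is (fdiff ?v F) differentiable at x" for "is" x
    unfolding eq using dsh[of "is"] Suc.prems(1) unfolding sh by (intro differentiable_diff)
  have 2: "norm (iter_partial_deriv (replicate s l) (fdiff ?v F) x) \<le> C * \<bar>\<eta>\<bar>" for x
  proof -
    let ?G = "iter_partial_deriv (replicate s l) F"
    have der: "((\<lambda>t. ?G (x + t *\<^sub>R axis l 1)) has_derivative (\<lambda>h. h *\<^sub>R partial_deriv l ?G (x + t *\<^sub>R axis l 1))) (at t)" for t
    proof -
      let ?D = "frechet_derivative ?G (at (x + t *\<^sub>R axis l 1))"
      have D: "(?G has_derivative ?D) (at (x + t *\<^sub>R axis l 1))"
        using Suc.prems(1) frechet_derivative_works by blast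
      have "((\<lambda>t. ?G (x + t *\<^sub>R axis l 1)) has_derivative (\<lambda>h. ?D (h *\<^sub>R axis l 1))) (at t)"
        by (rule has_derivative_compose[of "\<lambda>t. x + t *\<^sub>R axis l 1" "\<lambda>h. h *\<^sub>R axis l 1" t UNIV ?G ?D])
          (auto intro!: derivative_eq_intros D)
      then show ?thesis
        by (simp add: partial_deriv_def linear_scale[OF has_derivative_linear[OF D]])
    qed
    have "norm (?G (x + \<eta> *\<^sub>R axis l 1) - ?G (x + 0 *\<^sub>R axis l 1)) \<le> C * norm (\<eta> - 0)"
    proof (rule differentiable_bound[of UNIV "\<lambda>t. ?G (x + t *\<^sub>R axis l 1)"])
      show "onorm (\<lambda>h. h *\<^sub>R partial_deriv l ?G (x + t *\<^sub>R axis l 1)) \<le> C" for t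
      proof (rule onorm_le)
        fix h :: real
        have "norm (partial_deriv l ?G (x + t *\<^sub>R axis l 1)) \<le> C"
          using Suc.prems(2)[of "x + t *\<^sub>R axis l 1"] by simp
        then show "norm (h *\<^sub>R partial_deriv l ?G (x + t *\<^sub>R axis l 1)) \<le> C * norm h"
          unfolding norm_scaleR real_norm_def by (subst mult.commute) (rule mult_right_mono, auto)
      qed
    qed (use der in auto)
    then show ?thesis unfolding eq by simp
  qed
  have "norm ((fdiff ?v ^^ s) (fdiff ?v F) x) \<le> C * \<bar>\<eta>\<bar> * \<bar>\<eta>\<bar> ^ s"
    by (rule Suc.IH[OF 1 2])
  then show ?case
    by (simp add: funpow_Suc_right mult.assoc del: funpow.simps)
qed

section \<open>Divergence free localized waves\<close>

lemma integer_vector_add: "integer_vector p \<Longrightarrow> integer_vector q \<Longrightarrow> integer_vector (p + q)"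
  by (simp add: integer_vector_def)

text \<open>
  Trigonometric polynomials with real coefficients and real values. Complex exponentials make the closure
  under products immediate.
\<close>

definition cosine_poly :: "(real ^ 'n::finite \<Rightarrow> real) \<Rightarrow> bool" where
  "cosine_poly g \<longleftrightarrow> (\<exists>bs :: (real \<times> (real ^ 'n)) list. (\<forall>b\<in>set bs. integer_vector (snd b)) \<and>
     (\<forall>x. (\<Sum>b\<leftarrow>bs. of_real (fst b) * cis (snd b \<bullet> x)) = complex_of_real (g x)))"

lemma cosine_poly_one: "cosine_poly (\<lambda>_. 1)"
  unfolding cosine_poly_def
  by (rule exI[of _ "[(1, 0)]"]) (simp add: integer_vector_def)

lemma cosine_poly_mult:
  assumes "cosine_poly g" "cosine_poly h"
  shows "cosine_poly (\<lambda>x. g x * h x)"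
proof -
  obtain bs where bs: "\<And>b. b \<in> set bs \<Longrightarrow> integer_vector (snd b)"
    "\<And>x. (\<Sum>b\<leftarrow>bs. of_real (fst b) * cis (snd b \<bullet> x)) = complex_of_real (g x)"
    using assms(1) unfolding cosine_poly_def by blast
  obtain cs where cs: "\<And>b. b \<in> set cs \<Longrightarrow> integer_vector (snd b)"
    "\<And>x. (\<Sum>b\<leftarrow>cs. of_real (fst b) * cis (snd b \<bullet> x)) = complex_of_real (h x)"
    using assms(2) unfolding cosine_poly_def by blast
  define ds where "ds = concat (map (\<lambda>b. map (\<lambda>c. (fst b * fst c, snd b + snd c)) cs) bs)"
  have "\<forall>b\<in>set ds. integer_vector (snd b)"
    using bs(1) cs(1) by (auto simp: ds_def integer_vector_add)
  moreover have "(\<Sum>b\<leftarrow>ds. of_real (fst b) * cis (snd b \<bullet> x)) = complex_of_real (g x * h x)" for x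
  proof -
    have "(\<Sum>b\<leftarrow>map (\<lambda>c. (fst b * fst c, snd b + snd c)) cs. of_real (fst b) * cis (snd b \<bullet> x))
        = of_real (fst b) * cis (snd b \<bullet> x) * complex_of_real (h x)" for b
      unfolding cs(2)[symmetric]
      by (simp add: o_def inner_add_left cis_mult[symmetric] sum_list_const_mult[symmetric] mult_ac)
    then have "(\<Sum>b\<leftarrow>ds. of_real (fst b) * cis (snd b \<bullet> x))
        = (\<Sum>b\<leftarrow>bs. of_real (fst b) * cis (snd b \<bullet> x) * complex_of_real (h x))"
      unfolding ds_def sum_list_concat_map by simp
    also have "\<dots> = complex_of_real (g x) * complex_of_real (h x)"
      unfolding sum_list_mult_const bs(2) ..
    finally show ?thesis by simp
  qed
  ultimately show ?thesis
    unfolding cosine_poly_def by blast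
qed

lemma cosine_poly_half_one_plus_cos:
  fixes i :: "'n::finite"
  shows "cosine_poly (\<lambda>x::real ^ 'n. (1 + cos (x $ i)) / 2)"
  unfolding cosine_poly_def
proof (intro exI conjI allI)
  let ?bs = "[(1/2, 0), (1/4, axis i 1), (1/4, - axis i 1)] :: (real \<times> (real ^ 'n)) list"
  show "\<forall>b\<in>set ?bs. integer_vector (snd b)"
    by (auto simp: integer_vector_def axis_def)
  show "(\<Sum>b\<leftarrow>?bs. of_real (fst b) * cis (snd b \<bullet> x)) = complex_of_real ((1 + cos (x $ i)) / 2)" for x
    by (simp add: inner_axis' complex_eq_iff)
qed

lemma cosine_poly_bump: "cosine_poly (\<lambda>x::real ^ 'n::finite. bump x ^ k)"
proof (induction k)
  case (Suc k)
  have "cosine_poly (\<lambda>x. \<Prod>i\<in>S. (1 + cos (x $ i)) / 2)" if "finite S" for S :: "'n set"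
    using that
  proof induction
    case (insert j S)
    from cosine_poly_mult[OF cosine_poly_half_one_plus_cos[of j] insert.IH] show ?case
      by (simp only: prod.insert[OF insert.hyps])
  qed (simp add: cosine_poly_one)
  then have "cosine_poly (bump :: real ^ 'n \<Rightarrow> real)" unfolding bump_def[abs_def] by simp
  then show ?case using cosine_poly_mult[OF _ Suc] by simp
qed (simp add: cosine_poly_one)

lemma bump_lipschitz_axis:
  fixes x :: "real ^ 'n::finite"
  shows "bump (x + t *\<^sub>R axis l 1) \<le> bump x + \<bar>t\<bar>"
proof -
  define P where "P = (\<Prod>j\<in>UNIV - {l}. (1 + cos (x $ j)) / 2)"
  have P: "0 \<le> P" "P \<le> 1"
    unfolding P_def by (auto intro!: prod_nonneg prod_le_1 half_one_plus_cos)
  have b: "bump (x + t *\<^sub>R axis l 1) = (1 + cos (x $ l + t)) / 2 * P" for t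
  proof -
    have "bump (x + t *\<^sub>R axis l 1) = (1 + cos ((x + t *\<^sub>R axis l 1) $ l)) / 2
        * (\<Prod>j\<in>UNIV - {l}. (1 + cos ((x + t *\<^sub>R axis l 1) $ j)) / 2)"
      unfolding bump_def by (rule prod.remove) auto
    also have "(\<Prod>j\<in>UNIV - {l}. (1 + cos ((x + t *\<^sub>R axis l 1) $ j)) / 2) = P"
      unfolding P_def by (intro prod.cong) (auto simp: axis_def)
    finally show ?thesis by (simp add: axis_def)
  qed
  have "cos (x $ l + t) - cos (x $ l) \<le> 2 * \<bar>t\<bar>"
  proof -
    have "\<bar>cos (x $ l + t) - cos (x $ l)\<bar> \<le> \<bar>(x $ l + t) - x $ l\<bar>"
    proof -
      have "norm (cos (x $ l + t) - cos (x $ l)) \<le> 1 * norm ((x $ l + t) - x $ l)"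
        by (rule field_differentiable_bound[of UNIV cos "\<lambda>y. - sin y"])
          (auto intro!: derivative_eq_intros)
      then show ?thesis by simp
    qed
    then show ?thesis by simp
  qed
  then have "(cos (x $ l + t) - cos (x $ l)) / 2 * P \<le> \<bar>t\<bar> * 1"
    using P by (intro mult_mono) auto
  then show ?thesis
    using b[of t] b[of 0] by (simp add: field_simps)
qed

lemma fsum_power_Suc: "(fsum v ^^ Suc s) G x = (fsum v ^^ s) G (x + v) + (fsum v ^^ s) G x"
  by (simp only: funpow.simps comp_apply fsum_def)

text \<open>
  A step of half a wavelength changes the sign of the carrier wave \<open>cos (\<Lambda> x\<^sub>l)\<close>. Thus differences of the
  product become sums of the envelope \<open>B\<close>: there is no cancellation.
\<close>

lemma fdiff_power_wave:
  fixes B :: "real ^ 'n::finite \<Rightarrow> real" and l :: 'n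
  assumes "\<Lambda> > 0" and v: "v = (pi / \<Lambda>) *\<^sub>R axis l 1"
  shows "(fdiff v ^^ s) (\<lambda>x. cos (\<Lambda> * x $ l) * B x) x = (-1) ^ s * cos (\<Lambda> * x $ l) * (fsum v ^^ s) B x"
proof (induction s arbitrary: x)
  case (Suc s)
  have "cos (\<Lambda> * (x + v) $ l) = - cos (\<Lambda> * x $ l)"
    using assms by (simp add: axis_def distrib_left)
  then show ?case
    unfolding fdiff_power_Suc fsum_power_Suc Suc.IH by (simp add: algebra_simps)
qed simp

lemma fsum_power_bounds:
  fixes B :: "real ^ 'n::finite \<Rightarrow> real"
  assumes "\<And>x. 0 \<le> B x"
  shows "B x \<le> (fsum v ^^ s) B x"
    and "(\<And>r. r \<le> s \<Longrightarrow> B (x + real r *\<^sub>R v) \<le> c) \<Longrightarrow> (fsum v ^^ s) B x \<le> 2 ^ s * c"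
proof -
  have nn: "0 \<le> (fsum v ^^ s) B x" for s x
    by (induction s arbitrary: x) (auto simp: fsum_power_Suc assms simp del: funpow.simps(2))
  show "B x \<le> (fsum v ^^ s) B x"
  proof (induction s)
    case (Suc s)
    then show ?case using nn[of s "x + v"] unfolding fsum_power_Suc by simp
  qed simp
  show "(fsum v ^^ s) B x \<le> 2 ^ s * c" if "\<And>r. r \<le> s \<Longrightarrow> B (x + real r *\<^sub>R v) \<le> c"
    using that
  proof (induction s arbitrary: x)
    case 0
    then show ?case using 0[of 0] by simp
  next
    case (Suc s)
    have "(fsum v ^^ s) B x \<le> 2 ^ s * c"
      by (rule Suc.IH) (use Suc.prems in auto)
    moreover have "(fsum v ^^ s) B (x + v) \<le> 2 ^ s * c"
    proof (rule Suc.IH)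
      fix r assume "r \<le> s"
      then show "B (x + v + real r *\<^sub>R v) \<le> c"
        using Suc.prems[of "Suc r"] by (simp add: algebra_simps)
    qed
    ultimately show ?case unfolding fsum_power_Suc by simp
  qed
qed

text \<open>
  Modulating \<open>B\<close> with the carrier wave \<open>cos (\<Lambda> x\<^sub>l)\<close> shifts each frequency \<open>q\<close> of \<open>B\<close> to \<open>\<Lambda> e\<^sub>l + q\<close>. The
  amplitude \<open>e\<^sub>i\<close> is corrected along \<open>e\<^sub>l\<close> by a term of order \<open>1/\<Lambda>\<close>, which makes it orthogonal to the new
  frequency.
\<close>

definition wave :: "(real \<times> (real ^ 'n)) list \<Rightarrow> 'n \<Rightarrow> 'n \<Rightarrow> real \<Rightarrow> ('n::finite) trig" where
  "wave bs i l \<Lambda> = map (\<lambda>b. (fst b *\<^sub>R (axis i 1 - (snd b $ i / (\<Lambda> + snd b $ l)) *\<^sub>R axis l 1),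
     \<Lambda> *\<^sub>R axis l 1 + snd b, 0)) bs"

text \<open>
  The component along \<open>e\<^sub>i\<close> is exactly the modulated \<open>B\<close>, the component along \<open>e\<^sub>l\<close> is \<open>O(1/\<Lambda>)\<close>, and a
  derivative of order \<open>k\<close> costs a factor \<open>\<Lambda>\<^sup>k\<close>.
\<close>

lemma wave_properties:
  fixes bs :: "(real \<times> (real ^ 'n::finite)) list"
  assumes il: "i \<noteq> l" and int: "\<And>b. b \<in> set bs \<Longrightarrow> integer_vector (snd b)"
    and B: "\<And>x. (\<Sum>b\<leftarrow>bs. of_real (fst b) * cis (snd b \<bullet> x)) = complex_of_real (B x)"
    and \<Lambda>: "\<Lambda> \<ge> 1" "\<Lambda> \<in> \<int>" and big: "\<And>b. b \<in> set bs \<Longrightarrow> 2 * norm (snd b) \<le> \<Lambda>"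
    and W: "W = (\<Sum>b\<leftarrow>bs. \<bar>fst b\<bar>)" and W2: "W2 = (\<Sum>b\<leftarrow>bs. \<bar>fst b\<bar> * norm (snd b))"
  shows "torus_trig (wave bs i l \<Lambda>) \<in> Vec0"
    and "lift_field (torus_trig (wave bs i l \<Lambda>)) = trig_field (wave bs i l \<Lambda>)"
    and "trig_field (wave bs i l \<Lambda>) x = (cos (\<Lambda> * x $ l) * B x) *\<^sub>R axis i 1
        + (trig_field (wave bs i l \<Lambda>) x $ l) *\<^sub>R axis l 1"
    and "\<bar>trig_field (wave bs i l \<Lambda>) x $ l\<bar> \<le> 2 * W2 / \<Lambda>"
    and "length is \<le> k \<Longrightarrow> norm (iter_partial_deriv is (trig_field (wave bs i l \<Lambda>)) x) \<le> 2 * (2 * \<Lambda>) ^ k * W"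
proof -
  let ?dir = "\<lambda>b. axis i 1 - (snd b $ i / (\<Lambda> + snd b $ l)) *\<^sub>R axis l 1 :: real ^ 'n"
  let ?H = "trig_field (wave bs i l \<Lambda>)"
  have den: "\<Lambda> / 2 \<le> \<Lambda> + snd b $ l" if "b \<in> set bs" for b
    using big[OF that] component_le_norm_cart[of "snd b" l] by linarith
  have den': "\<bar>snd b $ i / (\<Lambda> + snd b $ l)\<bar> \<le> norm (snd b) / (\<Lambda> / 2)" if "b \<in> set bs" for b
  proof -
    have "\<bar>snd b $ i / (\<Lambda> + snd b $ l)\<bar> = \<bar>snd b $ i\<bar> / (\<Lambda> + snd b $ l)"
      using den[OF that] \<Lambda>(1) by (simp add: abs_divide)
    also have "\<dots> \<le> norm (snd b) / (\<Lambda> / 2)"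
      using den[OF that] \<Lambda>(1) component_le_norm_cart[of "snd b" i] by (intro frac_le) auto
    finally show ?thesis .
  qed
  have ints: "\<forall>(c, k, a)\<in>set (wave bs i l \<Lambda>). integer_vector k"
    using int \<Lambda>(2) by (auto simp: wave_def integer_vector_def axis_def)
  have orth: "\<forall>(c, k, a)\<in>set (wave bs i l \<Lambda>). k \<bullet> c = 0"
  proof -
    have "(\<Lambda> *\<^sub>R axis l 1 + snd b) \<bullet> ?dir b = 0"
      if "b \<in> set bs" for b
    proof -
      have "\<Lambda> + snd b $ l \<noteq> 0" using den[OF that] \<Lambda>(1) by linarith
      then show ?thesis
        using il unfolding inner_diff_right inner_scaleR_right inner_axis
        by (simp add: axis_def)
    qed
    then show ?thesis by (auto simp: wave_def)
  qed
  show "torus_trig (wave bs i l \<Lambda>) \<in> Vec0" by (rule torus_trig_Vec0[OF ints orth])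
  show "lift_field (torus_trig (wave bs i l \<Lambda>)) = ?H" by (rule lift_torus_trig[OF ints])
  have comp: "?H x $ j = (\<Sum>b\<leftarrow>bs. cos ((\<Lambda> *\<^sub>R axis l 1 + snd b) \<bullet> x)
      * (fst b * ?dir b $ j))" for j x
    unfolding trig_field_def wave_def by (induction bs) auto
  show "?H x = (cos (\<Lambda> * x $ l) * B x) *\<^sub>R axis i 1 + (?H x $ l) *\<^sub>R axis l 1"
  proof -
    have "?H x $ i = cos (\<Lambda> * x $ l) * B x"
    proof -
      have ip: "(\<Lambda> *\<^sub>R axis l 1 + snd b) \<bullet> x = \<Lambda> * x $ l + snd b \<bullet> x" for b :: "real \<times> (real ^ 'n)"
        by (simp add: inner_add_left inner_axis')
      have "?H x $ i = (\<Sum>b\<leftarrow>bs. Re (cis (\<Lambda> * x $ l) * (of_real (fst b) * cis (snd b \<bullet> x))))"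
        unfolding comp using il
        by (intro arg_cong[where f = sum_list] map_cong refl)
          (simp only: ip, simp add: axis_def cos_add algebra_simps)
      also have "\<dots> = Re (\<Sum>b\<leftarrow>bs. cis (\<Lambda> * x $ l) * (of_real (fst b) * cis (snd b \<bullet> x)))"
        by (induction bs) auto
      also have "\<dots> = Re (cis (\<Lambda> * x $ l) * complex_of_real (B x))"
        unfolding sum_list_const_mult B ..
      finally show ?thesis by simp
    qed
    moreover have "?H x $ j = 0" if "j \<noteq> i" "j \<noteq> l" for j
    proof -
      have "axis i (1::real) $ j = 0" "axis l (1::real) $ j = 0"
        using that by (auto simp: axis_def)
      then show ?thesis unfolding comp by (simp add: sum_list_0)
    qed
    ultimately show ?thesis
      using il by (auto simp: vec_eq_iff axis_def)
  qed
  show "\<bar>?H x $ l\<bar> \<le> 2 * W2 / \<Lambda>"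
  proof -
    have "\<bar>?H x $ l\<bar> \<le> (\<Sum>b\<leftarrow>bs. \<bar>fst b\<bar> * (norm (snd b) / (\<Lambda> / 2)))"
    proof -
      have "\<bar>?H x $ l\<bar> \<le> (\<Sum>b\<leftarrow>bs. \<bar>cos ((\<Lambda> *\<^sub>R axis l 1 + snd b) \<bullet> x)
          * (fst b * ?dir b $ l)\<bar>)"
        unfolding comp using sum_list_abs[of "map _ bs"] by (simp add: o_def)
      also have "\<dots> \<le> (\<Sum>b\<leftarrow>bs. \<bar>fst b\<bar> * (norm (snd b) / (\<Lambda> / 2)))"
      proof (rule sum_list_mono)
        fix b assume b: "b \<in> set bs"
        have e: "?dir b $ l = - (snd b $ i / (\<Lambda> + snd b $ l))"
          using il by (simp add: axis_def)
        have "\<bar>cos ((\<Lambda> *\<^sub>R axis l 1 + snd b) \<bullet> x)\<bar> * \<bar>fst b * - (snd b $ i / (\<Lambda> + snd b $ l))\<bar>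
            \<le> 1 * (\<bar>fst b\<bar> * (norm (snd b) / (\<Lambda> / 2)))"
          unfolding abs_mult abs_minus_cancel using den'[OF b] \<Lambda>(1)
          by (intro mult_mono) auto
        then show "\<bar>cos ((\<Lambda> *\<^sub>R axis l 1 + snd b) \<bullet> x)
          * (fst b * ?dir b $ l)\<bar>
          \<le> \<bar>fst b\<bar> * (norm (snd b) / (\<Lambda> / 2))"
          unfolding e abs_mult by simp
      qed
      finally show ?thesis .
    qed
    also have "\<dots> = 2 * W2 / \<Lambda>"
      unfolding W2 by (induction bs) (auto simp: add_divide_distrib distrib_left)
    finally show ?thesis .
  qed
  show "norm (iter_partial_deriv is ?H x) \<le> 2 * (2 * \<Lambda>) ^ k * W" if len: "length is \<le> k"
  proof -
    have "norm (iter_partial_deriv is ?H x) \<le> (\<Sum>(c, k, a)\<leftarrow>wave bs i l \<Lambda>. norm k ^ length is * norm c)"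
      by (rule norm_iter_partial_deriv_trig_field)
    also have "\<dots> = (\<Sum>b\<leftarrow>bs. norm (\<Lambda> *\<^sub>R axis l 1 + snd b) ^ length is
        * norm (fst b *\<^sub>R ?dir b))"
      unfolding wave_def by (simp add: o_def)
    also have "\<dots> \<le> (\<Sum>b\<leftarrow>bs. (2 * (2 * \<Lambda>) ^ k) * \<bar>fst b\<bar>)"
    proof (rule sum_list_mono)
      fix b assume b: "b \<in> set bs"
      have n1: "norm (axis j (1::real) :: real ^ 'n) = 1" for j by simp
      have "norm (\<Lambda> *\<^sub>R axis l 1 + snd b) \<le> \<Lambda> + norm (snd b)"
        using norm_triangle_ineq[of "\<Lambda> *\<^sub>R axis l 1" "snd b"] \<Lambda>(1) by simp
      then have k1: "norm (\<Lambda> *\<^sub>R axis l 1 + snd b) \<le> 2 * \<Lambda>"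
        using big[OF b] norm_ge_zero[of "snd b"] by linarith
      have "norm (\<Lambda> *\<^sub>R axis l 1 + snd b) ^ length is \<le> (2 * \<Lambda>) ^ length is"
        by (intro power_mono k1) simp
      also have "\<dots> \<le> (2 * \<Lambda>) ^ k"
        using len \<Lambda>(1) by (intro power_increasing) auto
      finally have k2: "norm (\<Lambda> *\<^sub>R axis l 1 + snd b) ^ length is \<le> (2 * \<Lambda>) ^ k" .
      have "norm (snd b) / (\<Lambda> / 2) \<le> 1" using big[OF b] \<Lambda>(1) by simp
      then have "\<bar>snd b $ i / (\<Lambda> + snd b $ l)\<bar> \<le> 1" using den'[OF b] by linarith
      then have "norm (?dir b) \<le> 2"
        using norm_triangle_ineq4[of "axis i 1 :: real ^ 'n" "(snd b $ i / (\<Lambda> + snd b $ l)) *\<^sub>R axis l 1"]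
        by simp
      then have "norm (fst b *\<^sub>R ?dir b) \<le> \<bar>fst b\<bar> * 2"
        unfolding norm_scaleR by (intro mult_left_mono) auto
      then have "norm (\<Lambda> *\<^sub>R axis l 1 + snd b) ^ length is
          * norm (fst b *\<^sub>R ?dir b)
          \<le> (2 * \<Lambda>) ^ k * (\<bar>fst b\<bar> * 2)"
        using k2 \<Lambda>(1) by (intro mult_mono) auto
      then show "norm (\<Lambda> *\<^sub>R axis l 1 + snd b) ^ length is
          * norm (fst b *\<^sub>R ?dir b)
          \<le> (2 * (2 * \<Lambda>) ^ k) * \<bar>fst b\<bar>"
        by (simp add: mult_ac)
    qed
    also have "\<dots> = 2 * (2 * \<Lambda>) ^ k * W"
      unfolding W by (simp add: sum_list_const_mult)
    finally show ?thesis .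
  qed
qed

section \<open>Genericity\<close>

lemma fdiff_power_scaleR_const:
  "(fdiff v ^^ s) (\<lambda>x. g x *\<^sub>R c) = (\<lambda>x. (fdiff v ^^ s) g x *\<^sub>R c)"
proof (induction s)
  case (Suc s)
  show ?case
    by (rule ext, unfold fdiff_power_Suc Suc.IH) (simp add: scaleR_diff_left)
qed simp

text \<open>
  The countably many open dense sets. A bound \<open>\<theta>\<close> strictly below \<open>1 / (n + 1)\<close> leaves room for a perturbation
  of the field.
\<close>

definition delta_fields :: "nat \<Rightarrow> 'n \<Rightarrow> ('n::finite) vfield set" where
  "delta_fields n i = {f \<in> Vec0. \<exists>cs. \<exists>\<theta> < 1 / (real n + 1). (\<Sum>c\<leftarrow>cs. fst c) = 0 \<and>
     norm (translate_sum f cs 0 - axis i 1) \<le> \<theta> \<and>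
     (\<forall>x. bump x \<le> 1 - 1 / (real n + 1) \<longrightarrow> norm (translate_sum f cs x) \<le> \<theta>)}"

lemma delta_fields_separate_points:
  assumes "\<And>n i. f \<in> delta_fields n i"
  shows "separates_points f"
  unfolding separates_points_def
proof (intro allI impI)
  fix i :: 'a and \<epsilon> \<rho> :: real assume \<epsilon>: "0 < \<epsilon>" and \<rho>: "\<rho> < 1"
  obtain n where n: "inverse (real (Suc n)) < min \<epsilon> (1 - \<rho>)"
    using reals_Archimedean[of "min \<epsilon> (1 - \<rho>)"] \<epsilon> \<rho> by auto
  then have n': "1 / (real n + 1) < \<epsilon>" "\<rho> \<le> 1 - 1 / (real n + 1)"
    by (auto simp: inverse_eq_divide add.commute)
  obtain cs \<theta> where "\<theta> < 1 / (real n + 1)" "(\<Sum>c\<leftarrow>cs. fst c) = 0"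
    "norm (translate_sum f cs 0 - axis i 1) \<le> \<theta>"
    "\<And>x. bump x \<le> 1 - 1 / (real n + 1) \<Longrightarrow> norm (translate_sum f cs x) \<le> \<theta>"
    using assms[of n i] unfolding delta_fields_def by blast
  with n' show "\<exists>cs. (\<Sum>c\<leftarrow>cs. fst c) = 0 \<and> norm (translate_sum f cs 0 - axis i 1) \<le> \<epsilon> \<and>
     (\<forall>x. bump x \<le> \<rho> \<longrightarrow> norm (translate_sum f cs x) \<le> \<epsilon>)"
    by (intro exI[of _ cs]) (meson less_imp_le order_trans)
qed

text \<open>
  The combination of translates is finite, so it depends continuously on the field in the supremum norm and
  can be kept.
\<close>

lemma openin_delta_fields: "openin Cinf_topology (delta_fields n i)"
  unfolding openin_Cinf_topology
proof (intro conjI ballI)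
  show "delta_fields n i \<subseteq> Vec0" by (auto simp: delta_fields_def)
  fix f :: "'a vfield" assume "f \<in> delta_fields n i"
  then obtain cs \<theta> where \<theta>: "\<theta> < 1 / (real n + 1)" and c0: "(\<Sum>c\<leftarrow>cs. fst c) = 0"
    and c1: "norm (translate_sum f cs 0 - axis i 1) \<le> \<theta>"
    and c2: "\<And>x. bump x \<le> 1 - 1 / (real n + 1) \<Longrightarrow> norm (translate_sum f cs x) \<le> \<theta>"
    unfolding delta_fields_def by blast
  define W where "W = (\<Sum>c\<leftarrow>cs. \<bar>fst c\<bar>)"
  have W: "0 \<le> W" unfolding W_def by (intro sum_list_nonneg) auto
  define d where "d = 1 / (real n + 1) - \<theta>"
  define e where "e = d / (2 * (W + 1))"
  have d: "d > 0" using \<theta> by (simp add: d_def)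
  have e: "e > 0" "W * e \<le> d / 2" using d W by (auto simp: e_def field_simps)
  have "g \<in> delta_fields n i" if g: "g \<in> Vec0" "Ck_close 0 e f g" for g
  proof -
    have close: "norm (lift_field g x - lift_field f x) \<le> e" for x
      using g(2)[unfolded Ck_close_def, rule_format, of "[]" x] by simp
    have "norm (translate_sum g ds x - translate_sum f ds x) \<le> (\<Sum>c\<leftarrow>ds. \<bar>fst c\<bar>) * e"
      for ds :: "(real \<times> (real ^ 'a)) list" and x
    proof (induction ds)
      case (Cons c ds)
      have "norm (fst c *\<^sub>R (lift_field g (x + snd c) - lift_field f (x + snd c))) \<le> \<bar>fst c\<bar> * e"
        unfolding norm_scaleR by (rule mult_left_mono[OF close abs_ge_zero])
      from norm_triangle_le[OF add_mono[OF this Cons.IH]] show ?case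
        by (simp add: translate_sum_def algebra_simps)
    qed (simp add: translate_sum_def)
    then have "norm (translate_sum g cs x - translate_sum f cs x) \<le> W * e" for x
      unfolding W_def .
    then have diff: "norm (translate_sum g cs x - translate_sum f cs x) \<le> d / 2" for x
      using e(2) order_trans by blast
    have "\<theta> + d / 2 < 1 / (real n + 1)" using d unfolding d_def by argo
    moreover have "norm (translate_sum g cs 0 - axis i 1) \<le> \<theta> + d / 2"
      using diff[of 0] c1 norm_triangle_ineq[of "translate_sum g cs 0 - translate_sum f cs 0" "translate_sum f cs 0 - axis i 1"]
      by simp
    moreover have "norm (translate_sum g cs x) \<le> \<theta> + d / 2" if "bump x \<le> 1 - 1 / (real n + 1)" for x
      using diff[of x] c2[OF that] norm_triangle_sub[of "translate_sum g cs x" "translate_sum f cs x"] by simp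
    ultimately show ?thesis
      unfolding delta_fields_def using g(1) c0 by blast
  qed
  with e(1) show "\<exists>k. \<exists>e>0. \<forall>g\<in>Vec0. Ck_close k e f g \<longrightarrow> g \<in> delta_fields n i" by blast
qed

text \<open>
  The order of the choices matters: the difference order \<open>s = k + 1\<close>, then the exponent \<open>p\<close> that
  localizes \<open>B = bump\<^sup>p\<close>, then the frequency \<open>\<Lambda>\<close>, and last the amplitude \<open>\<epsilon>\<close>, as large as
  \<open>C\<^sup>k\<close>-closeness permits. Three errors have to be small after normalizing the wave at the origin: the
  envelope away from the lattice, the component along \<open>e\<^sub>l\<close>, of size \<open>O(1/\<Lambda>)\<close>, and the difference of the
  original field, of size \<open>\<Lambda>\<^sup>-\<^sup>s / \<epsilon> = O(1/\<Lambda>)\<close>.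
\<close>

lemma dense_delta_fields:
  fixes f :: "('n::finite) vfield"
  assumes card: "CARD('n) \<ge> 2" and f: "f \<in> Vec0" and e: "e > 0"
  shows "\<exists>g\<in>delta_fields n i. Ck_close k e f g"
proof -
  obtain l where il: "i \<noteq> l"
  proof -
    have "UNIV \<noteq> {i}" using card by (metis card.empty card_insert_disjoint empty_iff finite.emptyI
          numeral_2_eq_2 not_less_eq_eq Suc_n_not_le_n)
    then obtain j where "j \<noteq> i" by auto
    then have "i \<noteq> j" by simp
    then show thesis by (rule that)
  qed
  define s where "s = k + 1"
  define \<theta> where "\<theta> = 1 / (real n + 1)"
  define \<rho> where "\<rho> = 1 - \<theta> / 2"
  have \<theta>: "0 < \<theta>" "\<theta> \<le> 1" by (auto simp: \<theta>_def)
  have \<rho>: "0 \<le> \<rho>" "\<rho> < 1" using \<theta> by (auto simp: \<rho>_def)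
  have "(\<lambda>p. 2 ^ s * \<rho> ^ p) \<longlonglongrightarrow> 2 ^ s * 0"
    by (intro tendsto_intros LIMSEQ_realpow_zero \<rho>)
  then have "eventually (\<lambda>p. 2 ^ s * \<rho> ^ p < \<theta> / 4) sequentially"
    using \<theta> by (intro order_tendstoD(2)[of _ "2 ^ s * 0"]) auto
  then obtain p where p: "2 ^ s * \<rho> ^ p < \<theta> / 4"
    unfolding eventually_sequentially by blast
  define B :: "real ^ 'n \<Rightarrow> real" where "B x = bump x ^ p" for x
  obtain bs :: "(real \<times> (real ^ 'n)) list" where int: "\<And>b. b \<in> set bs \<Longrightarrow> integer_vector (snd b)"
    and B: "\<And>x. (\<Sum>b\<leftarrow>bs. of_real (fst b) * cis (snd b \<bullet> x)) = complex_of_real (B x)"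
    using cosine_poly_bump[of p] unfolding cosine_poly_def B_def by blast
  define W where "W = (\<Sum>b\<leftarrow>bs. \<bar>fst b\<bar>)"
  define W2 where "W2 = (\<Sum>b\<leftarrow>bs. \<bar>fst b\<bar> * norm (snd b))"
  define Qm where "Qm = (\<Sum>b\<leftarrow>bs. norm (snd b))"
  have W0: "0 \<le> W" unfolding W_def by (intro sum_list_nonneg) auto
  have W2: "0 \<le> W2" unfolding W2_def by (intro sum_list_nonneg) auto
  have Qm: "0 \<le> Qm" unfolding Qm_def by (intro sum_list_nonneg) auto
  have Qb: "norm (snd b) \<le> Qm" if "b \<in> set bs" for b
    unfolding Qm_def using that by (intro member_le_sum_list) auto
  have W: "0 < W"
  proof -
    have "complex_of_real (\<Sum>b\<leftarrow>bs. fst b) = (\<Sum>b\<leftarrow>bs. of_real (fst b) * cis (snd b \<bullet> 0))"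
      by (induction bs) auto
    also have "\<dots> = 1" unfolding B by (simp add: B_def)
    finally have "complex_of_real (\<Sum>b\<leftarrow>bs. fst b) = 1" .
    then have "(\<Sum>b\<leftarrow>bs. fst b) = 1" by simp
    then show ?thesis
      using sum_list_abs[of "map fst bs"] unfolding W_def by (simp add: o_def)
  qed
  have sm: "smooth_field f" using f by (simp add: Vec0_def)
  obtain C where C: "C > 0" "\<And>x. norm (iter_partial_deriv (replicate s l) (lift_field f) x) \<le> C"
    using smooth_field_iter_bounded[OF sm] by blast
  \<comment> \<open>lower bounds for \<open>\<Lambda>\<close>: \<open>A2\<close> for the shifts \<open>r \<pi> / \<Lambda>\<close> inside the envelope, \<open>A3\<close> for the component along
    \<open>e\<^sub>l\<close>, \<open>A4\<close> for the difference of \<open>f\<close>\<close>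
  define A2 where "A2 = 2 * real s * pi / \<theta>"
  define A3 where "A3 = 2 ^ s * 8 * W2 / \<theta>"
  define A4 where "A4 = 16 * 2 ^ k * W * C * pi ^ s / (e * \<theta>)"
  have A: "0 \<le> A2" "0 \<le> A3" "0 \<le> A4"
    using \<theta> W2 W C e by (auto simp: A2_def A3_def A4_def)
  obtain \<Lambda>n :: nat where \<Lambda>n: "1 + 2 * Qm + A2 + A3 + A4 < real \<Lambda>n"
    using reals_Archimedean2 by blast
  define \<Lambda> where "\<Lambda> = real \<Lambda>n"
  have \<Lambda>: "\<Lambda> \<ge> 1" "\<Lambda> \<in> \<int>" "2 * Qm \<le> \<Lambda>" "A2 \<le> \<Lambda>" "A3 \<le> \<Lambda>" "A4 \<le> \<Lambda>"
    using \<Lambda>n A Qm unfolding \<Lambda>_def by auto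
  have big: "2 * norm (snd b) \<le> \<Lambda>" if "b \<in> set bs" for b
    using Qb[OF that] \<Lambda>(3) by simp
  define H where "H = trig_field (wave bs i l \<Lambda>)"
  define h where "h = torus_trig (wave bs i l \<Lambda>)"
  note wv = wave_properties[of i l bs B \<Lambda> W W2, OF il _ B \<Lambda>(1,2) _ W_def W2_def, folded H_def h_def]
  have h: "h \<in> Vec0" by (rule wv(1)) (use int big in auto)
  have lh: "lift_field h = H" by (rule wv(2)) (use int big in auto)
  have H: "H x = (cos (\<Lambda> * x $ l) * B x) *\<^sub>R axis i 1 + (H x $ l) *\<^sub>R axis l 1" for x
    by (rule wv(3)) (use int big in auto)
  have R: "\<bar>H x $ l\<bar> \<le> 2 * W2 / \<Lambda>" for x
    by (rule wv(4)) (use int big in auto)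
  have D: "norm (iter_partial_deriv is H x) \<le> 2 * (2 * \<Lambda>) ^ k * W" if "length is \<le> k" for "is" x
    by (rule wv(5)) (use int big that in auto)
  define \<epsilon> where "\<epsilon> = e / (4 * (2 * \<Lambda>) ^ k * W)"
  have \<epsilon>: "\<epsilon> > 0" using e W \<Lambda> by (simp add: \<epsilon>_def)
  define g where "g = (\<lambda>p. f p + \<epsilon> *\<^sub>R h p)"
  note gp = Vec0_add_scaleR[OF f h, where e = \<epsilon>, folded g_def]
  have close: "Ck_close k e f g"
    unfolding Ck_close_def gp(3) lh
  proof (intro allI impI)
    fix "is" :: "'n list" and x assume len: "length is \<le> k"
    have "\<epsilon> * norm (iter_partial_deriv is H x) \<le> \<epsilon> * (2 * (2 * \<Lambda>) ^ k * W)"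
      using D[OF len] \<epsilon> by (intro mult_left_mono) auto
    also have "\<dots> = e / 2" using W \<Lambda> by (simp add: \<epsilon>_def)
    finally show "norm (iter_partial_deriv is (lift_field f) x + \<epsilon> *\<^sub>R iter_partial_deriv is H x
        - iter_partial_deriv is (lift_field f) x) < e"
      using \<epsilon> e by simp
  qed
  define v :: "real ^ 'n" where "v = (pi / \<Lambda>) *\<^sub>R axis l 1"
  define ES where "ES = (fsum v ^^ s) B"
  have B0: "0 \<le> B x" for x by (simp add: B_def bump_bounds)
  have ES0: "1 \<le> ES 0"
    using fsum_power_bounds(1)[where B = B and x = 0 and v = v and s = s] B0 by (simp add: ES_def B_def)
  have ESnn: "0 \<le> ES x" for x
    using fsum_power_bounds(1)[where B = B and x = x and v = v and s = s] B0 order_trans unfolding ES_def by blast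
  have ESfar: "ES x \<le> \<theta> / 4" if x: "bump x \<le> 1 - \<theta>" for x
  proof -
    have "ES x \<le> 2 ^ s * \<rho> ^ p"
      unfolding ES_def
    proof (rule fsum_power_bounds(2)[OF B0])
      fix r assume r: "r \<le> s"
      have "real r * pi / \<Lambda> \<le> real s * pi / \<Lambda>"
        using r \<Lambda> by (intro divide_right_mono mult_right_mono) auto
      also have "\<dots> \<le> \<theta> / 2"
        using \<Lambda>(1,4) \<theta> by (simp add: A2_def field_simps)
      finally have small: "real r * pi / \<Lambda> \<le> \<theta> / 2" .
      have "\<bar>real r * pi / \<Lambda>\<bar> = real r * pi / \<Lambda>" using \<Lambda>(1) by simp
      then have "bump (x + (real r * pi / \<Lambda>) *\<^sub>R axis l 1) \<le> bump x + real r * pi / \<Lambda>"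
        using bump_lipschitz_axis[of x "real r * pi / \<Lambda>" l] by (simp only:)
      then have "bump (x + (real r * pi / \<Lambda>) *\<^sub>R axis l 1) \<le> \<rho>"
        using small x unfolding \<rho>_def by argo
      then show "B (x + real r *\<^sub>R v) \<le> \<rho> ^ p"
        unfolding B_def v_def by (intro power_mono) (auto simp: bump_bounds)
    qed
    with p show ?thesis by simp
  qed
  obtain cs where cs0: "(\<Sum>c\<leftarrow>cs. fst c) = 0"
    and cs: "\<And>q x. translate_sum q cs x = (fdiff v ^^ s) (lift_field q) x"
    using fdiff_power_translate_sum[where s = s and v = v] unfolding s_def by auto
  \<comment> \<open>normalizes the component along \<open>e\<^sub>i\<close> to be exactly 1 at the origin\<close>
  define \<kappa> where "\<kappa> = (-1) ^ s / (\<epsilon> * ES 0)"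
  have \<kappa>: "\<bar>\<kappa>\<bar> \<le> 1 / \<epsilon>" "\<bar>\<kappa>\<bar> * \<epsilon> \<le> 1" "\<kappa> * \<epsilon> * (-1) ^ s = 1 / ES 0"
  proof -
    have a: "\<bar>\<kappa>\<bar> = 1 / (\<epsilon> * ES 0)"
      using \<epsilon> ES0 by (simp add: \<kappa>_def abs_mult power_abs)
    show "\<bar>\<kappa>\<bar> \<le> 1 / \<epsilon>" unfolding a using \<epsilon> ES0 by (intro divide_left_mono) auto
    show "\<bar>\<kappa>\<bar> * \<epsilon> \<le> 1" unfolding a using \<epsilon> ES0 by simp
    show "\<kappa> * \<epsilon> * (-1) ^ s = 1 / ES 0" using \<epsilon> by (simp add: \<kappa>_def flip: power_mult_distrib)
  qed
  define ds where "ds = map (\<lambda>c. (\<kappa> * fst c, snd c)) cs"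
  have ds0: "(\<Sum>c\<leftarrow>ds. fst c) = 0"
    using cs0 by (simp add: ds_def o_def sum_list_const_mult)
  have dsk: "translate_sum q ds x = \<kappa> *\<^sub>R translate_sum q cs x" for q x
    unfolding translate_sum_def ds_def by (simp add: o_def scaleR_sum_list_map)
  have expand: "translate_sum g ds x = (cos (\<Lambda> * x $ l) * ES x / ES 0) *\<^sub>R axis i 1
      + (\<kappa> *\<^sub>R (fdiff v ^^ s) (lift_field f) x + (\<kappa> * \<epsilon> * (fdiff v ^^ s) (\<lambda>x. H x $ l) x) *\<^sub>R axis l 1)" for x
  proof -
    have "(fdiff v ^^ s) H x = (fdiff v ^^ s) (\<lambda>x. (cos (\<Lambda> * x $ l) * B x) *\<^sub>R axis i 1 + 1 *\<^sub>R ((H x $ l) *\<^sub>R axis l 1)) x"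
      using H by (simp flip: H)
    also have "\<dots> = ((-1) ^ s * cos (\<Lambda> * x $ l) * ES x) *\<^sub>R axis i 1 + ((fdiff v ^^ s) (\<lambda>x. H x $ l) x) *\<^sub>R axis l 1"
      using \<Lambda>(1) unfolding fdiff_power_add_scaleR fdiff_power_scaleR_const ES_def
      by (subst fdiff_power_wave[OF _ v_def]) auto
    finally have "translate_sum g ds x = \<kappa> *\<^sub>R (fdiff v ^^ s) (lift_field f) x
        + ((\<kappa> * \<epsilon> * (-1) ^ s) * (cos (\<Lambda> * x $ l) * ES x)) *\<^sub>R axis i 1
        + (\<kappa> * \<epsilon> * (fdiff v ^^ s) (\<lambda>x. H x $ l) x) *\<^sub>R axis l 1"
      unfolding dsk cs gp(2) lh fdiff_power_add_scaleR by (simp add: algebra_simps)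
    then show ?thesis unfolding \<kappa>(3) by (simp add: algebra_simps)
  qed
  have rest: "norm (\<kappa> *\<^sub>R (fdiff v ^^ s) (lift_field f) x + (\<kappa> * \<epsilon> * (fdiff v ^^ s) (\<lambda>x. H x $ l) x) *\<^sub>R axis l 1) \<le> \<theta> / 2" for x
  proof -
    have "norm ((fdiff v ^^ s) (lift_field f) x) \<le> C * \<bar>pi / \<Lambda>\<bar> ^ s"
      unfolding v_def using smooth_field_differentiable[OF sm] C(2) by (intro fdiff_power_smooth) auto
    then have "norm (\<kappa> *\<^sub>R (fdiff v ^^ s) (lift_field f) x) \<le> (1 / \<epsilon>) * (C * (pi / \<Lambda>) ^ s)"
      unfolding norm_scaleR using \<kappa>(1) \<epsilon> \<Lambda>(1) C(1) by (intro mult_mono) auto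
    also have "\<dots> = A4 / \<Lambda> * (\<theta> / 4)"
      using e W \<Lambda>(1) \<theta> by (simp add: \<epsilon>_def A4_def s_def power_divide power_mult_distrib field_simps)
    also have "\<dots> \<le> 1 * (\<theta> / 4)"
      using \<Lambda>(1,6) \<theta> by (intro mult_right_mono) auto
    finally have 1: "norm (\<kappa> *\<^sub>R (fdiff v ^^ s) (lift_field f) x) \<le> \<theta> / 4" by simp
    have "norm ((fdiff v ^^ s) (\<lambda>x. H x $ l) x) \<le> 2 ^ s * (2 * W2 / \<Lambda>)"
      by (rule fdiff_power_bound) (use R in simp)
    then have "(\<bar>\<kappa>\<bar> * \<epsilon>) * norm ((fdiff v ^^ s) (\<lambda>x. H x $ l) x) \<le> 1 * (2 ^ s * (2 * W2 / \<Lambda>))"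
      using \<kappa>(2) \<epsilon> by (intro mult_mono) auto
    also have "\<dots> = A3 / \<Lambda> * (\<theta> / 4)"
      using \<theta> by (simp add: A3_def)
    also have "\<dots> \<le> 1 * (\<theta> / 4)"
      using \<Lambda>(1,5) \<theta> by (intro mult_right_mono) auto
    finally have 2: "norm ((\<kappa> * \<epsilon> * (fdiff v ^^ s) (\<lambda>x. H x $ l) x) *\<^sub>R (axis l 1 :: real ^ 'n)) \<le> \<theta> / 4"
      using \<epsilon> by (simp add: abs_mult)
    show ?thesis
      using norm_triangle_le[OF add_mono[OF 1 2]] by simp
  qed
  have at0: "norm (translate_sum g ds 0 - axis i 1) \<le> \<theta> / 2"
    using rest[of 0] ES0 unfolding expand by simp
  have far: "norm (translate_sum g ds x) \<le> 3 / 4 * \<theta>" if "bump x \<le> 1 - \<theta>" for x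
  proof -
    have "norm ((cos (\<Lambda> * x $ l) * ES x / ES 0) *\<^sub>R (axis i 1 :: real ^ 'n)) = \<bar>cos (\<Lambda> * x $ l)\<bar> * (ES x / ES 0)"
      using ES0 ESnn[of x] by (simp add: abs_mult)
    also have "\<dots> \<le> 1 * (ES x / 1)"
      using ES0 ESnn[of x] by (intro mult_mono divide_left_mono) auto
    also have "\<dots> \<le> \<theta> / 4" using ESfar[OF that] by simp
    finally have 3: "norm ((cos (\<Lambda> * x $ l) * ES x / ES 0) *\<^sub>R (axis i 1 :: real ^ 'n)) \<le> \<theta> / 4" .
    show ?thesis
      unfolding expand using norm_triangle_le[OF add_mono[OF 3 rest[of x]]] by simp
  qed
  have "3 / 4 * \<theta> < \<theta>" "\<theta> / 2 \<le> 3 / 4 * \<theta>" using \<theta> by auto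
  then have "g \<in> delta_fields n i"
    using gp(1) ds0 at0 far unfolding delta_fields_def \<theta>_def[symmetric]
    by (intro CollectI conjI exI[of _ ds] exI[of _ "3 / 4 * \<theta>"]) auto
  with close show ?thesis by blast
qed

theorem residual_separates_points:
  assumes card: "CARD('n::finite) \<ge> 2"
  shows "residual_in Cinf_topology {f \<in> (Vec0 :: 'n vfield set). separates_points f}"
  unfolding residual_in_def topspace_Cinf_topology
proof (intro conjI exI[of _ "range (\<lambda>(n, i). delta_fields n i)"] ballI)
  show "countable (range (\<lambda>(n, i :: 'n). delta_fields n i))"
    unfolding UNIV_Times_UNIV[symmetric]
    by (intro countable_image countable_SIGMA) (auto intro: countable_finite)
  fix U :: "'n vfield set" assume "U \<in> range (\<lambda>(n, i). delta_fields n i)"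
  then obtain n i where U: "U = delta_fields n i" by auto
  show "openin Cinf_topology U"
    unfolding U by (rule openin_delta_fields)
  show "Cinf_topology closure_of U = Vec0"
  proof
    show "Cinf_topology closure_of U \<subseteq> Vec0"
      using closure_of_subset_topspace[of Cinf_topology U] by (simp add: topspace_Cinf_topology)
    show "Vec0 \<subseteq> Cinf_topology closure_of U"
    proof
      fix f :: "'n vfield" assume f: "f \<in> Vec0"
      show "f \<in> Cinf_topology closure_of U"
        unfolding in_closure_of topspace_Cinf_topology
      proof (intro conjI f allI impI, elim conjE)
        fix V assume "f \<in> V" "openin Cinf_topology V"
        then obtain k e where ke: "e > 0" "\<forall>g\<in>Vec0. Ck_close k e f g \<longrightarrow> g \<in> V"
          unfolding openin_Cinf_topology by blast
        obtain g where "g \<in> U" "Ck_close k e f g"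
          using dense_delta_fields[OF card f ke(1)] unfolding U by blast
        with ke(2) show "\<exists>y. y \<in> U \<and> y \<in> V"
          unfolding U delta_fields_def by blast
      qed
    qed
  qed
next
  show "Vec0 \<inter> \<Inter> (range (\<lambda>(n, i). delta_fields n i)) \<subseteq> {f \<in> (Vec0 :: 'n vfield set). separates_points f}"
    using delta_fields_separate_points by fastforce
qed auto

section \<open>Global reachability of ensembles\<close>

lemma countable_period_lattice: "countable (period_lattice :: (real ^ 'n::finite) set)"
proof (rule countable_subset)
  show "(period_lattice :: (real ^ 'n) set) \<subseteq> range (\<lambda>n :: 'n \<Rightarrow> int. \<chi> i. 2 * pi * of_int (n i))"
  proof
    fix k :: "real ^ 'n" assume "k \<in> period_lattice"
    then obtain n :: "'n \<Rightarrow> int" where "\<And>i. k $ i = 2 * pi * of_int (n i)"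
      unfolding period_lattice_def mem_Collect_eq by metis
    then have "k = (\<chi> i. 2 * pi * of_int (n i))" by (simp add: vec_eq_iff)
    then show "k \<in> range (\<lambda>n :: 'n \<Rightarrow> int. \<chi> i. 2 * pi * of_int (n i))" by blast
  qed
qed simp

lemma lattice_diff_commute: "x - y \<in> period_lattice \<longleftrightarrow> y - x \<in> period_lattice"
  using period_lattice_uminus[of "x - y"] period_lattice_uminus[of "y - x"] by auto

lemma countable_lattice_translates:
  fixes C :: "(real ^ 'n::finite) set"
  assumes "finite C"
  shows "countable {y. \<exists>c\<in>C. y - c \<in> period_lattice}"
proof -
  have "{y. \<exists>c\<in>C. y - c \<in> period_lattice} \<subseteq> (\<Union>c\<in>C. (\<lambda>k. c + k) ` period_lattice)"
    by (auto simp: image_iff) (metis add.commute diff_add_cancel)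
  then show ?thesis
    by (rule countable_subset)
      (intro countable_UN countable_image countable_period_lattice countable_finite assms)
qed

text \<open>
  Points are added one by one outside a countable set.
\<close>

lemma obtain_distinct_points_avoiding:
  fixes C :: "(real ^ 'n::finite) set"
  assumes "finite C"
  shows "\<exists>\<zeta>. distinct_points N \<zeta> \<and> (\<forall>i<N. \<forall>c\<in>C. \<zeta> i - c \<notin> period_lattice)"
proof (induction N)
  case 0
  show ?case by (simp add: distinct_points_def)
next
  case (Suc N)
  then obtain \<zeta> where \<zeta>: "distinct_points N \<zeta>" "\<And>i c. i < N \<Longrightarrow> c \<in> C \<Longrightarrow> \<zeta> i - c \<notin> period_lattice"
    by blast
  let ?B = "{y. \<exists>c\<in>C \<union> \<zeta> ` {..<N}. y - c \<in> period_lattice}"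
  have cB: "countable ?B"
    by (rule countable_lattice_translates) (use assms in auto)
  have unc: "uncountable (UNIV :: (real ^ 'n) set)"
  proof
    assume "countable (UNIV :: (real ^ 'n) set)"
    then have "countable ((\<lambda>x :: real ^ 'n. x $ undefined) ` UNIV)" by (rule countable_image)
    moreover have "(\<lambda>x :: real ^ 'n. x $ undefined) ` UNIV = UNIV"
    proof -
      have "t = (vec t :: real ^ 'n) $ undefined" for t by simp
      then show ?thesis by blast
    qed
    ultimately show False using uncountable_UNIV_real by simp
  qed
  have "?B \<noteq> UNIV"
  proof
    assume "?B = UNIV"
    with cB have "countable (UNIV :: (real ^ 'n) set)" by (simp only:)
    with unc show False by (rule notE)
  qed
  moreover have "\<exists>z. z \<notin> A" if "A \<noteq> UNIV" for A :: "(real ^ 'n) set"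
    using that by blast
  ultimately obtain z where z: "z \<notin> ?B" by blast
  have "distinct_points (Suc N) (\<zeta>(N := z))"
    unfolding distinct_points_def
  proof (intro allI impI)
    fix j k assume "j < Suc N" "k < Suc N" "j \<noteq> k"
    then consider "j < N" "k < N" "j \<noteq> k" | "j = N" "k < N" | "j < N" "k = N" by linarith
    then show "(\<zeta>(N := z)) j - (\<zeta>(N := z)) k \<notin> period_lattice"
    proof cases
      case 1
      then show ?thesis using \<zeta>(1) by (simp add: distinct_points_def)
    next
      case 2
      then show ?thesis using z by auto
    next
      case 3
      then show ?thesis using z lattice_diff_commute[of "\<zeta> j" z] by auto
    qed
  qed
  moreover have "(\<zeta>(N := z)) i - c \<notin> period_lattice" if "i < Suc N" "c \<in> C" for i c
    using that \<zeta>(2)[of i c] z by (cases "i = N") auto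
  ultimately show ?case by blast
qed

context drift
begin

text \<open>
  The admissible positions of one point, the others being fixed, form the complement of a countable set, which
  is connected in dimension at least 2. By \<open>local_reach\<close> mutual reachability is an equivalence relation on it
  with open classes.
\<close>

lemma reach_move_one:
  assumes card: "CARD('n) \<ge> 2" and span: "positively_spanning m" and i: "i < N"
    and x: "distinct_points N (x(i := a))" "distinct_points N (x(i := b))"
  shows "reach f N (x(i := a)) (x(i := b))"
proof -
  define S where "S = {y. distinct_points N (x(i := y))}"
  let ?B = "{y. \<exists>c\<in>x ` ({..<N} - {i}). y - c \<in> period_lattice}"
  have others: "x j - x k \<notin> period_lattice" if "j < N" "k < N" "j \<noteq> k" "j \<noteq> i" "k \<noteq> i" for j k
    using x(1) that unfolding distinct_points_def by fastforce
  have "S = - ?B"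
  proof (intro set_eqI iffI)
    fix y assume y: "y \<in> S"
    show "y \<in> - ?B"
    proof
      assume "y \<in> ?B"
      then obtain k where "k < N" "k \<noteq> i" "y - x k \<in> period_lattice" by auto
      moreover have "(x(i := y)) i - (x(i := y)) k \<notin> period_lattice"
        using y i calculation unfolding S_def distinct_points_def by blast
      ultimately show False by simp
    qed
  next
    fix y assume y: "y \<in> - ?B"
    have "y - x k \<notin> period_lattice" "x k - y \<notin> period_lattice" if "k < N" "k \<noteq> i" for k
      using y that lattice_diff_commute[of "x k" y] by auto
    then show "y \<in> S"
      using others i unfolding S_def distinct_points_def by auto
  qed
  moreover have "countable ?B"
    by (rule countable_lattice_translates) auto
  ultimately have "connected S"
    using path_connected_complement_countable[of ?B] card by (simp add: path_connected_imp_connected)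
  then have "reach f N (x(i := a)) (x(i := b)) \<and> reach f N (x(i := b)) (x(i := a))"
  proof (rule connected_equivalence_relation[where
      R = "\<lambda>a b. reach f N (x(i := a)) (x(i := b)) \<and> reach f N (x(i := b)) (x(i := a))"])
    show "a \<in> S" "b \<in> S" using x by (auto simp: S_def)
    fix c assume c: "c \<in> S"
    then obtain r where r: "r > 0" and rr: "\<And>y y'. (\<forall>j<N. norm (y j - (x(i := c)) j) \<le> r \<and> norm (y' j - (x(i := c)) j) \<le> r)
        \<Longrightarrow> reach f N y y'"
      using local_reach[OF span, of N "x(i := c)"] unfolding S_def by blast
    have "reach f N (x(i := c)) (x(i := d)) \<and> reach f N (x(i := d)) (x(i := c))" if "d \<in> S \<inter> ball c r" for d
      using that r by (intro conjI rr) (auto simp: dist_norm norm_minus_commute less_imp_le)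
    moreover have "openin (top_of_set S) (S \<inter> ball c r)" by (simp add: openin_open_Int)
    moreover have "c \<in> S \<inter> ball c r" using c r by simp
    ultimately show "\<exists>T. openin (top_of_set S) T \<and> c \<in> T \<and>
        (\<forall>d\<in>T. reach f N (x(i := c)) (x(i := d)) \<and> reach f N (x(i := d)) (x(i := c)))"
      by blast
  qed (auto intro: reach_trans)
  then show ?thesis by blast
qed

text \<open>
  The points are moved one after the other. Disjointness of start and target keeps the mixed ensembles
  distinct.
\<close>

lemma reach_disjoint:
  assumes card: "CARD('n) \<ge> 2" and span: "positively_spanning m"
    and x: "distinct_points N x" and y: "distinct_points N y"
    and disj: "\<And>i j. i < N \<Longrightarrow> j < N \<Longrightarrow> x i - y j \<notin> period_lattice"
  shows "reach f N x y"
proof -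
  have disj': "y j - x i \<notin> period_lattice" if "i < N" "j < N" for i j
    using disj[OF that] lattice_diff_commute[of "x i" "y j"] by simp
  define z where "z k j = (if j < k then y j else x j)" for k j :: nat
  have dz: "distinct_points N (z k)" for k
    using x y disj disj' unfolding distinct_points_def z_def by auto
  have "reach f N x (z k)" if "k \<le> N" for k
    using that
  proof (induction k)
    case 0
    have "z 0 = x" by (simp add: z_def fun_eq_iff)
    then show ?case by (simp add: reach_refl)
  next
    case (Suc k)
    have e: "z k = (z k)(k := x k)" "z (Suc k) = (z k)(k := y k)"
      by (auto simp: z_def fun_eq_iff)
    have "reach f N ((z k)(k := x k)) ((z k)(k := y k))"
      by (rule reach_move_one[OF card span]) (use dz[of k] dz[of "Suc k"] e Suc.prems in auto)
    then have "reach f N (z k) (z (Suc k))" using e by simp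
    with Suc show ?case using reach_trans by (metis Suc_leD)
  qed
  from this[of N] show ?thesis
    by (auto intro: reach_cong simp: z_def)
qed

lemma reach_all:
  assumes card: "CARD('n) \<ge> 2" and span: "positively_spanning m"
    and x: "distinct_points N x" and y: "distinct_points N y"
  shows "reach f N x y"
proof -
  obtain \<zeta> where \<zeta>: "distinct_points N \<zeta>" "\<forall>i<N. \<forall>c\<in>x ` {..<N} \<union> y ` {..<N}. \<zeta> i - c \<notin> period_lattice"
    using obtain_distinct_points_avoiding[of "x ` {..<N} \<union> y ` {..<N}" N] by auto
  have "reach f N x \<zeta>"
    by (rule reach_disjoint[OF card span x \<zeta>(1)]) (use \<zeta>(2) lattice_diff_commute in auto)
  moreover have "reach f N \<zeta> y"
    by (rule reach_disjoint[OF card span \<zeta>(1) y]) (use \<zeta>(2) in auto)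
  ultimately show ?thesis by (rule reach_trans)
qed

lemma distinct_points_rep:
  assumes "\<gamma> \<in> ensembles N"
  shows "distinct_points N (\<lambda>j. rep_torus (\<gamma> ! j))"
  using assms unfolding distinct_points_def ensembles_def
  by (auto simp: nth_eq_iff_index_eq simp flip: torus_proj_eq_iff)

theorem globally_controllable_if_separates_points:
  assumes card: "CARD('n) \<ge> 2" and sep: "separates_points f"
  shows "globally_controllable f N"
  unfolding globally_controllable_def
proof (intro ballI equalityI subsetI)
  fix \<gamma> \<eta> :: "'n torus list"
  assume \<gamma>: "\<gamma> \<in> ensembles N"
  {
    assume "\<eta> \<in> (\<Union>t\<in>{0..}. attainable f \<gamma> t)"
    then obtain t u where "0 \<le> t" "admissible_control t u" "\<eta> = map (flow f u t) \<gamma>"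
      unfolding attainable_def by auto
    then show "\<eta> \<in> ensembles N"
      using \<gamma> inj_flow[of t u] inj_on_subset[OF _ subset_UNIV]
      by (auto simp: ensembles_def distinct_map)
  }
  assume \<eta>: "\<eta> \<in> ensembles N"
  obtain m where "positively_spanning m"
    using separates_points_imp_positively_spanning[OF sep] by blast
  then have "reach f N (\<lambda>j. rep_torus (\<gamma> ! j)) (\<lambda>j. rep_torus (\<eta> ! j))"
    by (rule reach_all[OF card _ distinct_points_rep[OF \<gamma>] distinct_points_rep[OF \<eta>]])
  then obtain t u B where t: "0 \<le> t" and u: "u \<in> borel_measurable borel" "\<And>s. norm (u s) \<le> B"
    and tr: "\<And>j. j < N \<Longrightarrow> \<exists>\<xi>. lifted_trajectory f u t \<xi> \<and> \<xi> 0 = rep_torus (\<gamma> ! j) \<and> \<xi> t = rep_torus (\<eta> ! j)"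
    unfolding reach_def by blast
  have len: "length \<gamma> = N" "length \<eta> = N" using \<gamma> \<eta> by (auto simp: ensembles_def)
  have "\<eta> = map (flow f u t) \<gamma>"
  proof (rule nth_equalityI)
    fix j assume "j < length \<eta>"
    then have j: "j < N" using len by simp
    then obtain \<xi> where \<xi>: "lifted_trajectory f u t \<xi>" "\<xi> 0 = rep_torus (\<gamma> ! j)" "\<xi> t = rep_torus (\<eta> ! j)"
      using tr by blast
    show "\<eta> ! j = map (flow f u t) \<gamma> ! j"
      using flow_eq[OF \<xi>(1) t] \<xi> j len by simp
  qed (simp add: len)
  then have "\<eta> \<in> attainable f \<gamma> t"
    unfolding attainable_def using bounded_borel_admissible[OF u, of t] by blast
  then show "\<eta> \<in> (\<Union>t\<in>{0..}. attainable f \<gamma> t)"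
    using t by auto
qed

text \<open>
  Start with two points at distance \<open>exp (- L T)\<close>. Their lifts stay within distance 1 up to time \<open>T\<close>, but
  any two lifts of the target points \<open>0\<close> and \<open>\<pi> e\<^sub>i\<close> are at distance at least \<open>\<pi>\<close>.
\<close>

theorem not_globally_controllable_within:
  assumes N: "N \<ge> 2"
  shows "\<not> globally_controllable_within f N T"
proof
  assume ctr: "globally_controllable_within f N T"
  fix i :: 'n
  define b :: "real ^ 'n" where "b = exp (- (L * max 0 T)) *\<^sub>R axis i 1"
  define q :: "real ^ 'n" where "q = pi *\<^sub>R axis i 1"
  have far: "pi \<le> norm (x - y)" if xy: "x \<in> period_lattice" "y - q \<in> period_lattice" for x y
  proof -
    obtain k l :: int where k: "x $ i = 2 * pi * of_int k" and l: "(y - q) $ i = 2 * pi * of_int l"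
      using xy unfolding period_lattice_def by blast
    have "(x - y) $ i = pi * of_int (2 * (k - l) - 1)"
      using k l by (simp add: q_def axis_def algebra_simps)
    moreover have "1 \<le> \<bar>2 * (k - l) - 1\<bar>" by presburger
    then have "pi * 1 \<le> pi * \<bar>of_int (2 * (k - l) - 1)\<bar>"
      by (intro mult_left_mono) (simp_all only: of_int_abs[symmetric] of_int_1_le_iff pi_ge_zero)
    ultimately have "pi \<le> \<bar>(x - y) $ i\<bar>" by (simp add: abs_mult)
    then show ?thesis using component_le_norm_cart[of "x - y" i] by linarith
  qed
  have ex: "\<exists>rest. torus_proj 0 # torus_proj w # rest \<in> ensembles N" if w: "w \<notin> period_lattice" for w :: "real ^ 'n"
  proof -
    obtain \<zeta> where \<zeta>: "distinct_points (N - 2) \<zeta>" "\<forall>i<N - 2. \<forall>c\<in>{0, w}. \<zeta> i - c \<notin> period_lattice"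
      using obtain_distinct_points_avoiding[of "{0, w}" "N - 2"] by auto
    have inj: "inj_on (\<lambda>j. torus_proj (\<zeta> j)) {0..<N - 2}"
    proof (rule inj_onI)
      fix j k assume jk: "j \<in> {0..<N - 2}" "k \<in> {0..<N - 2}" "torus_proj (\<zeta> j) = torus_proj (\<zeta> k)"
      then show "j = k"
        using \<zeta>(1)[unfolded distinct_points_def, rule_format, of j k] by (cases "j = k") (auto simp: torus_proj_eq_iff)
    qed
    have zw: "- \<zeta> j \<notin> period_lattice" "w - \<zeta> j \<notin> period_lattice" if "j < N - 2" for j
      using \<zeta>(2) that lattice_diff_commute[of 0 "\<zeta> j"] lattice_diff_commute[of w "\<zeta> j"] by auto
    have "torus_proj 0 # torus_proj w # map (\<lambda>j. torus_proj (\<zeta> j)) [0..<N - 2] \<in> ensembles N"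
      using zw w N inj lattice_diff_commute[of 0 w]
      by (auto simp: ensembles_def distinct_map torus_proj_eq_iff)
    then show ?thesis by blast
  qed
  have "b \<notin> period_lattice"
  proof
    assume "b \<in> period_lattice"
    then obtain k :: int where k: "b $ i = 2 * pi * of_int k" unfolding period_lattice_def by blast
    have bi: "0 < b $ i" "b $ i \<le> 1" using L_pos by (auto simp: b_def axis_def)
    have "k \<ge> 1"
      using bi(1) unfolding k by (simp add: zero_less_mult_iff)
    then have "2 * pi * 1 \<le> 2 * pi * of_int k" by (intro mult_left_mono) auto
    then show False using bi(2) pi_gt3 unfolding k by linarith
  qed
  then obtain r where \<gamma>: "torus_proj 0 # torus_proj b # r \<in> ensembles N" using ex by blast
  have "q \<notin> period_lattice"
    using far[of q q] pi_gt_zero by auto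
  then obtain r' where \<eta>: "torus_proj 0 # torus_proj q # r' \<in> ensembles N" using ex by blast
  obtain t u where t: "0 \<le> t" "t \<le> T" and u: "admissible_control t u"
    and "torus_proj 0 # torus_proj q # r' = map (flow f u t) (torus_proj 0 # torus_proj b # r)"
  proof -
    have "(\<Union>t\<in>{0..T}. attainable f (torus_proj 0 # torus_proj b # r) t) = ensembles N"
      using ctr \<gamma> unfolding globally_controllable_within_def by (rule bspec)
    with \<eta> have "torus_proj 0 # torus_proj q # r'
        \<in> (\<Union>t\<in>{0..T}. attainable f (torus_proj 0 # torus_proj b # r) t)"
      by (simp only:)
    then obtain t where "t \<in> {0..T}"
      and "torus_proj 0 # torus_proj q # r' \<in> attainable f (torus_proj 0 # torus_proj b # r) t"
      by (rule UN_E)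
    then show thesis
      unfolding attainable_def by (auto intro: that)
  qed
  then have fl: "flow f u t (torus_proj 0) = torus_proj 0" "flow f u t (torus_proj b) = torus_proj q"
    by auto
  obtain \<xi> where \<xi>: "lifted_trajectory f u t \<xi>" "\<xi> 0 = 0" "flow f u t (torus_proj 0) = torus_proj (\<xi> t)"
    using obtain_flow_trajectory[OF u t(1)] .
  obtain \<xi>' where \<xi>': "lifted_trajectory f u t \<xi>'" "\<xi>' 0 = b" "flow f u t (torus_proj b) = torus_proj (\<xi>' t)"
    using obtain_flow_trajectory[OF u t(1)] .
  have "\<xi> t \<in> period_lattice" "\<xi>' t - q \<in> period_lattice"
    using fl \<xi>(3) \<xi>'(3) torus_proj_eq_iff[of "\<xi> t" 0] torus_proj_eq_iff[of "\<xi>' t" q] by auto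
  then have "pi \<le> norm (\<xi> t - \<xi>' t)" by (rule far)
  also have "\<dots> \<le> exp (L * t) * norm (\<xi> 0 - \<xi>' 0)"
    using trajectories_separation(1)[OF \<xi>(1) \<xi>'(1), of t] t by simp
  also have "\<dots> = exp (L * t) * exp (- (L * max 0 T))"
    using \<xi>(2) \<xi>'(2) by (simp add: b_def)
  also have "\<dots> \<le> 1"
    using t L_pos by (simp flip: exp_add)
  finally show False using pi_gt3 by simp
qed

end

lemma Vec0_drift:
  assumes "f \<in> Vec0"
  obtains L M where "drift f L M"
proof -
  have sm: "smooth_field f" using assms by (simp add: Vec0_def)
  obtain L where "L > 0" "\<And>x y. norm (lift_field f x - lift_field f y) \<le> L * norm (x - y)"
    using smooth_field_lipschitz[OF sm] by blast
  moreover obtain M where "M > 0" "\<And>x. norm (lift_field f x) \<le> M"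
    using smooth_field_iter_bounded[OF sm, of "[]"] by auto
  ultimately have "drift f L M" by unfold_locales auto
  then show thesis by (rule that)
qed

theorem theorem5:
  shows "((CARD('n::finite) = 2 \<or> CARD('n) = 3) \<longrightarrow>
            (\<exists>R :: 'n vfield set. residual_in Cinf_topology R \<and>
               (\<forall>f\<in>R. \<forall>N\<ge>1. globally_controllable f N))) \<and>
         (CARD('n) \<ge> 2 \<longrightarrow>
            (\<forall>f \<in> (Vec0 :: 'n vfield set). \<forall>N\<ge>2. \<forall>T>0.
               \<not> globally_controllable_within f N T))"
proof (intro conjI impI ballI allI)
  assume "CARD('n) = 2 \<or> CARD('n) = 3"
  then have card: "CARD('n) \<ge> 2" by auto
  have "globally_controllable f N" if f: "f \<in> {f \<in> (Vec0 :: 'n vfield set). separates_points f}" for f N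
  proof -
    have "f \<in> Vec0" "separates_points f" using f by auto
    obtain L M where "drift f L M" using Vec0_drift[OF \<open>f \<in> Vec0\<close>] .
    then show ?thesis
      by (rule drift.globally_controllable_if_separates_points[OF _ card \<open>separates_points f\<close>])
  qed
  with residual_separates_points[OF card]
  show "\<exists>R :: 'n vfield set. residual_in Cinf_topology R \<and> (\<forall>f\<in>R. \<forall>N\<ge>1. globally_controllable f N)"
    by blast
next
  fix f :: "'n vfield" and N :: nat and T :: real
  assume "f \<in> Vec0" and N: "N \<ge> 2"
  obtain L M where "drift f L M" using Vec0_drift[OF \<open>f \<in> Vec0\<close>] .
  then show "\<not> globally_controllable_within f N T"
    by (rule drift.not_globally_controllable_within[OF _ N])
qed

end
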